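(* Let $V$ be a simple Euclidean Jordan algebra of rank $r$, $B(t)=\Gamma(\lambda)\widetilde I_{\lambda-1}(2\sqrt t)$ (an entire function of $t$), $B(x|y)=B((x|y))$, and for $t>0$, $x,y\in\Xi$ set $$\Gamma(t,x,y):=(2t)^{-r\lambda}\,e^{-\frac1t(\operatorname{tr}(x)+\operatorname{tr}(y))}\,B\big(\tfrac xt\,\big|\,\tfrac yt\big).$$ Then for all $s,t>0$ and $x,y\in\Xi$: (1) $\Gamma(t,x,y)=2^{-2r\lambda}\int_\Xi e^{-t\operatorname{tr}(\xi)}B(-(x|\xi))B(-(y|\xi))\,d\mu(\xi)$. (2) $\int_\Xi\Gamma(t,x,y)\,d\mu(y)=1$. (3) $\int_\Xi\Gamma(s,x,z)\Gamma(t,y,z)\,d\mu(z)=\Gamma(s+t,x,y)$. (4) For every $y\in\Xi$ the function $(t,x)\mapsto\Gamma(t,x,y)$ solves the heat equation $(\mathcal B_{\mathbf e}-\partial_t)u=0$ ($\mathcal B_{\mathbf e}$ acting in $x$).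
   Context: $V$ has unit $\mathbf e$; $d$ = dimension of the off-diagonal Peirce spaces; $\lambda=\frac d2$ if $r>1$, $\lambda\in(0,\infty)$ arbitrary if $r=1$. $(x|y)=\operatorname{tr}(xy)$; $L(x)$ multiplication, $P(x,y)=L(x)L(y)+L(y)L(x)-L(xy)$. $L=\operatorname{Str}(V)_0$ is the identity component of the structure group, $K^L=\{g\in L:g\mathbf e=\mathbf e\}$, $c_1$ a primitive idempotent, $\Xi=L\cdot c_1$, $\int_\Xi f\,d\mu=\frac{2^{r\lambda}}{\Gamma(r\lambda)}\int_{K^L}\int_0^\infty f(ktc_1)t^{r\lambda-1}dt\,dk$ with $dk$ the normalized Haar measure. $\widetilde I_\alpha(t)=(t/2)^{-\alpha}I_\alpha(t)$. The Bessel operator $\mathcal Bf=\sum_{\alpha,\beta}\frac{\partial^2f}{\partial x_\alpha\partial x_\beta}P(e_\alpha,e_\beta)x+\lambda\sum_\alpha\frac{\partial f}{\partial x_\alpha}e_\alpha$ (orthonormal basis $(e_\alpha)$ of $V$) is tangential to $\Xi$, and $\mathcal B_{\mathbf e}=(\mathbf e|\mathcal B)$, a second order differential operator on $\Xi$. *)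

theory Defs
  imports "HOL-Analysis.Analysis"
begin

section \<open>Modified Bessel functions\<close>

definition bessel_I :: "real \<Rightarrow> complex \<Rightarrow> complex" where
  "bessel_I \<alpha> z = (z / 2) powr of_real \<alpha> *
     (\<Sum>k. rGamma (of_real \<alpha> + of_nat k + 1) / fact k * (z / 2) ^ (2 * k))"

text \<open>The normalized function is \<open>(z/2)\<^sup>-\<^sup>\<alpha> I\<^sub>\<alpha>(z)\<close>, an entire function; the value at \<open>0\<close>
  fills in the removable singularity, where \<open>powr\<close> is of no use.\<close>

definition bessel_I_tilde :: "real \<Rightarrow> complex \<Rightarrow> complex" where
  "bessel_I_tilde \<alpha> z =
     (if z = 0 then rGamma (of_real \<alpha> + 1) else (z / 2) powr (- of_real \<alpha>) * bessel_I \<alpha> z)"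

text \<open>For \<open>t < 0\<close> the square root is imaginary, but the value is still real, see
  \<open>bessel_B_series\<close> below; \<open>Re\<close> only adjusts the type.\<close>

definition bessel_B :: "real \<Rightarrow> real \<Rightarrow> real" where
  "bessel_B lam t = Re (of_real (Gamma lam) * bessel_I_tilde (lam - 1) (2 * csqrt (of_real t)))"

lemma bessel_I_tilde_series:
  "bessel_I_tilde \<alpha> z = (\<Sum>k. rGamma (of_real \<alpha> + of_nat k + 1) / fact k * (z / 2) ^ (2 * k))"
proof (cases "z = 0")
  case True
  have "(\<Sum>k. rGamma (of_real \<alpha> + of_nat k + 1) / fact k * (0::complex) ^ (2 * k)) =
        (\<Sum>k\<in>{0}. rGamma (of_real \<alpha> + of_nat k + 1) / fact k * (0::complex) ^ (2 * k))"
    by (rule suminf_finite) auto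
  then show ?thesis using True by (simp add: bessel_I_tilde_def)
next
  case False
  then have "(z / 2) powr (- of_real \<alpha>) * (z / 2) powr of_real \<alpha> = 1"
    by (simp add: powr_minus)
  then show ?thesis using False
    by (simp add: bessel_I_tilde_def bessel_I_def mult.assoc [symmetric])
qed

lemma bessel_B_series:
  assumes "lam > 0"
  shows "of_real (Gamma lam) * bessel_I_tilde (lam - 1) (2 * csqrt (of_real t)) =
           complex_of_real (bessel_B lam t)"
    and "bessel_B lam t = (\<Sum>k. Gamma lam / (fact k * Gamma (lam + real k)) * t ^ k)"
proof -
  define a where "a k = rGamma (lam + real k) / fact k * t ^ k" for k
  have rG: "rGamma (lam + real k) = (lam + real k) * rGamma (lam + real (Suc k))" for k
    using rGamma_plus1[of "lam + real k"] by (simp add: add_ac)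
  obtain N :: nat where N: "2 * \<bar>t\<bar> / lam < real N"
    using reals_Archimedean2 by blast
  have "summable a"
  proof (rule summable_ratio_test[of "1/2" N])
    fix k assume "k \<ge> N"
    with N have "2 * \<bar>t\<bar> / lam \<le> real k + 1" by linarith
    then have "2 * \<bar>t\<bar> \<le> (real k + 1) * lam" using assms by (simp add: field_simps)
    also have "\<dots> \<le> (real k + 1) * (lam + real k)" by (intro mult_left_mono) auto
    finally have le: "\<bar>t\<bar> \<le> 1/2 * ((real k + 1) * (lam + real k))" by simp
    define b where "b = \<bar>rGamma (lam + real (Suc k))\<bar> * \<bar>t\<bar> ^ k / fact (Suc k)"
    have "norm (a (Suc k)) = \<bar>t\<bar> * b"
      by (simp add: a_def b_def abs_mult power_abs)
    also have "\<dots> \<le> 1/2 * ((real k + 1) * (lam + real k)) * b"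
      using le by (rule mult_right_mono) (simp add: b_def)
    also have "(real k + 1) * (lam + real k) * b = norm (a k)"
    proof -
      have "norm (a k) = (lam + real k) * (\<bar>rGamma (lam + real (Suc k))\<bar> * \<bar>t\<bar> ^ k) / fact k"
        unfolding a_def rG[of k] using assms by (simp add: abs_mult power_abs)
      moreover have "fact (Suc k) = (real k + 1) * fact k" by (simp add: add.commute)
      moreover have "real k + 1 \<noteq> 0" by linarith
      ultimately show ?thesis by (simp add: b_def del: fact_Suc)
    qed
    then have "1/2 * ((real k + 1) * (lam + real k)) * b = 1/2 * norm (a k)" by simp
    finally show "norm (a (Suc k)) \<le> 1/2 * norm (a k)" .
  qed simp
  have "rGamma (complex_of_real (lam - 1) + of_nat k + 1) / fact k * csqrt (of_real t) ^ (2 * k)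
      = of_real (a k)" for k
  proof -
    have "complex_of_real (lam - 1) + of_nat k + 1 = of_real (lam + real k)" by simp
    then show ?thesis
      by (simp only: rGamma_complex_of_real power_mult power2_csqrt)
         (simp add: a_def)
  qed
  then have "bessel_I_tilde (lam - 1) (2 * csqrt (of_real t)) = of_real (suminf a)"
    using suminf_of_real[OF \<open>summable a\<close>, where 'a = complex]
    by (simp add: bessel_I_tilde_series)
  then have eq: "of_real (Gamma lam) * bessel_I_tilde (lam - 1) (2 * csqrt (of_real t)) =
      complex_of_real (Gamma lam * suminf a)" by simp
  then show "of_real (Gamma lam) * bessel_I_tilde (lam - 1) (2 * csqrt (of_real t)) =
      complex_of_real (bessel_B lam t)"
    by (simp only: bessel_B_def eq Re_complex_of_real)
  have "bessel_B lam t = Gamma lam * suminf a"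
    by (simp only: bessel_B_def eq Re_complex_of_real)
  also have "\<dots> = (\<Sum>k. Gamma lam * a k)"
    using \<open>summable a\<close> by (rule suminf_mult [symmetric])
  finally show "bessel_B lam t = (\<Sum>k. Gamma lam / (fact k * Gamma (lam + real k)) * t ^ k)"
    by (simp add: a_def rGamma_inverse_Gamma divide_inverse mult_ac)
qed

section \<open>Jordan algebras\<close>

context
  fixes jprod :: "'a::euclidean_space \<Rightarrow> 'a \<Rightarrow> 'a" (infixl "\<odot>" 70)
    and e :: 'a
begin

primrec jordan_power :: "'a \<Rightarrow> nat \<Rightarrow> 'a" where
  "jordan_power x 0 = e"
| "jordan_power x (Suc n) = x \<odot> jordan_power x n"

text \<open>Degree of the minimal polynomial of \<open>x\<close>: the least \<open>k\<close> for which the family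
  \<open>e, x, \<dots>, x\<^sup>k\<close> (with repetitions counted) is linearly dependent.\<close>

definition min_poly_degree :: "'a \<Rightarrow> nat" where
  "min_poly_degree x = (LEAST k. jordan_power x k \<in> span (jordan_power x ` {..<k}))"

definition jordan_rank :: nat where
  "jordan_rank = Max (range min_poly_degree)"

text \<open>The elements with \<open>min_poly_degree x = r\<close> are the regular ones. They satisfy
  \<open>x\<^sup>r - a\<^sub>1(x) x\<^sup>r\<^sup>-\<^sup>1 + \<dots> = 0\<close> with unique coefficients, and the trace is the (unique) linear
  form on the whole algebra that equals \<open>a\<^sub>1\<close> on this dense open set.\<close>

definition jordan_trace :: "'a \<Rightarrow> real" where
  "jordan_trace = (THE T. linear T \<and>
     (\<forall>x. min_poly_degree x = jordan_rank \<longrightarrow>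
        jordan_power x jordan_rank - T x *\<^sub>R jordan_power x (jordan_rank - 1)
          \<in> span (jordan_power x ` {..<jordan_rank - 1})))"

definition primitive_idempotent :: "'a \<Rightarrow> bool" where
  "primitive_idempotent c \<longleftrightarrow> c \<noteq> 0 \<and> c \<odot> c = c \<and>
     \<not> (\<exists>a b. a \<noteq> 0 \<and> b \<noteq> 0 \<and> a \<odot> a = a \<and> b \<odot> b = b \<and> a \<odot> b = 0 \<and> c = a + b)"

definition jordan_frame :: "'a set \<Rightarrow> bool" where
  "jordan_frame C \<longleftrightarrow> finite C \<and> (\<forall>c\<in>C. primitive_idempotent c) \<and>
     (\<forall>c\<in>C. \<forall>c'\<in>C. c \<noteq> c' \<longrightarrow> c \<odot> c' = 0) \<and> \<Sum>C = e"

definition off_diagonal_peirce_spaces :: "'a set set" where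
  "off_diagonal_peirce_spaces =
     {{x. c \<odot> x = (1/2) *\<^sub>R x \<and> c' \<odot> x = (1/2) *\<^sub>R x} | C c c'.
        jordan_frame C \<and> c \<in> C \<and> c' \<in> C \<and> c \<noteq> c'}"

definition jordan_P :: "'a \<Rightarrow> 'a \<Rightarrow> 'a \<Rightarrow> 'a" where
  "jordan_P x y z = x \<odot> (y \<odot> z) + y \<odot> (x \<odot> z) - (x \<odot> y) \<odot> z"

text \<open>The adjoint is taken with respect to the inner product of the type, so these notions are
  meant for algebras whose inner product is the trace form \<open>tr(xy)\<close>. The quadratic
  representation is \<open>P(x) = P(x,x)\<close>.\<close>

definition structure_group :: "('a \<Rightarrow>\<^sub>L 'a) set" where
  "structure_group = {g. bij (blinfun_apply g) \<and>
     (\<forall>x. jordan_P (g x) (g x) =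
        blinfun_apply g \<circ> jordan_P x x \<circ> adjoint (blinfun_apply g))}"

definition structure_group_0 :: "('a \<Rightarrow>\<^sub>L 'a) set" where
  "structure_group_0 = connected_component_set structure_group id_blinfun"

definition structure_group_K :: "('a \<Rightarrow>\<^sub>L 'a) set" where
  "structure_group_K = {g \<in> structure_group_0. g e = e}"

definition min_orbit :: "'a \<Rightarrow> 'a set" where
  "min_orbit c\<^sub>1 = (\<lambda>g. blinfun_apply g c\<^sub>1) ` structure_group_0"

end

locale euclidean_jordan_algebra =
  fixes jprod :: "'a::euclidean_space \<Rightarrow> 'a \<Rightarrow> 'a" (infixl "\<odot>" 70)
    and e :: 'a
  assumes bilinear_prod: "bilinear (\<odot>)"
    and prod_commute: "x \<odot> y = y \<odot> x"
    and jordan_identity: "x \<odot> ((x \<odot> x) \<odot> y) = (x \<odot> x) \<odot> (x \<odot> y)"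
    and unit_left: "e \<odot> x = x"
    and inner_assoc: "(x \<odot> y) \<bullet> z = y \<bullet> (x \<odot> z)"

locale simple_euclidean_jordan_algebra = euclidean_jordan_algebra +
  assumes simple: "subspace I \<Longrightarrow> (\<And>x y. y \<in> I \<Longrightarrow> x \<odot> y \<in> I) \<Longrightarrow> I = {0} \<or> I = UNIV"

section \<open>Integration on the orbit\<close>

definition normalized_haar :: "('a::euclidean_space \<Rightarrow>\<^sub>L 'a) set \<Rightarrow> ('a \<Rightarrow>\<^sub>L 'a) measure \<Rightarrow> bool" where
  "normalized_haar K \<kappa> \<longleftrightarrow> sets \<kappa> = sets (restrict_space borel K) \<and> emeasure \<kappa> K = 1 \<and>
     (\<forall>k\<in>K. \<forall>A\<in>sets \<kappa>. emeasure \<kappa> ((\<lambda>g. k o\<^sub>L g) ` A) = emeasure \<kappa> A)"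

text \<open>The measure \<open>\<mu>\<close> on \<open>\<Xi> = L c\<^sub>1\<close>: the image under \<open>(k,t) \<mapsto> k t c\<^sub>1\<close> of the product of \<open>dk\<close>
  and \<open>2\<^sup>r\<^sup>\<lambda> / \<Gamma>(r\<lambda>) t\<^sup>r\<^sup>\<lambda>\<^sup>-\<^sup>1 dt\<close> on the positive half line.\<close>

definition orbit_measure ::
  "('a::euclidean_space \<Rightarrow> 'a \<Rightarrow> 'a) \<Rightarrow> 'a \<Rightarrow> real \<Rightarrow> 'a \<Rightarrow> ('a \<Rightarrow>\<^sub>L 'a) measure \<Rightarrow> 'a measure" where
  "orbit_measure jprod e lam c\<^sub>1 \<kappa> =
     (let q = real (jordan_rank jprod e) * lam in
      distr
        (\<kappa> \<Otimes>\<^sub>M density (restrict_space lborel {0<..})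
                (\<lambda>t. ennreal (2 powr q / Gamma q * t powr (q - 1))))
        (restrict_space borel (min_orbit jprod c\<^sub>1))
        (\<lambda>(k, t). blinfun_apply k (t *\<^sub>R c\<^sub>1)))"

section \<open>The Bessel operator\<close>

text \<open>\<open>Basis\<close> is an orthonormal basis.\<close>

definition bessel_operator ::
  "('a::euclidean_space \<Rightarrow> 'a \<Rightarrow> 'a) \<Rightarrow> real \<Rightarrow> ('a \<Rightarrow> real) \<Rightarrow> 'a \<Rightarrow> 'a" where
  "bessel_operator jprod lam f x =
     (\<Sum>a\<in>Basis. \<Sum>b\<in>Basis.
        frechet_derivative (\<lambda>z. frechet_derivative f (at z) b) (at x) a *\<^sub>R jordan_P jprod a b x)
     + lam *\<^sub>R (\<Sum>a\<in>Basis. frechet_derivative f (at x) a *\<^sub>R a)"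

definition C2_on :: "'a::euclidean_space set \<Rightarrow> ('a \<Rightarrow> real) \<Rightarrow> bool" where
  "C2_on U f \<longleftrightarrow> (\<forall>x\<in>U. f differentiable at x) \<and>
     (\<forall>b\<in>Basis. \<forall>x\<in>U. (\<lambda>z. frechet_derivative f (at z) b) differentiable at x) \<and>
     (\<forall>a\<in>Basis. \<forall>b\<in>Basis. continuous_on U
        (\<lambda>x. frechet_derivative (\<lambda>z. frechet_derivative f (at z) b) (at x) a))"

definition C2_extension :: "'a::euclidean_space set \<Rightarrow> ('a \<Rightarrow> real) \<Rightarrow> 'a \<Rightarrow> ('a \<Rightarrow> real) \<Rightarrow> bool" where
  "C2_extension S f x F \<longleftrightarrow>
     (\<exists>U. open U \<and> x \<in> U \<and> C2_on U F \<and> (\<forall>z\<in>U \<inter> S. F z = f z))"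

text \<open>\<open>\<B>\<^sub>e f (x) = v\<close> for a function \<open>f\<close> on \<open>\<Xi>\<close>. Since \<open>\<B>\<close> is tangential to \<open>\<Xi>\<close>, its \<open>e\<close>-component
  is applied to \<open>f\<close> by applying it to a \<open>C\<^sup>2\<close> extension of \<open>f\<close> to a neighbourhood of \<open>x\<close> in \<open>V\<close>.
  The predicate demands that there is such an extension and that all of them give the value \<open>v\<close>;
  the values of \<open>f\<close> off \<open>\<Xi>\<close> are irrelevant.\<close>

definition has_bessel_e ::
  "('a::euclidean_space \<Rightarrow> 'a \<Rightarrow> 'a) \<Rightarrow> 'a \<Rightarrow> real \<Rightarrow> 'a \<Rightarrow> ('a \<Rightarrow> real) \<Rightarrow> 'a \<Rightarrow> real \<Rightarrow> bool" where
  "has_bessel_e jprod e lam c\<^sub>1 f x v \<longleftrightarrow>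
     (\<exists>F. C2_extension (min_orbit jprod c\<^sub>1) f x F) \<and>
     (\<forall>F. C2_extension (min_orbit jprod c\<^sub>1) f x F \<longrightarrow> e \<bullet> bessel_operator jprod lam F x = v)"

section \<open>The heat kernel\<close>

definition heat_kernel ::
  "('a::euclidean_space \<Rightarrow> 'a \<Rightarrow> 'a) \<Rightarrow> 'a \<Rightarrow> real \<Rightarrow> real \<Rightarrow> 'a \<Rightarrow> 'a \<Rightarrow> real" where
  "heat_kernel jprod e lam t x y =
     (2 * t) powr (- (real (jordan_rank jprod e) * lam)) *
     exp (- (1 / t) * (jordan_trace jprod e x + jordan_trace jprod e y)) *
     bessel_B lam ((x /\<^sub>R t) \<bullet> (y /\<^sub>R t))"

end

theory Submission
  imports Defs
begin

text \<open>
  Statements (1) to (3) are specializations of the single identity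
  \<open>\<integral> exp (- \<tau> tr \<xi>) B (p (x|\<xi>)) B (r (y|\<xi>)) d\<mu>(\<xi>) =
   (2/\<tau>)\<^sup>r\<^sup>\<lambda> exp ((p tr x + r tr y)/\<tau>) B (p r (x|y)/\<tau>\<^sup>2)\<close>.
  Expanding both Bessel functions reduces it to the moments
  \<open>\<integral> (x|k c\<^sub>1)\<^sup>m (y|k c\<^sub>1)\<^sup>n dk\<close>. Invariance of \<open>dk\<close> under the one-parameter groups generated by
  the derivations \<open>[L(u), L(v)]\<close>, applied with \<open>u\<close> running through an orthonormal basis and combined
  with the Casimir identity
  \<open>\<Sum>\<^sub>u L(u)\<^sup>2 x = (1 + (r - 2) \<lambda>/2) x + (\<lambda>/2) tr(x) e\<close>, gives recurrences which determine these
  moments and which the Taylor coefficients of \<open>exp (a u + b w) B(g u w)\<close> also satisfy.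

  For (4), differentiating twice along the curves \<open>exp (s L(u)) x\<close> in the orbit and summing over \<open>u\<close>
  expresses \<open>\<B>\<^sub>e F\<close> on the orbit through values of \<open>F\<close> on the orbit only, again by the Casimir
  identity; the heat equation itself is then Bessel's equation \<open>z B'' + \<lambda> B' = B\<close>.
\<close>

section \<open>Jordan identities\<close>

text \<open>The common identity is used with (p, r, \<tau>) = (-1, -1, t) for (1), (1/t^2, 0, 1/t)
  for (2) and (1/s^2, 1/t^2, 1/s + 1/t) for (3). Its moments satisfy no closed recurrence by
  themselves: invariance produces integrals with an additional factor (xy|k c). A second family with
  this factor is carried along, and the system closes because P(x)v = (x|v)x on the orbit makes
  x(xy) a combination of x and xy. The moments of total degree N carry the denominator (rank
  \<lambda>)_N, exactly the factor that the radial Gamma integral supplies in the numerator. The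
  algebra has an obstacle of its own. Rank and trace are defined through generic minimal
  polynomials, while the Casimir identity needs the eigenvalues of L(x) with multiplicities. Jordan
  frames connect the two, so the spectral theorem is required, and so is the equality of norms of
  all primitive idempotents before the trace is known. Moreover the hypothesis on \<lambda> concerns
  a single Peirce space: its dimension is carried through one frame by connectedness and to other
  frames by counting dim V.\<close>

context euclidean_jordan_algebra
begin

abbreviation "\<P> \<equiv> jordan_P (\<odot>)"
abbreviation "jpow \<equiv> jordan_power (\<odot>) e"
abbreviation "mindeg \<equiv> min_poly_degree (\<odot>) e"
abbreviation "Str \<equiv> structure_group (\<odot>)"
abbreviation "Str\<^sub>0 \<equiv> structure_group_0 (\<odot>)"
abbreviation "orbit \<equiv> min_orbit (\<odot>)"

sublocale prod: bounded_bilinear "(\<odot>)"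
  using bilinear_prod by (simp add: bilinear_conv_bounded_bilinear)

lemmas prod_expand = prod.add_left prod.add_right prod.diff_left prod.diff_right
  prod.minus_left prod.minus_right prod.scaleR_left prod.scaleR_right
  prod.zero_left prod.zero_right

lemma unit_right: "x \<odot> e = x"
  by (simp add: prod_commute[of x] unit_left)

lemma inner_assoc': "x \<bullet> (y \<odot> z) = (y \<odot> x) \<bullet> z"
  by (simp add: inner_assoc)

text \<open>The combination \<open>f (x + z) - f (x - z) - 2 *\<^sub>R f z\<close> removes from the
  cubic polynomial \<open>f (x + z)\<close> everything except the part linear in \<open>z\<close>,
  which is left twice.\<close>

lemma jordan_linearized2:
  "z \<odot> ((x \<odot> x) \<odot> y) + 2 *\<^sub>R (x \<odot> ((x \<odot> z) \<odot> y)) = (x \<odot> x) \<odot> (z \<odot> y) + 2 *\<^sub>R ((x \<odot> z) \<odot> (x \<odot> y))"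
proof -
  define f where "f x = x \<odot> ((x \<odot> x) \<odot> y) - (x \<odot> x) \<odot> (x \<odot> y)" for x
  have f0: "f x = 0" for x by (simp add: f_def jordan_identity)
  have "f (x + z) - f (x - z) - 2 *\<^sub>R f z =
     2 *\<^sub>R (z \<odot> ((x \<odot> x) \<odot> y) + 2 *\<^sub>R (x \<odot> ((x \<odot> z) \<odot> y)) - ((x \<odot> x) \<odot> (z \<odot> y) + 2 *\<^sub>R ((x \<odot> z) \<odot> (x \<odot> y))))"
    unfolding f_def prod_expand prod_commute[of z x]
    by (simp add: algebra_simps scaleR_2)
  then show ?thesis by (simp add: f0)
qed

text \<open>Polarization in the variable that is still quadratic; the result is symmetric in
  \<open>x\<close>, \<open>z\<close>, \<open>w\<close>.\<close>

lemma jordan_linearized: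
  "x \<odot> ((z \<odot> w) \<odot> y) + z \<odot> ((x \<odot> w) \<odot> y) + w \<odot> ((x \<odot> z) \<odot> y) =
   (z \<odot> w) \<odot> (x \<odot> y) + (x \<odot> w) \<odot> (z \<odot> y) + (x \<odot> z) \<odot> (w \<odot> y)"
proof -
  define g where "g u = z \<odot> ((u \<odot> u) \<odot> y) + 2 *\<^sub>R (u \<odot> ((u \<odot> z) \<odot> y)) - (u \<odot> u) \<odot> (z \<odot> y) - 2 *\<^sub>R ((u \<odot> z) \<odot> (u \<odot> y))" for u
  have g0: "g u = 0" for u
    using jordan_linearized2[of z u y] by (simp add: g_def algebra_simps)
  have "g (x + w) - g x - g w =
     2 *\<^sub>R (x \<odot> ((z \<odot> w) \<odot> y) + z \<odot> ((x \<odot> w) \<odot> y) + w \<odot> ((x \<odot> z) \<odot> y)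
     - ((z \<odot> w) \<odot> (x \<odot> y) + (x \<odot> w) \<odot> (z \<odot> y) + (x \<odot> z) \<odot> (w \<odot> y)))"
    unfolding g_def prod_expand prod_commute[of w x] prod_commute[of w z]
    by (simp add: algebra_simps scaleR_2)
  then show ?thesis by (simp add: g0)
qed

text \<open>By commutativity the same identity becomes a relation between multiplication operators
  applied to \<open>w\<close>: L(x)L(y)L(z) + L(z)L(y)L(x) + L((xz)y) = L(xy)L(z) + L(zy)L(x) +
  L(xz)L(y).\<close>

lemma jordan_linearized':
  "x \<odot> (y \<odot> (z \<odot> w)) + z \<odot> (y \<odot> (x \<odot> w)) + ((x \<odot> z) \<odot> y) \<odot> w =
   (x \<odot> y) \<odot> (z \<odot> w) + (z \<odot> y) \<odot> (x \<odot> w) + (x \<odot> z) \<odot> (y \<odot> w)"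
  using jordan_linearized[of x z w y]
  by (simp add: prod_commute[of w] prod_commute[of _ y] add_ac prod_commute[of "z \<odot> w" "x \<odot> y"]
      prod_commute[of "y \<odot> x"] prod_commute[of "x \<odot> w"])

text \<open>Derivative at s = 0 of P(gz, gw) = g P(z, w) g for the self-adjoint g = exp(s L(u)). It
  places the multiplications in the Lie algebra of the structure group.\<close>

lemma jordan_P_lie:
  "\<P> (u \<odot> z) w v + \<P> z (u \<odot> w) v =
   u \<odot> \<P> z w v + \<P> z w (u \<odot> v)"
proof -
  have "u \<odot> \<P> z w v + \<P> z w (u \<odot> v) -
     (\<P> (u \<odot> z) w v + \<P> z (u \<odot> w) v) = 0"
    using jordan_linearized'[of u w z v] jordan_linearized'[of u z w v] jordan_linearized[of u z w v]
    unfolding jordan_P_def prod_expand prod_commute[of w z] prod_commute[of z "u \<odot> w"]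
    by (simp add: algebra_simps) (smt (verit) add.commute add.left_commute add_diff_cancel_left')
  then show ?thesis by simp
qed

end

section \<open>Peirce decomposition and the spectral theorem\<close>

text \<open>A maximum point of the quadratic form on the unit sphere of \<open>A\<close> is an
  eigenvector: perturbing it along the defect \<open>h\<close> gives an inequality for all
  \<open>t\<close> whose linear coefficient is 2(h|h), so \<open>h\<close> vanishes.\<close>

lemma symmetric_eigenvector:
  fixes f :: "'a::euclidean_space \<Rightarrow> 'a"
  assumes A: "subspace A" "A \<noteq> {0}" and lin: "linear f"
    and inv: "\<And>v. v \<in> A \<Longrightarrow> f v \<in> A" and sym: "\<And>v w. f v \<bullet> w = v \<bullet> f w"
  obtains p l where "p \<in> A" "p \<noteq> 0" "f p = l *\<^sub>R p"
proof -
  obtain q where q: "q \<in> A" "q \<noteq> 0" using A subspace_0 by blast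
  then have "q /\<^sub>R norm q \<in> A \<inter> sphere 0 1" using A by (simp add: subspace_scale)
  moreover have "compact (A \<inter> sphere 0 1)"
    using A by (simp add: closed_subspace closed_Int_compact)
  moreover have "continuous_on (A \<inter> sphere 0 1) (\<lambda>v. f v \<bullet> v)"
    using lin by (intro continuous_intros linear_continuous_on) (auto simp: linear_linear)
  ultimately obtain p where p: "p \<in> A" "norm p = 1"
    and max: "\<And>v. v \<in> A \<Longrightarrow> norm v = 1 \<Longrightarrow> f v \<bullet> v \<le> f p \<bullet> p"
    using continuous_attains_sup[of "A \<inter> sphere 0 1" "\<lambda>v. f v \<bullet> v"]
    by (metis (no_types, lifting) Int_iff emptyE mem_sphere_0)
  define m where "m = f p \<bullet> p"
  have le: "f v \<bullet> v \<le> m * (v \<bullet> v)" if "v \<in> A" for v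
  proof (cases "v = 0")
    case False
    have "f (v /\<^sub>R norm v) \<bullet> (v /\<^sub>R norm v) \<le> m"
      unfolding m_def using that False A by (intro max) (auto simp: subspace_scale)
    then show ?thesis using False lin
      by (simp add: linear_cmul field_simps power2_norm_eq_inner[symmetric] power2_eq_square)
  qed (use lin linear_0 in auto)
  define h where "h = m *\<^sub>R p - f p"
  have hA: "h \<in> A" using A p inv by (simp add: h_def subspace_diff subspace_scale)
  define K where "K = m * (h \<bullet> h) - f h \<bullet> h"
  have K: "K \<ge> 0" using le[OF hA] by (simp add: K_def)
  have ge: "0 \<le> 2 * t * (h \<bullet> h) + t^2 * K" for t
  proof -
    have "p + t *\<^sub>R h \<in> A" using p hA A by (simp add: subspace_add subspace_scale)
    from le[OF this] have "0 \<le> m * ((p + t *\<^sub>R h) \<bullet> (p + t *\<^sub>R h)) - f (p + t *\<^sub>R h) \<bullet> (p + t *\<^sub>R h)"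
      by simp
    also have "\<dots> = m * (p \<bullet> p) - f p \<bullet> p + 2 * t * (m * (p \<bullet> h) - f p \<bullet> h) + t^2 * K"
      using lin sym[of h p]
      by (simp add: linear_add linear_cmul inner_add_left inner_add_right K_def algebra_simps
          power2_eq_square inner_commute)
    also have "m * (p \<bullet> p) - f p \<bullet> p = 0" using p by (simp add: m_def dot_square_norm)
    also have "m * (p \<bullet> h) - f p \<bullet> h = h \<bullet> h"
      by (simp add: h_def inner_diff_left inner_diff_right inner_commute[of "f p" p] algebra_simps)
    finally show ?thesis by simp
  qed
  have "h = 0"
  proof (rule ccontr)
    assume "h \<noteq> 0"
    then have pos: "h \<bullet> h > 0" by simp
    \<comment> \<open>The minimizer of the quadratic would have \<open>K\<close> in the denominator,
      which may be 0; with \<open>K + 1\<close> instead the value is still negative.\<close>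
    define t where "t = - (h \<bullet> h) / (K + 1)"
    have t: "t * (K + 1) = - (h \<bullet> h)" using K by (simp add: t_def)
    have "0 \<le> (K + 1)^2 * (2 * t * (h \<bullet> h) + t^2 * K)" using ge[of t] by simp
    also have "\<dots> = 2 * (K + 1) * (t * (K + 1)) * (h \<bullet> h) + (t * (K + 1))^2 * K"
      by (simp add: algebra_simps power2_eq_square)
    also have "\<dots> = - ((K + 2) * (h \<bullet> h)^2)"
      unfolding t by (simp add: algebra_simps power2_eq_square)
    also have "\<dots> < 0" using K pos by simp
    finally show False by simp
  qed
  then have "f p = m *\<^sub>R p" by (simp add: h_def)
  moreover have "p \<noteq> 0" using p by auto
  ultimately show thesis using p that by blast
qed

section \<open>Peirce rules for a single idempotent\<close>

context euclidean_jordan_algebra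
begin

lemma inner_unit: "x \<bullet> y = (x \<odot> y) \<bullet> e"
  using inner_assoc[of x y e] by (simp add: unit_right inner_commute)

text \<open>Put \<open>c\<close> for two arguments of \<open>jordan_linearized\<close>: for the
  eigenvalues 1 and 0 the remaining terms give the commutation, whereas for 1/2 the relation is
  void.\<close>

lemma idempotent_commute:
  assumes "c \<odot> c = c" "c \<odot> x = x \<or> c \<odot> x = 0"
  shows "c \<odot> (x \<odot> v) = x \<odot> (c \<odot> v)"
  using assms(2)
proof
  assume "c \<odot> x = x"
  then show ?thesis using jordan_linearized[of c c x v] assms(1) by (simp add: algebra_simps)
next
  assume "c \<odot> x = 0"
  then show ?thesis using jordan_linearized[of c c x v] assms(1) by (simp add: prod_expand)
qed

text \<open>The multiplications by \<open>u\<close> and by \<open>w\<close> both commute with that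
  by \<open>c\<close>, so \<open>c\<close> acts on the product with the eigenvalue of
  \<open>w\<close> as well as with that of \<open>u\<close>.\<close>

lemma peirce_1_0:
  assumes "c \<odot> c = c" "c \<odot> u = u" "c \<odot> w = 0"
  shows "u \<odot> w = 0"
proof -
  have "c \<odot> (u \<odot> w) = 0"
    using idempotent_commute[of c u w] assms by (simp add: prod_expand)
  moreover have "c \<odot> (w \<odot> u) = w \<odot> u"
    using idempotent_commute[of c w u] assms by (simp add: prod_expand)
  ultimately show ?thesis by (simp add: prod_commute)
qed

text \<open>Expresses that the product lies in the sum of the eigenspaces 0 and 1, without naming
  its two components.\<close>

lemma peirce_half_half:
  assumes "c \<odot> c = c" "c \<odot> u = (1/2) *\<^sub>R u" "c \<odot> w = (1/2) *\<^sub>R w"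
  shows "c \<odot> (c \<odot> (u \<odot> w)) = c \<odot> (u \<odot> w)"
proof -
  have [simp]: "u \<odot> c = (1/2) *\<^sub>R u" "w \<odot> c = (1/2) *\<^sub>R w" "(u \<odot> w) \<odot> c = c \<odot> (u \<odot> w)"
    using assms prod_commute[of u c] prod_commute[of w c] prod_commute[of "u \<odot> w" c] by auto
  show ?thesis
    using jordan_linearized[of c u w c] assms prod_commute[of w u] by (simp add: prod_expand)
qed

text \<open>The eigenvalues of an idempotent are thus among the roots 0, 1/2, 1 of 2t^3 - 3t^2 +
  t.\<close>

lemma peirce_polynomial:
  assumes "c \<odot> c = c"
  shows "2 *\<^sub>R (c \<odot> (c \<odot> (c \<odot> v))) = 3 *\<^sub>R (c \<odot> (c \<odot> v)) - c \<odot> v"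
proof -
  have "c \<odot> (c \<odot> (c \<odot> v)) + c \<odot> (c \<odot> (c \<odot> v)) + c \<odot> v = 3 *\<^sub>R (c \<odot> (c \<odot> v))"
    using jordan_linearized'[of c c c v] assms
    by (simp add: scaleR_left.add[of 2 1, simplified] scaleR_2)
  then show ?thesis by (simp add: scaleR_2 algebra_simps)
qed

lemma jordan_P_same: "\<P> x x v = 2 *\<^sub>R (x \<odot> (x \<odot> v)) - (x \<odot> x) \<odot> v"
  by (simp add: jordan_P_def scaleR_2)

text \<open>The polynomial 2t^2 - t takes the values 0, 0, 1 at 0, 1/2, 1, so
  \<open>\<P> c c\<close> projects onto the Peirce 1-space.\<close>

lemma jordan_P_idempotent: "c \<odot> c = c \<Longrightarrow> c \<odot> \<P> c c v = \<P> c c v"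
  using peirce_polynomial[of c v]
  by (simp add: jordan_P_same prod_expand) (simp add: algebra_simps scaleR_2 scaleR_left.add[of 2 1, simplified])

lemma jordan_P_inner: "\<P> x y v \<bullet> w = v \<bullet> \<P> x y w"
  by (simp add: jordan_P_def inner_add_left inner_add_right inner_diff_left inner_diff_right inner_assoc)

section \<open>Powers of one element and the spectral theorem\<close>

text \<open>Stands for x^(n+1). Without the unit, the powers stay inside the Peirce 1-space of every
  idempotent that fixes \<open>x\<close>.\<close>

definition mult_pow :: "'a \<Rightarrow> nat \<Rightarrow> 'a" where
  "mult_pow x n = (((\<odot>) x) ^^ n) x"

lemma mult_pow_Suc: "mult_pow x (Suc n) = x \<odot> mult_pow x n"
  by (simp add: mult_pow_def)

lemma mult_pow_0: "mult_pow x 0 = x"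
  by (simp add: mult_pow_def)

lemma square_mult_pow: "(x \<odot> x) \<odot> mult_pow x n = mult_pow x (Suc (Suc n))"
proof (induction n)
  case 0 show ?case using prod_commute[of "x \<odot> x" x] by (simp add: mult_pow_def)
next
  case (Suc n) then show ?case
    by (simp only: mult_pow_Suc jordan_identity[symmetric])
qed

text \<open>Expresses multiplication by x^(n+3) through multiplications by x, x^2 and the two
  preceding powers; commutation with x and x^2 is thereby inherited in
  \<open>mult_pow_commute\<close>.\<close>

lemma mult_mult_pow:
  "mult_pow x (Suc (Suc n)) \<odot> v =
   2 *\<^sub>R (mult_pow x (Suc n) \<odot> (x \<odot> v)) + (x \<odot> x) \<odot> (mult_pow x n \<odot> v) - 2 *\<^sub>R (x \<odot> (mult_pow x n \<odot> (x \<odot> v)))"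
  using jordan_linearized'[of x "mult_pow x n" x v]
  by (simp add: square_mult_pow flip: mult_pow_Suc) (simp add: algebra_simps scaleR_2)

lemma mult_pow_commute:
  "x \<odot> (mult_pow x n \<odot> v) = mult_pow x n \<odot> (x \<odot> v) \<and>
   (x \<odot> x) \<odot> (mult_pow x n \<odot> v) = mult_pow x n \<odot> ((x \<odot> x) \<odot> v)"
proof (induction n arbitrary: v rule: less_induct)
  case (less n)
  show ?case
  proof (cases n)
    case 0 then show ?thesis by (simp add: mult_pow_0 jordan_identity)
  next
    case (Suc m)
    show ?thesis
    proof (cases m)
      case 0 then show ?thesis
        using Suc by (simp add: mult_pow_Suc mult_pow_0 jordan_identity)
    next
      case (Suc k)
      have n: "n = Suc (Suc k)" using Suc \<open>n = Suc m\<close> by simp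
      have 1: "x \<odot> (mult_pow x k \<odot> v) = mult_pow x k \<odot> (x \<odot> v)"
         "(x \<odot> x) \<odot> (mult_pow x k \<odot> v) = mult_pow x k \<odot> ((x \<odot> x) \<odot> v)"
         "x \<odot> (mult_pow x (Suc k) \<odot> v) = mult_pow x (Suc k) \<odot> (x \<odot> v)"
         "(x \<odot> x) \<odot> (mult_pow x (Suc k) \<odot> v) = mult_pow x (Suc k) \<odot> ((x \<odot> x) \<odot> v)" for v
        using less n by auto
      show ?thesis
        unfolding n mult_mult_pow by (simp only: prod_expand 1 jordan_identity)
    qed
  qed
qed

text \<open>Multiplication by \<open>x\<close> has an eigenvector \<open>p\<close> in the span
  \<open>A\<close> of its powers. Multiplications by elements of \<open>A\<close> commute with it,
  so pq is a multiple of \<open>p\<close> for every q in \<open>A\<close>. In particular pp = al p,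
  with al nonzero because (pp|e) = (p|p), and rescaling \<open>p\<close> gives the idempotent. The
  last conclusion holds since everything in \<open>A\<close> is fixed by \<open>c\<close>.\<close>

lemma exists_idempotent:
  assumes "x \<noteq> 0"
  obtains a l where "a \<noteq> 0" "a \<odot> a = a" "x \<odot> a = l *\<^sub>R a"
    "\<And>c. c \<odot> c = c \<Longrightarrow> c \<odot> x = x \<Longrightarrow> c \<odot> a = a"
proof -
  define A where "A = span (range (mult_pow x))"
  have inA: "mult_pow x n \<in> A" for n by (auto simp: A_def intro: span_base)
  have linL: "linear ((\<odot>) y)" for y using prod.bounded_linear_right by (rule bounded_linear.linear)
  have inv: "x \<odot> v \<in> A" if "v \<in> A" for v
    using that unfolding A_def
  proof (induction rule: span_induct_alt)
    case (step c y z)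
    then obtain n where "y = mult_pow x n" by auto
    then have "x \<odot> y \<in> span (range (mult_pow x))" by (auto simp flip: mult_pow_Suc intro: span_base)
    with step show ?case by (simp add: prod_expand span_add span_scale)
  qed (simp add: prod_expand span_0)
  have comm: "x \<odot> (p \<odot> v) = p \<odot> (x \<odot> v)" if "p \<in> A" for p v
    using that unfolding A_def
    by (induction rule: span_induct_alt) (auto simp: prod_expand mult_pow_commute)
  have fixA: "c \<odot> p = p" if "p \<in> A" "c \<odot> c = c" "c \<odot> x = x" for c p
  proof -
    have "c \<odot> mult_pow x n = mult_pow x n" for n
      by (induction n) (use that idempotent_commute[of c x] in \<open>auto simp: mult_pow_Suc mult_pow_0\<close>)
    with that(1) show ?thesis unfolding A_def
      by (induction rule: span_induct_alt) (auto simp: prod_expand)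
  qed
  have "A \<noteq> {0}" using inA[of 0] assms by (auto simp: mult_pow_0)
  moreover have "subspace A" by (simp add: A_def subspace_span)
  ultimately obtain p l where p: "p \<in> A" "p \<noteq> 0" "x \<odot> p = l *\<^sub>R p"
    using symmetric_eigenvector[of A "(\<odot>) x"] linL inv inner_assoc
    by (metis inner_commute)
  have ppow: "p \<odot> mult_pow x n = (l ^ Suc n) *\<^sub>R p" for n
  proof (induction n)
    case 0 then show ?case using p prod_commute by (simp add: mult_pow_0)
  next
    case (Suc n)
    have "p \<odot> mult_pow x (Suc n) = x \<odot> (p \<odot> mult_pow x n)"
      using comm[OF p(1)] by (simp add: mult_pow_Suc)
    with Suc show ?case using p by (simp add: prod_expand)
  qed
  have "\<exists>al. p \<odot> q = al *\<^sub>R p" if "q \<in> A" for q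
    using that unfolding A_def
  proof (induction rule: span_induct_alt)
    case base show ?case by (intro exI[of _ 0]) (simp add: prod_expand)
  next
    case (step c y z)
    then obtain n al where "y = mult_pow x n" "p \<odot> z = al *\<^sub>R p" by auto
    then have "p \<odot> (c *\<^sub>R y + z) = (c * l ^ Suc n + al) *\<^sub>R p"
      by (simp add: prod_expand ppow algebra_simps)
    then show ?case by blast
  qed
  then obtain al where al: "p \<odot> p = al *\<^sub>R p" using p by blast
  have "al \<noteq> 0" using inner_unit[of p p] al p by auto
  then show thesis
    using p al fixA
    by (intro that[of "(1/al) *\<^sub>R p" l]) (auto simp: prod_expand)
qed

text \<open>If the idempotent attached to \<open>x\<close> were \<open>c\<close> itself, then x = xc
  would be a multiple of \<open>c\<close>.\<close>

lemma split_idempotent: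
  assumes "c \<odot> c = c" "c \<odot> x = x" "x \<notin> span {c}"
  obtains a l where "a \<noteq> 0" "a \<noteq> c" "a \<odot> a = a" "c \<odot> a = a" "x \<odot> a = l *\<^sub>R a"
proof -
  have "x \<noteq> 0" using assms(3) span_0 by auto
  then obtain a l where a: "a \<noteq> 0" "a \<odot> a = a" "x \<odot> a = l *\<^sub>R a" "c \<odot> a = a"
    using exists_idempotent assms by metis
  have "a \<noteq> c"
  proof
    assume "a = c"
    then have "x = l *\<^sub>R c" using a assms prod_commute[of x c] by simp
    then show False using assms(3) by (auto simp: span_singleton)
  qed
  then show thesis using a that by blast
qed

lemma idempotent_diff:
  assumes "c \<odot> c = c" "a \<odot> a = a" "c \<odot> a = a"
  shows "(c - a) \<odot> (c - a) = c - a" "a \<odot> (c - a) = 0" "(c - a) \<odot> a = 0"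
  using assms prod_commute[of a c] by (simp_all add: prod_expand)

lemma primitive_peirce_1:
  assumes "primitive_idempotent (\<odot>) c" "c \<odot> x = x"
  shows "x \<in> span {c}"
proof (rule ccontr)
  assume "x \<notin> span {c}"
  have c: "c \<odot> c = c" using assms by (simp add: primitive_idempotent_def)
  obtain a l where "a \<noteq> 0" "a \<noteq> c" "a \<odot> a = a" "c \<odot> a = a"
    by (rule split_idempotent[OF c assms(2) \<open>x \<notin> span {c}\<close>])
  then have "a \<noteq> 0 \<and> c - a \<noteq> 0 \<and> a \<odot> a = a \<and> (c - a) \<odot> (c - a) = c - a \<and> a \<odot> (c - a) = 0 \<and> c = a + (c - a)"
    using idempotent_diff[OF c, of a] by auto
  then show False
    using assms(1) unfolding primitive_idempotent_def by blast
qed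

lemma primitive_P:
  assumes "primitive_idempotent (\<odot>) c"
  shows "\<P> c c v = ((c \<bullet> v) / (c \<bullet> c)) *\<^sub>R c"
proof -
  have c: "c \<odot> c = c" "c \<noteq> 0" using assms by (auto simp: primitive_idempotent_def)
  obtain k where k: "\<P> c c v = k *\<^sub>R c"
    using primitive_peirce_1[OF assms jordan_P_idempotent[OF c(1)]] by (auto simp: span_singleton)
  have "k * (c \<bullet> c) = v \<bullet> \<P> c c c"
    using k jordan_P_inner[of c c v c] by simp
  also have "\<P> c c c = c" using c by (simp add: jordan_P_same scaleR_2)
  finally have "k = (c \<bullet> v) / (c \<bullet> c)" using c by (simp add: inner_commute field_simps)
  then show ?thesis using k by simp
qed

text \<open>Induction on the dimension of the Peirce 1-space. A splitting c = a + b with xa = l a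
  leaves x - l a in the 1-space of \<open>b\<close>, and the 1-spaces of \<open>a\<close> and
  \<open>b\<close> are both smaller because each misses the other idempotent.\<close>

lemma idempotent_spectral:
  assumes "c \<odot> c = c" "c \<odot> x = x"
  shows "\<exists>C. finite C \<and> (\<forall>d\<in>C. primitive_idempotent (\<odot>) d \<and> c \<odot> d = d) \<and>
    (\<forall>d\<in>C. \<forall>d'\<in>C. d \<noteq> d' \<longrightarrow> d \<odot> d' = 0) \<and> \<Sum>C = c \<and> x \<in> span C"
  using assms
proof (induction "dim {v. c \<odot> v = v}" arbitrary: c x rule: less_induct)
  case less
  have sub: "subspace {v. b \<odot> v = v}" for b
    by (auto simp: subspace_def prod_expand)
  consider "c = 0" | "primitive_idempotent (\<odot>) c" "x \<in> span {c}"
    | a l where "a \<noteq> 0" "a \<noteq> c" "a \<odot> a = a" "c \<odot> a = a" "x \<odot> a = l *\<^sub>R a"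
  proof (cases "x \<in> span {c}")
    case False
    from split_idempotent[OF less.prems this] show ?thesis using that(3) by blast
  next
    case True
    show ?thesis
    proof (cases "c = 0 \<or> primitive_idempotent (\<odot>) c")
      case False
      \<comment> \<open>Here \<open>x\<close> is a multiple of \<open>c\<close>, so any splitting of
        \<open>c\<close> serves and the scalar is the eigenvalue on \<open>a\<close>.\<close>
      then obtain a b where ab: "a \<noteq> 0" "b \<noteq> 0" "a \<odot> a = a" "b \<odot> b = b" "a \<odot> b = 0" "c = a + b"
        using less.prems unfolding primitive_idempotent_def by blast
      moreover have "c \<odot> a = a" "a \<odot> c = a" using ab prod_commute[of a b] by (simp_all add: prod_expand)
      moreover obtain l where "x = l *\<^sub>R c" using True by (auto simp: span_singleton)
      ultimately show ?thesis using that(3)[of a l] by (auto simp: prod_expand)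
    qed (use True that in auto)
  qed
  then show ?case
  proof cases
    case 1 then show ?thesis
      using less.prems by (intro exI[of _ "{}"]) (auto simp: prod_expand)
  next
    case 2 then show ?thesis
      using less.prems by (intro exI[of _ "{c}"]) auto
  next
    case (3 a l)
    define b where "b = c - a"
    have b: "b \<odot> b = b" "a \<odot> b = 0" "b \<odot> a = 0" "c \<odot> b = b" "b \<noteq> 0"
      using 3 less.prems idempotent_diff[of c a] by (auto simp: b_def prod_expand)
    define y where "y = x - l *\<^sub>R a"
    have ax: "a \<odot> x = l *\<^sub>R a" using 3 prod_commute by metis
    have y: "b \<odot> y = y" unfolding b_def y_def
      using less.prems 3 ax by (simp add: prod_expand)
    have step: "dim {v. u \<odot> v = v} < dim {v. c \<odot> v = v} \<and> (\<forall>v. u \<odot> v = v \<longrightarrow> c \<odot> v = v)"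
      if u: "u \<odot> u = u" "w \<odot> w = w" "u \<odot> w = 0" "w \<noteq> 0" "c = u + w" for u w
    proof -
      have "c \<odot> v = v" if "u \<odot> v = v" for v
        using peirce_1_0[of u v w] that u prod_commute[of v w] by (simp add: prod_expand)
      moreover have "c \<odot> w = w" "u \<odot> w \<noteq> w" using u by (simp_all add: prod_expand)
      ultimately have "{v. u \<odot> v = v} \<subset> {v. c \<odot> v = v}" by blast
      moreover have spn: "span {v. b \<odot> v = v} = {v. b \<odot> v = v}" for b
        using sub[of b] by (simp only: span_eq_iff)
      ultimately have "dim {v. u \<odot> v = v} < dim {v. c \<odot> v = v}" by (intro dim_psubset) (simp only: spn)
      then show ?thesis using \<open>\<And>v. u \<odot> v = v \<Longrightarrow> c \<odot> v = v\<close> by blast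
    qed
    have sa: "dim {v. a \<odot> v = v} < dim {v. c \<odot> v = v}" "\<And>v. a \<odot> v = v \<Longrightarrow> c \<odot> v = v"
      using step[OF \<open>a \<odot> a = a\<close> b(1,2) b(5)] unfolding b_def by simp_all
    have sb: "dim {v. b \<odot> v = v} < dim {v. c \<odot> v = v}" "\<And>v. b \<odot> v = v \<Longrightarrow> c \<odot> v = v"
      using step[OF b(1) \<open>a \<odot> a = a\<close> b(3) \<open>a \<noteq> 0\<close>] unfolding b_def by simp_all
    \<comment> \<open>The part of \<open>x\<close> belonging to \<open>a\<close> is the known
      multiple \<open>l *\<^sub>R a\<close>, so the induction hypothesis is applied with
      \<open>a\<close> itself as the vector; only the splitting of the idempotent is kept.\<close>
    obtain Ca where Ca: "finite Ca" "\<forall>d\<in>Ca. primitive_idempotent (\<odot>) d \<and> a \<odot> d = d"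
      "\<forall>d\<in>Ca. \<forall>d'\<in>Ca. d \<noteq> d' \<longrightarrow> d \<odot> d' = 0" "\<Sum>Ca = a"
      using less.hyps[OF sa(1) 3(3) 3(3)] by blast
    obtain Cb where Cb: "finite Cb" "\<forall>d\<in>Cb. primitive_idempotent (\<odot>) d \<and> b \<odot> d = d"
      "\<forall>d\<in>Cb. \<forall>d'\<in>Cb. d \<noteq> d' \<longrightarrow> d \<odot> d' = 0" "\<Sum>Cb = b" "y \<in> span Cb"
      using less.hyps[OF sb(1) b(1) y] by blast
    have orth: "d \<odot> d' = 0" if "d \<in> Ca" "d' \<in> Cb" for d d'
    proof -
      have "a \<odot> d' = 0" using peirce_1_0[of b d' a] b Cb that prod_commute[of a d'] by auto
      then show ?thesis using peirce_1_0[of a d d'] Ca that 3 by auto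
    qed
    have disj: "Ca \<inter> Cb = {}"
    proof -
      have "d \<odot> d = 0" if "d \<in> Ca \<inter> Cb" for d using orth that by auto
      moreover have "d \<odot> d \<noteq> 0" if "d \<in> Ca" for d
        using Ca that unfolding primitive_idempotent_def by auto
      ultimately show ?thesis by blast
    qed
    have "x = l *\<^sub>R \<Sum>Ca + y" using Ca by (simp add: y_def)
    moreover have "\<Sum>Ca \<in> span (Ca \<union> Cb)" by (intro span_sum span_base) auto
    moreover have "y \<in> span (Ca \<union> Cb)" using Cb(5) span_mono[of Cb "Ca \<union> Cb"] by auto
    ultimately have "x \<in> span (Ca \<union> Cb)" by (simp add: span_add span_scale)
    moreover have "\<Sum>(Ca \<union> Cb) = c" using Ca Cb disj by (simp add: sum.union_disjoint b_def)
    moreover have "d \<odot> d' = 0" if "d \<in> Ca \<union> Cb" "d' \<in> Ca \<union> Cb" "d \<noteq> d'" for d d'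
      using that Ca(3) Cb(3) orth prod_commute[of d d'] by auto
    ultimately show ?thesis
      using Ca Cb sa(2) sb(2) by (intro exI[of _ "Ca \<union> Cb"]) auto
  qed
qed

lemma spectral: obtains C where "jordan_frame (\<odot>) e C" "x \<in> span C"
  using idempotent_spectral[of e x] by (auto simp: unit_left jordan_frame_def)

end

section \<open>Jordan frames in a simple algebra\<close>

text \<open>The two leading coefficients are singled out because the second one becomes the
  trace.\<close>

lemma prod_diff_expansion:
  fixes l :: "'b \<Rightarrow> real"
  assumes "finite S"
  shows "\<exists>a. \<forall>t. (\<Prod>c\<in>S. t - l c) =
    t ^ card S - (\<Sum>c\<in>S. l c) * t ^ (card S - 1) + (\<Sum>k<card S - 1. a k * t ^ k)"
  using assms
proof (induction S)
  case empty then show ?case by simp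
next
  case (insert c S)
  then obtain a where a: "\<And>t. (\<Prod>c\<in>S. t - l c) =
    t ^ card S - (\<Sum>c\<in>S. l c) * t ^ (card S - 1) + (\<Sum>k<card S - 1. a k * t ^ k)" by blast
  show ?case
  proof (cases "card S")
    case 0
    then have "S = {}" using insert by simp
    then show ?thesis by simp
  next
    case (Suc m)
    define s where "s = (\<Sum>c\<in>S. l c)"
    define b where "b k = (if k = 0 then 0 else a (k - 1)) - (if k < m then l c * a k else 0)
       + (if k = m then l c * s else 0)" for k
    have "(\<Prod>c\<in>insert c S. t - l c) = t ^ Suc (Suc m) - (l c + s) * t ^ Suc m + (\<Sum>k<Suc m. b k * t ^ k)" for t
    proof -
      have "(\<Sum>k<Suc m. b k * t ^ k) =
        (\<Sum>k<Suc m. (if k = 0 then 0 else a (k - 1)) * t ^ k) - (\<Sum>k<Suc m. (if k < m then l c * a k else 0) * t ^ k)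
         + (\<Sum>k<Suc m. (if k = m then l c * s else 0) * t ^ k)"
        by (simp only: b_def algebra_simps sum.distrib sum_subtractf)
      also have "(\<Sum>k<Suc m. (if k = 0 then 0 else a (k - 1)) * t ^ k) = t * (\<Sum>k<m. a k * t ^ k)"
        by (simp only: sum.lessThan_Suc_shift) (simp add: sum_distrib_left mult_ac)
      also have "(\<Sum>k<Suc m. (if k < m then l c * a k else 0) * t ^ k) = l c * (\<Sum>k<m. a k * t ^ k)"
        by (simp add: sum_distrib_left mult_ac)
      also have "(\<Sum>k<Suc m. (if k = m then l c * s else 0) * t ^ k) = l c * s * t ^ m"
        by (simp add: sum.neutral)
      finally have "(\<Sum>k<Suc m. b k * t ^ k) =
        t * (\<Sum>k<m. a k * t ^ k) - l c * (\<Sum>k<m. a k * t ^ k) + l c * s * t ^ m" .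
      moreover have "(\<Prod>c\<in>insert c S. t - l c) = (t - l c) * (t ^ Suc m - s * t ^ m + (\<Sum>k<m. a k * t ^ k))"
        using insert a[of t] by (simp add: Suc s_def)
      ultimately show ?thesis by (simp only:) (simp add: algebra_simps)
    qed
    then show ?thesis using insert Suc by (intro exI[of _ b]) (simp add: s_def)
  qed
qed

lemma half_eqI: "2 *\<^sub>R x = y \<Longrightarrow> x = (1/2) *\<^sub>R (y :: 'b::real_vector)"
  by auto

section \<open>Joint Peirce spaces of a frame\<close>

context euclidean_jordan_algebra
begin

abbreviation "primitive \<equiv> primitive_idempotent (\<odot>)"
abbreviation "frame \<equiv> jordan_frame (\<odot>) e"

definition peirce :: "'a \<Rightarrow> 'a \<Rightarrow> 'a set" where
  "peirce c d = {x. c \<odot> x = (1/2) *\<^sub>R x \<and> d \<odot> x = (1/2) *\<^sub>R x}"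

lemma frameD:
  assumes "frame C"
  shows "finite C" "\<And>c. c \<in> C \<Longrightarrow> primitive c" "\<And>c. c \<in> C \<Longrightarrow> c \<odot> c = c" "\<And>c. c \<in> C \<Longrightarrow> c \<noteq> 0"
    "\<And>c d. c \<in> C \<Longrightarrow> d \<in> C \<Longrightarrow> c \<noteq> d \<Longrightarrow> c \<odot> d = 0" "\<Sum>C = e"
  using assms by (auto simp: jordan_frame_def primitive_idempotent_def)

lemma frame_inner: "frame C \<Longrightarrow> c \<in> C \<Longrightarrow> d \<in> C \<Longrightarrow> c \<noteq> d \<Longrightarrow> c \<bullet> d = 0"
  using inner_unit[of c d] by (simp add: frameD)

lemma frame_commute: "frame C \<Longrightarrow> c \<in> C \<Longrightarrow> d \<in> C \<Longrightarrow> c \<odot> (d \<odot> v) = d \<odot> (c \<odot> v)"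
  by (cases "c = d") (auto intro: idempotent_commute simp: frameD)

lemma frame_sum: "frame C \<Longrightarrow> (\<Sum>c\<in>C. c \<odot> v) = v"
  using frameD(6)[of C] by (simp add: prod.sum_left[symmetric] unit_left)

text \<open>Insert the unit as the sum of the frame twice and trade the diagonal terms for
  \<open>\<P> c c v\<close>. The sum runs over ordered pairs, so the component 4 c(dv) of a joint
  Peirce space appears as two equal halves.\<close>

lemma frame_decomposition:
  assumes "frame C"
  shows "v = (\<Sum>c\<in>C. \<P> c c v) + 2 *\<^sub>R (\<Sum>c\<in>C. \<Sum>d\<in>C - {c}. c \<odot> (d \<odot> v))"
proof -
  have "v = (\<Sum>c\<in>C. \<Sum>d\<in>C. c \<odot> (d \<odot> v))"
    by (simp add: frame_sum[OF assms] prod.sum_right[symmetric])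
  also have "\<dots> = (\<Sum>c\<in>C. c \<odot> (c \<odot> v)) + (\<Sum>c\<in>C. \<Sum>d\<in>C - {c}. c \<odot> (d \<odot> v))"
    unfolding sum.distrib[symmetric]
    by (intro sum.cong refl) (simp add: sum.remove frameD[OF assms])
  finally have 1: "(\<Sum>c\<in>C. \<Sum>d\<in>C - {c}. c \<odot> (d \<odot> v)) = v - (\<Sum>c\<in>C. c \<odot> (c \<odot> v))"
    by (simp add: algebra_simps)
  have "(\<Sum>c\<in>C. \<P> c c v) = 2 *\<^sub>R (\<Sum>c\<in>C. c \<odot> (c \<odot> v)) - v"
    using frame_sum[OF assms, of v]
    by (simp add: jordan_P_same frameD[OF assms] sum_subtractf scaleR_sum_right)
  then show ?thesis unfolding 1 by (simp add: scaleR_2 algebra_simps)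
qed

lemma frame_peirce_1_kill:
  "frame C \<Longrightarrow> c \<in> C \<Longrightarrow> d \<in> C \<Longrightarrow> c \<noteq> d \<Longrightarrow> c \<odot> u = u \<Longrightarrow> d \<odot> u = 0"
  using peirce_1_0[of c u d] prod_commute[of u d] by (simp add: frameD)

text \<open>\<open>u\<close> lies in the 1-space and \<open>b\<close> in the 0-space of the
  idempotent \<open>c + d\<close>.\<close>

lemma frame_peirce_kill:
  assumes "frame C" "c \<in> C" "d \<in> C" "b \<in> C" "c \<noteq> d" "b \<noteq> c" "b \<noteq> d" "u \<in> peirce c d"
  shows "b \<odot> u = 0"
proof -
  have "(c + d) \<odot> (c + d) = c + d" "(c + d) \<odot> u = u" "(c + d) \<odot> b = 0"
    using assms frameD[OF assms(1)] prod_commute[of d c]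
    by (simp_all add: prod_expand peirce_def flip: scaleR_add_left)
  from peirce_1_0[OF this] show ?thesis by (simp add: prod_commute)
qed

text \<open>\<open>d\<close> annihilates \<open>\<P> c c v\<close>, which lies in the 1-space of
  \<open>c\<close>. Written out and commuted, this is the eigenvalue equation for \<open>c\<close>;
  the one for \<open>d\<close> follows by symmetry.\<close>

lemma frame_peirce_proj:
  assumes "frame C" "c \<in> C" "d \<in> C" "c \<noteq> d"
  shows "c \<odot> (d \<odot> v) \<in> peirce c d"
proof -
  have half: "c \<odot> (c \<odot> (d \<odot> v)) = (1/2) *\<^sub>R (c \<odot> (d \<odot> v))" if "c \<in> C" "d \<in> C" "c \<noteq> d" for c d
  proof -
    have "d \<odot> \<P> c c v = 0"
      using frame_peirce_1_kill[OF assms(1) that] jordan_P_idempotent frameD[OF assms(1)] that by blast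
    then have "2 *\<^sub>R (c \<odot> (c \<odot> (d \<odot> v))) = c \<odot> (d \<odot> v)"
      using that frame_commute[OF assms(1) that(1) that(2)] frameD[OF assms(1)]
      by (simp add: jordan_P_same prod_expand)
    then show ?thesis by (rule half_eqI)
  qed
  show ?thesis
    using half[of c d] half[of d c] assms frame_commute[OF assms(1-3)] by (simp add: peirce_def)
qed

text \<open>Peirce rules give xx = al c + be d with al (c|c) = be (d|d) = (x|x)/2. By the Jordan
  identity x times x^3 equals the square of x^2, and the coefficients of \<open>c\<close> there
  force al = be. Hence coupled members of a frame have equal norm.\<close>

lemma peirce_square:
  assumes C: "frame C" "c \<in> C" "d \<in> C" "c \<noteq> d" and x: "x \<in> peirce c d" "x \<noteq> 0"
  obtains al where "al > 0" "x \<odot> x = al *\<^sub>R (c + d)" "c \<bullet> c = d \<bullet> d"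
proof -
  note F = frameD[OF C(1)]
  have cd: "c \<odot> d = 0" "d \<odot> c = 0" using F C by auto
  have f: "(c + d) \<odot> (c + d) = c + d" "(c + d) \<odot> x = x"
    using F C x cd by (simp_all add: prod_expand peirce_def flip: scaleR_add_left)
  have fx: "(c + d) \<odot> (x \<odot> x) = x \<odot> x" using idempotent_commute[OF f(1), of x x] f by simp
  have "c \<odot> (c \<odot> (x \<odot> x)) = c \<odot> (x \<odot> x)" "d \<odot> (d \<odot> (x \<odot> x)) = d \<odot> (x \<odot> x)"
    using x F C by (auto intro!: peirce_half_half simp: peirce_def)
  then have "c \<odot> (x \<odot> x) \<in> span {c}" "d \<odot> (x \<odot> x) \<in> span {d}"
    using primitive_peirce_1 F(2) C by blast+
  then obtain al be where ab: "c \<odot> (x \<odot> x) = al *\<^sub>R c" "d \<odot> (x \<odot> x) = be *\<^sub>R d"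
    by (auto simp: span_singleton)
  have xx: "x \<odot> x = al *\<^sub>R c + be *\<^sub>R d" using fx ab by (simp add: prod_expand)
  have icd: "c \<bullet> d = 0" "d \<bullet> c = 0" using frame_inner[OF C] by (simp_all add: inner_commute)
  have x': "x \<odot> c = (1/2) *\<^sub>R x" "x \<odot> d = (1/2) *\<^sub>R x"
    using x prod_commute by (auto simp: peirce_def)
  have "(x \<odot> x) \<bullet> c = (x \<bullet> x) / 2" "(x \<odot> x) \<bullet> d = (x \<bullet> x) / 2"
    using x' by (simp_all add: inner_assoc)
  then have n: "al * (c \<bullet> c) = (x \<bullet> x) / 2" "be * (d \<bullet> d) = (x \<bullet> x) / 2"
    using xx icd by (simp_all add: inner_add_left)
  have pos: "x \<bullet> x > 0" "c \<bullet> c > 0" "d \<bullet> d > 0" using x F C by auto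
  have "al * (c \<bullet> c) > 0" using n(1) pos(1) by linarith
  then have al: "al > 0" using pos by (simp add: zero_less_mult_iff)
  have "x \<odot> (x \<odot> x) = ((al + be) / 2) *\<^sub>R x"
    using x' by (subst xx) (simp add: prod_expand add_divide_distrib scaleR_add_left)
  then have "x \<odot> (x \<odot> (x \<odot> x)) = ((al + be) / 2) *\<^sub>R (x \<odot> x)" by (simp only: prod_expand)
  moreover have "x \<odot> (x \<odot> (x \<odot> x)) = (x \<odot> x) \<odot> (x \<odot> x)"
    using jordan_identity[of x x] prod_commute[of "x \<odot> x" x] by simp
  moreover have "(x \<odot> x) \<odot> (x \<odot> x) = (al * al) *\<^sub>R c + (be * be) *\<^sub>R d"
    unfolding xx using F C cd by (simp add: prod_expand)
  ultimately have "((al * al) *\<^sub>R c + (be * be) *\<^sub>R d) \<bullet> c = (((al + be) / 2) *\<^sub>R (al *\<^sub>R c + be *\<^sub>R d)) \<bullet> c"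
    using xx by simp
  then have "al * al = (al + be) / 2 * al" using icd pos by (simp add: inner_add_left)
  then have "al = be" using al by simp
  then have "c \<bullet> c = d \<bullet> d" using n al by (metis less_irrefl mult_left_cancel)
  then show thesis using that[of al] al \<open>al = be\<close> xx by (simp add: scaleR_add_right)
qed

end

section \<open>Consequences of simplicity for a frame\<close>

context simple_euclidean_jordan_algebra
begin

text \<open>If \<open>S\<close> is not coupled to its complement, its sum \<open>f\<close> has no
  eigenvalue 1/2. Then the Peirce 1-space of \<open>f\<close> is an ideal, and simplicity leaves
  only the two trivial cases.\<close>

lemma frame_connected:
  assumes C: "frame C" and S: "S \<subseteq> C"
    and sep: "\<And>c d. c \<in> S \<Longrightarrow> d \<in> C - S \<Longrightarrow> peirce c d = {0}"
  shows "S = {} \<or> S = C"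
proof -
  note F = frameD[OF C]
  define f where "f = \<Sum>S"
  have finS: "finite S" using F S finite_subset by blast
  have fm: "f \<odot> v = (\<Sum>b\<in>S. b \<odot> v)" for v by (simp add: f_def prod.sum_left)
  have fS: "f \<odot> u = (if c \<in> S then u else 0)" if "c \<in> C" "c \<odot> u = u" for c u
  proof -
    have "f \<odot> u = (\<Sum>b\<in>S. if b = c then u else 0)"
      unfolding fm using S that frame_peirce_1_kill[OF C] by (intro sum.cong) (auto)
    then show ?thesis using finS by simp
  qed
  have ff: "f \<odot> f = f"
  proof -
    have "f \<odot> f = (\<Sum>c\<in>S. f \<odot> c)" by (simp add: f_def prod.sum_right)
    also have "\<dots> = (\<Sum>c\<in>S. c)" using S fS F by (intro sum.cong) auto
    finally show ?thesis by (simp add: f_def)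
  qed
  have fcomm: "f \<odot> (c \<odot> v) = c \<odot> (f \<odot> v)" if "c \<in> C" for c v
    unfolding fm prod.sum_right using S that frame_commute[OF C] by (intro sum.cong) auto
  \<comment> \<open>On each frame component \<open>f\<close> acts as 0 or 1, except on the joint
    Peirce spaces between \<open>S\<close> and its complement, which vanish by assumption.\<close>
  have half0: "v = 0" if v: "f \<odot> v = (1/2) *\<^sub>R v" for v
  proof -
    have hz: "u = 0" if "u = (1/2) *\<^sub>R u" for u :: 'a
      using arg_cong[OF that, of "(*\<^sub>R) 2"] by (simp add: scaleR_2)
    have "\<P> c c v = 0" if c: "c \<in> C" for c
    proof -
      let ?u = "\<P> c c v"
      have "f \<odot> ?u = (1/2) *\<^sub>R ?u"
        using c F(3) v by (simp add: jordan_P_same prod_expand fcomm scaleR_diff_right)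
      moreover have "f \<odot> ?u = (if c \<in> S then ?u else 0)"
        using fS[OF c jordan_P_idempotent] F(3) c by blast
      ultimately show ?thesis using hz[of ?u] by (auto split: if_splits)
    qed
    moreover have "c \<odot> (d \<odot> v) = 0" if cd: "c \<in> C" "d \<in> C - {c}" for c d
    proof -
      let ?u = "c \<odot> (d \<odot> v)"
      have u: "?u \<in> peirce c d" using frame_peirce_proj[OF C] cd by auto
      have 1: "f \<odot> ?u = (1/2) *\<^sub>R ?u"
        using cd v by (simp add: prod_expand fcomm)
      have "f \<odot> ?u = (\<Sum>b\<in>S. (if b = c then (1/2) *\<^sub>R ?u else 0) + (if b = d then (1/2) *\<^sub>R ?u else 0))"
        unfolding fm
      proof (intro sum.cong refl)
        fix b assume "b \<in> S"
        then have "b \<in> C" using S by blast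
        then show "b \<odot> ?u = (if b = c then (1/2) *\<^sub>R ?u else 0) + (if b = d then (1/2) *\<^sub>R ?u else 0)"
          using u cd frame_peirce_kill[OF C, of c d b ?u] by (auto simp: peirce_def)
      qed
      also have "\<dots> = (if c \<in> S then (1/2) *\<^sub>R ?u else 0) + (if d \<in> S then (1/2) *\<^sub>R ?u else 0)"
        using finS by (simp add: sum.distrib)
      finally have 2: "f \<odot> ?u = \<dots>" .
      consider "c \<in> S" "d \<notin> S" | "d \<in> S" "c \<notin> S" | "c \<in> S" "d \<in> S" | "c \<notin> S" "d \<notin> S" by blast
      then show ?thesis
      proof cases
        case 1 then show ?thesis using sep[of c d] cd u by auto
      next
        case 2 then show ?thesis using sep[of d c] cd u by (auto simp: peirce_def)
      next
        case 3
        then have "f \<odot> ?u = ?u" using 2 by (simp flip: scaleR_add_left)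
        then show ?thesis using 1 hz[of ?u] by simp
      next
        case 4
        then have "f \<odot> ?u = 0" using 2 by simp
        then show ?thesis using 1 by simp
      qed
    qed
    ultimately show "v = 0" using frame_decomposition[OF C, of v] by simp
  qed
  \<comment> \<open>By the cubic relation for idempotents, the difference of the two sides is an
    eigenvector for 1/2.\<close>
  have fx: "f \<odot> (f \<odot> x) = f \<odot> x" for x
  proof -
    have "f \<odot> (f \<odot> x - f \<odot> (f \<odot> x)) = (1/2) *\<^sub>R (f \<odot> x - f \<odot> (f \<odot> x))"
    proof -
      have "2 *\<^sub>R (f \<odot> (f \<odot> x - f \<odot> (f \<odot> x))) = f \<odot> x - f \<odot> (f \<odot> x)"
        using peirce_polynomial[OF ff, of x]
        by (simp add: prod_expand algebra_simps scaleR_2 scaleR_left.add[of 2 1, simplified])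
      then show ?thesis by (rule half_eqI)
    qed
    from half0[OF this] show ?thesis by simp
  qed
  define I where "I = {v. f \<odot> v = v}"
  have "subspace I" by (auto simp: I_def subspace_def prod_expand)
  moreover have "x \<odot> y \<in> I" if "y \<in> I" for x y
  proof -
    have y: "f \<odot> y = y" using that by (simp add: I_def)
    have "y \<odot> (x - f \<odot> x) = 0" by (rule peirce_1_0[OF ff y]) (simp add: prod_expand fx)
    then have "x \<odot> y = (f \<odot> x) \<odot> y" using prod_commute[of y] by (simp add: prod_expand)
    moreover have "f \<odot> ((f \<odot> x) \<odot> y) = (f \<odot> x) \<odot> (f \<odot> y)"
      by (rule idempotent_commute[OF ff]) (simp add: fx)
    ultimately show ?thesis using y by (simp add: I_def)
  qed
  ultimately have "I = {0} \<or> I = UNIV" by (rule simple)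
  then show ?thesis
  proof
    assume "I = {0}"
    moreover have "c \<in> I" if "c \<in> S" for c using fS[of c c] F that S by (auto simp: I_def)
    ultimately show ?thesis using F S by blast
  next
    assume "I = UNIV"
    then have "f \<odot> c = c" for c by (auto simp: I_def)
    then have "c \<in> S" if "c \<in> C" for c
      using fS[OF that F(3)[OF that]] F(4)[OF that] by (auto split: if_splits)
    then show ?thesis using S by blast
  qed
qed

text \<open>Members of different norm are uncoupled by \<open>peirce_square\<close>, so the class of
  those with the norm of \<open>c\<close> is the whole frame.\<close>

lemma frame_norm:
  assumes "frame C" "c \<in> C" "d \<in> C"
  shows "c \<bullet> c = d \<bullet> d"
proof -
  define S where "S = {b \<in> C. b \<bullet> b = c \<bullet> c}"
  have "S = {} \<or> S = C"
  proof (rule frame_connected[OF assms(1)])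
    fix a b assume ab: "a \<in> S" "b \<in> C - S"
    then have "a \<noteq> b" "a \<in> C" "b \<in> C" "a \<bullet> a \<noteq> b \<bullet> b" by (auto simp: S_def)
    then have "x = 0" if "x \<in> peirce a b" for x
      using peirce_square[OF assms(1) _ _ _ that] by blast
    then show "peirce a b = {0}" by (auto simp: peirce_def prod_expand)
  qed (auto simp: S_def)
  then have "d \<in> S" using assms by (auto simp: S_def)
  then show ?thesis by (simp add: S_def)
qed

end

section \<open>Rank and trace\<close>

lemma span_image_lessThan:
  fixes f :: "nat \<Rightarrow> 'b::real_vector"
  assumes "y \<in> span (f ` {..<k})"
  obtains u where "y = (\<Sum>i<k. u i *\<^sub>R f i)"
proof -
  have "\<exists>u. y = (\<Sum>i<k. u i *\<^sub>R f i)" using assms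
  proof (induction rule: span_induct_alt)
    case base show ?case by (intro exI[of _ "\<lambda>_. 0"]) simp
  next
    case (step c x y)
    then obtain j u where ju: "j < k" "x = f j" "y = (\<Sum>i<k. u i *\<^sub>R f i)" by auto
    have "c *\<^sub>R x = (\<Sum>i<k. (if i = j then c else 0) *\<^sub>R f i)"
      using ju by (simp add: if_distrib[of "\<lambda>a. a *\<^sub>R _"] cong: if_cong)
    then have "c *\<^sub>R x + y = (\<Sum>i<k. ((if i = j then c else 0) + u i) *\<^sub>R f i)"
      using ju by (simp add: scaleR_add_left sum.distrib)
    then show ?case by (intro exI[of _ "\<lambda>i. (if i = j then c else 0) + u i"])
  qed
  then show thesis using that by blast
qed

text \<open>Expansion in an orthonormal basis of the range turns the trace into a count. It serves
  to read dimensions of Peirce spaces off traces.\<close>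

lemma trace_orthogonal_projection:
  fixes p :: "'b::euclidean_space \<Rightarrow> 'b"
  assumes "subspace S" "\<And>v. p v \<in> S" "\<And>v. v \<in> S \<Longrightarrow> p v = v" "\<And>v w. p v \<bullet> w = v \<bullet> p w"
  shows "(\<Sum>b\<in>Basis. p b \<bullet> b) = real (dim S)"
proof -
  obtain B where B: "B \<subseteq> S" "pairwise orthogonal B" "\<And>x. x \<in> B \<Longrightarrow> norm x = 1"
    "independent B" "card B = dim S" "span B = S"
    using orthonormal_basis_subspace[OF assms(1)] by blast
  have fin: "finite B" using B independent_imp_finite by blast
  have ip: "u \<bullet> w = (if u = w then 1 else 0)" if "u \<in> B" "w \<in> B" for u w
    using B that by (auto simp: pairwise_def orthogonal_def dot_square_norm)
  have expand: "v = (\<Sum>u\<in>B. (v \<bullet> u) *\<^sub>R u)" if "v \<in> S" for v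
  proof -
    have "v \<in> range (\<lambda>k. \<Sum>u\<in>B. k u *\<^sub>R u)"
      using that B(6) span_finite[OF fin] by simp
    then obtain k where k: "v = (\<Sum>u\<in>B. k u *\<^sub>R u)" by auto
    have "v \<bullet> w = k w" if "w \<in> B" for w
    proof -
      have "v \<bullet> w = (\<Sum>u\<in>B. if u = w then k w else 0)"
        unfolding k inner_sum_left using ip that by (intro sum.cong) auto
      then show ?thesis using fin that by simp
    qed
    then show ?thesis using k by simp
  qed
  have "(\<Sum>b\<in>Basis. p b \<bullet> b) = (\<Sum>b\<in>Basis. \<Sum>u\<in>B. (b \<bullet> u) * (b \<bullet> u))"
  proof (intro sum.cong refl)
    fix b
    have "p b \<bullet> b = (\<Sum>u\<in>B. (p b \<bullet> u) *\<^sub>R u) \<bullet> b" using expand[OF assms(2)] by metis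
    also have "\<dots> = (\<Sum>u\<in>B. (b \<bullet> u) * (b \<bullet> u))"
      unfolding inner_sum_left
    proof (intro sum.cong refl)
      fix u assume "u \<in> B"
      then have "p u = u" using assms(3) B by auto
      then show "((p b \<bullet> u) *\<^sub>R u) \<bullet> b = (b \<bullet> u) * (b \<bullet> u)"
        using assms(4)[of b u] by (simp add: inner_commute)
    qed
    finally show "p b \<bullet> b = (\<Sum>u\<in>B. (b \<bullet> u) * (b \<bullet> u))" .
  qed
  also have "\<dots> = (\<Sum>u\<in>B. \<Sum>b\<in>Basis. (u \<bullet> b) * (u \<bullet> b))"
    by (subst sum.swap) (simp add: inner_commute)
  also have "\<dots> = (\<Sum>u\<in>B. u \<bullet> u)" by (intro sum.cong refl) (simp add: euclidean_inner[symmetric])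
  also have "\<dots> = real (dim S)" using ip B by simp
  finally show ?thesis .
qed

section \<open>Comparing primitive idempotents of different frames\<close>

context euclidean_jordan_algebra
begin

text \<open>The two idempotents need not lie in a common frame, so \<open>peirce_square\<close> is
  out of reach. Write p = al c + x + z in the Peirce spaces 1, 1/2, 0 of \<open>c\<close> and
  compare the 1/2-components of pp = p and of P(p)c = be p: this gives (al - be)x = 0, and al = be
  is the equality of norms.\<close>

lemma primitive_norm_overlap:
  assumes c: "primitive c" and p: "primitive p" and ne: "c \<bullet> p \<noteq> 0"
  shows "c \<bullet> c = p \<bullet> p"
proof -
  have cc: "c \<odot> c = c" "c \<noteq> 0" and pp: "p \<odot> p = p" "p \<noteq> 0"
    using c p by (auto simp: primitive_idempotent_def)
  define al where "al = (c \<bullet> p) / (c \<bullet> c)"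
  define be where "be = (p \<bullet> c) / (p \<bullet> p)"
  define q where "q = c \<odot> p"
  have "2 *\<^sub>R (c \<odot> q) - q = al *\<^sub>R c"
    using primitive_P[OF c, of p] by (simp add: jordan_P_same cc al_def q_def)
  then have "2 *\<^sub>R (c \<odot> q) = al *\<^sub>R c + q" by (simp add: algebra_simps)
  then have cq: "c \<odot> q = (1/2) *\<^sub>R (al *\<^sub>R c + q)" by (rule half_eqI)
  define x where "x = 2 *\<^sub>R q - (2 * al) *\<^sub>R c"
  define z where "z = p - al *\<^sub>R c - x"
  have q: "q = al *\<^sub>R c + (1/2) *\<^sub>R x" by (simp add: x_def scaleR_diff_right)
  have cx: "c \<odot> x = (1/2) *\<^sub>R x"
    by (simp add: x_def prod_expand cq cc scaleR_diff_right scaleR_add_right) (simp add: algebra_simps flip: scaleR_add_left)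
  have cz: "c \<odot> z = 0" unfolding z_def prod_expand cx cc
    by (simp add: q_def[symmetric] q)
  have xc: "x \<odot> c = (1/2) *\<^sub>R x" "z \<odot> c = 0" "z \<odot> x = x \<odot> z"
    using cx cz prod_commute by metis+
  have pe: "p = al *\<^sub>R c + x + z" by (simp add: z_def)
  \<comment> \<open>4t - 4t^2 is 1 at 1/2 and 0 at 0 and 1, so \<open>H\<close> is the projection
    onto the Peirce 1/2-space of \<open>c\<close>.\<close>
  define H where "H v = 4 *\<^sub>R (c \<odot> v) - 4 *\<^sub>R (c \<odot> (c \<odot> v))" for v
  have Hadd: "H (v + w) = H v + H w" and Hs: "H (k *\<^sub>R v) = k *\<^sub>R H v" for v w k
    by (simp_all add: H_def prod_expand algebra_simps)
  have Hc: "H c = 0" "H z = 0" by (simp_all add: H_def cc cz prod_expand)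
  have Hx: "H x = x" by (simp add: H_def cx prod_expand scaleR_2)
  have Hxx: "H (x \<odot> x) = 0" using peirce_half_half[OF cc(1) cx cx] by (simp add: H_def)
  have Hzz: "H (z \<odot> z) = 0" using idempotent_commute[OF cc(1), of z z] cz by (simp add: H_def prod_expand)
  have "c \<odot> (x \<odot> z) = (1/2) *\<^sub>R (x \<odot> z)"
    using idempotent_commute[OF cc(1), of z x] cz cx xc by (simp add: prod_expand)
  then have Hxz: "H (x \<odot> z) = x \<odot> z" by (simp add: H_def prod_expand scaleR_2)
  note Hs' = Hadd Hs Hc Hx Hxx Hzz Hxz
  have Hp: "H p = x" by (subst pe) (simp add: Hs')
  have "H (p \<odot> p) = al *\<^sub>R x + 2 *\<^sub>R (x \<odot> z)"
    by (subst (1 2) pe) (simp add: prod_expand cc cx cz xc Hs' scaleR_2 flip: scaleR_add_left)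
  then have e1: "x = al *\<^sub>R x + 2 *\<^sub>R (x \<odot> z)" using Hp pp by simp
  have "H (p \<odot> q) = (3/4 * al) *\<^sub>R x + (1/2) *\<^sub>R (x \<odot> z)"
    by (subst pe, subst q)
      (simp add: prod_expand cc cx cz xc Hs' scaleR_add_right, simp flip: scaleR_add_left add.assoc)
  moreover have "2 *\<^sub>R (p \<odot> q) + (-1) *\<^sub>R q = be *\<^sub>R p"
    using primitive_P[OF p, of c] prod_commute[of p c]
    by (simp add: jordan_P_same pp be_def q_def)
  then have "H (2 *\<^sub>R (p \<odot> q) + (-1) *\<^sub>R q) = be *\<^sub>R H p" by (simp only: Hs)
  then have "2 *\<^sub>R H (p \<odot> q) - H q = be *\<^sub>R x" by (simp only: Hadd Hs Hp) simp
  moreover have "H q = (1/2) *\<^sub>R x" by (subst q) (simp add: Hs')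
  ultimately have "(3/2 * al) *\<^sub>R x + x \<odot> z - (1/2) *\<^sub>R x = be *\<^sub>R x" by (simp add: scaleR_add_right)
  moreover have "x \<odot> z = (1/2) *\<^sub>R (x - al *\<^sub>R x)"
    by (rule half_eqI) (use e1 in \<open>simp add: algebra_simps\<close>)
  ultimately have "(al - be) *\<^sub>R x = 0"
    by (simp add: algebra_simps flip: scaleR_add_left)
  \<comment> \<open>Without a 1/2-component, pp = p forces al = 1 and makes \<open>z\<close> an
    idempotent orthogonal to \<open>c\<close>; primitivity of \<open>p\<close> then gives z =
    0.\<close>
  moreover have "al = be" if "x = 0"
  proof -
    have "p = al *\<^sub>R c + z" "q = al *\<^sub>R c" using that pe q by auto
    have "c \<odot> (z \<odot> z) = 0" using idempotent_commute[OF cc(1), of z z] cz by (simp add: prod_expand)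
    moreover have "p \<odot> p = (al * al) *\<^sub>R c + z \<odot> z"
      unfolding \<open>p = al *\<^sub>R c + z\<close> by (simp add: prod_expand cc cz xc)
    ultimately have "c \<odot> (p \<odot> p) = (al * al) *\<^sub>R c" by (simp add: prod_expand cc)
    moreover have "c \<odot> (p \<odot> p) = al *\<^sub>R c" using pp q_def \<open>q = al *\<^sub>R c\<close> by simp
    ultimately have "al * al = al" using cc by simp
    moreover have "al \<noteq> 0" using ne cc by (simp add: al_def)
    ultimately have "al = 1" by simp
    then have "p = c + z" using \<open>p = al *\<^sub>R c + z\<close> by simp
    then have "z \<odot> z = z" using pp cc cz xc by (simp add: prod_expand)
    then have "z = 0" using p cc cz \<open>p = c + z\<close> unfolding primitive_idempotent_def by blast
    then show ?thesis using \<open>p = c + z\<close> by (simp add: al_def be_def)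
  qed
  ultimately have "al = be" by auto
  then show ?thesis using ne by (simp add: al_def be_def inner_commute field_simps)
qed

lemma frame_overlap:
  assumes "frame C" "primitive p"
  obtains c where "c \<in> C" "c \<bullet> p \<noteq> 0"
proof -
  have "p \<odot> p = p" "p \<noteq> 0" using assms(2) by (auto simp: primitive_idempotent_def)
  then have "e \<bullet> p \<noteq> 0" using inner_unit[of p p] by (auto simp: inner_commute)
  then have "(\<Sum>c\<in>C. c \<bullet> p) \<noteq> 0" using frameD(6)[OF assms(1)] by (simp add: inner_sum_left[symmetric])
  then show thesis using that by (meson sum.neutral)
qed

section \<open>Minimal polynomials in frame coordinates\<close>

lemma frame_power:
  assumes "frame C"
  shows "jpow (\<Sum>c\<in>C. l c *\<^sub>R c) n = (\<Sum>c\<in>C. (l c ^ n) *\<^sub>R c)"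
proof (induction n)
  case 0 then show ?case using frameD[OF assms] by simp
next
  case (Suc n)
  have "(\<Sum>c\<in>C. \<Sum>d\<in>C. (l c * l d ^ n) *\<^sub>R (c \<odot> d)) = (\<Sum>c\<in>C. \<Sum>d\<in>C. if d = c then (l c ^ Suc n) *\<^sub>R c else 0)"
    using frameD[OF assms] by (intro sum.cong) auto
  moreover have "(\<Sum>c\<in>C. l c *\<^sub>R c) \<odot> (\<Sum>d\<in>C. (l d ^ n) *\<^sub>R d) =
      (\<Sum>c\<in>C. \<Sum>d\<in>C. (l c * l d ^ n) *\<^sub>R (c \<odot> d))"
    unfolding prod.sum_left unfolding prod.sum_right by (simp add: prod_expand mult_ac)
  ultimately show ?case using Suc frameD(1)[OF assms] by simp
qed

text \<open>Cayley-Hamilton in frame coordinates: the product of the factors \<open>t - l c\<close>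
  vanishes at every coordinate of \<open>x\<close>. As \<open>x\<close> may be non-regular, this
  bounds all degrees and also identifies the trace.\<close>

lemma frame_relation:
  assumes C: "frame C" and x: "x = (\<Sum>c\<in>C. l c *\<^sub>R c)"
  shows "jpow x (card C) - (\<Sum>c\<in>C. l c) *\<^sub>R jpow x (card C - 1)
    \<in> span (jpow x ` {..<card C - 1})"
proof -
  obtain a where a: "\<And>t. (\<Prod>c\<in>C. t - l c) =
    t ^ card C - (\<Sum>c\<in>C. l c) * t ^ (card C - 1) + (\<Sum>k<card C - 1. a k * t ^ k)"
    using prod_diff_expansion[OF frameD(1)[OF C], of l] by blast
  have "0 = (\<Sum>d\<in>C. (\<Prod>c\<in>C. l d - l c) *\<^sub>R d)"
    using frameD(1)[OF C] by (intro sum.neutral[symmetric]) auto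
  also have "\<dots> = jpow x (card C) - (\<Sum>c\<in>C. l c) *\<^sub>R jpow x (card C - 1)
     + (\<Sum>k<card C - 1. a k *\<^sub>R jpow x k)"
    unfolding a x frame_power[OF C] scaleR_sum_right
    by (simp add: sum.distrib sum_subtractf scaleR_add_left scaleR_diff_left scaleR_sum_left)
      (subst sum.swap, rule refl)
  finally have "jpow x (card C) - (\<Sum>c\<in>C. l c) *\<^sub>R jpow x (card C - 1)
     = - (\<Sum>k<card C - 1. a k *\<^sub>R jpow x k)" by (simp add: eq_neg_iff_add_eq_0)
  also have "\<dots> \<in> span (jpow x ` {..<card C - 1})"
    by (intro span_neg span_sum span_scale span_base) auto
  finally show ?thesis .
qed

lemma unit_nonzero: "e \<noteq> 0"
proof
  assume "e = 0"
  then have "x = 0" for x :: 'a using unit_left[of x] by (simp add: prod_expand)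
  moreover obtain b :: 'a where "b \<in> Basis" using nonempty_Basis by blast
  ultimately show False using nonzero_Basis by blast
qed

lemma frame_card_pos: "frame C \<Longrightarrow> card C > 0"
  using frameD[of C] unit_nonzero by (auto simp: card_gt_0_iff)

lemma frame_power_card_in_span:
  assumes C: "frame C" and x: "x = (\<Sum>c\<in>C. l c *\<^sub>R c)"
  shows "jpow x (card C) \<in> span (jpow x ` {..<card C})"
proof -
  let ?S = "span (jpow x ` {..<card C})"
  have "jpow x (card C) - (\<Sum>c\<in>C. l c) *\<^sub>R jpow x (card C - 1) \<in> ?S"
    using frame_relation[OF C x]
      span_mono[of "jpow x ` {..<card C - 1}" "jpow x ` {..<card C}"]
    by (meson diff_le_self image_mono lessThan_subset_iff subsetD)
  moreover have "(\<Sum>c\<in>C. l c) *\<^sub>R jpow x (card C - 1) \<in> ?S"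
    by (rule span_scale, rule span_base) (use frame_card_pos[OF C] in auto)
  ultimately have "jpow x (card C) - (\<Sum>c\<in>C. l c) *\<^sub>R jpow x (card C - 1)
     + (\<Sum>c\<in>C. l c) *\<^sub>R jpow x (card C - 1) \<in> ?S"
    by (rule span_add)
  then show ?thesis by simp
qed

lemma min_poly_degree_le:
  assumes "frame C" "x \<in> span C"
  shows "mindeg x \<le> card C"
proof -
  obtain l where x: "x = (\<Sum>c\<in>C. l c *\<^sub>R c)"
    using assms frameD(1) by (auto simp: span_finite)
  from frame_power_card_in_span[OF assms(1) x] show ?thesis
    unfolding min_poly_degree_def by (rule Least_le)
qed

text \<open>A dependence among lower powers would be a nonzero polynomial with the
  \<open>card C\<close> distinct values of \<open>l\<close> among its roots.\<close>

lemma min_poly_degree_regular: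
  assumes C: "frame C" and inj: "inj_on l C"
  shows "mindeg (\<Sum>c\<in>C. l c *\<^sub>R c) = card C"
proof -
  define x where "x = (\<Sum>c\<in>C. l c *\<^sub>R c)"
  have "x \<in> span C" unfolding x_def by (rule span_sum, rule span_scale, rule span_base)
  then have le: "mindeg x \<le> card C" using min_poly_degree_le[OF C] by blast
  define k where "k = mindeg x"
  have "jpow x (card C) \<in> span (jpow x ` {..<card C})"
    using frame_power_card_in_span[OF C x_def] .
  then have "jpow x k \<in> span (jpow x ` {..<k})"
    unfolding k_def min_poly_degree_def by (rule LeastI)
  then obtain u where u: "jpow x k = (\<Sum>i<k. u i *\<^sub>R jpow x i)"
    by (rule span_image_lessThan)
  define v where "v i = (if i = k then -1 else u i)" for i
  have "(\<Sum>i\<le>k. v i * l c ^ i) = 0" if c: "c \<in> C" for c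
  proof -
    have ic: "jpow x n \<bullet> c = l c ^ n * (c \<bullet> c)" for n
    proof -
      have "jpow x n \<bullet> c = (\<Sum>d\<in>C. if d = c then l c ^ n * (c \<bullet> c) else 0)"
        unfolding x_def frame_power[OF C] inner_sum_left
        using frame_inner[OF C _ c] by (intro sum.cong) auto
      then show ?thesis using frameD(1)[OF C] c by simp
    qed
    from arg_cong[OF u, of "\<lambda>y. y \<bullet> c"] have "l c ^ k = (\<Sum>i<k. u i * l c ^ i)"
      using frameD(4)[OF C c] by (simp add: inner_sum_left ic flip: sum_distrib_right mult.assoc)
    then show ?thesis by (simp add: v_def lessThan_Suc_atMost[symmetric])
  qed
  then have "l ` C \<subseteq> {t. (\<Sum>i\<le>k. v i * t ^ i) = 0}" by auto
  moreover have "\<exists>i\<le>k. v i \<noteq> 0" by (auto simp: v_def)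
  then have "finite {t. (\<Sum>i\<le>k. v i * t ^ i) = 0}" "card {t. (\<Sum>i\<le>k. v i * t ^ i) = 0} \<le> k"
    using polyfun_rootbound[of k v] by blast+
  ultimately have "card (l ` C) \<le> k" using card_mono le_trans by blast
  then show ?thesis using le card_image[OF inj] by (simp add: k_def x_def)
qed

end

section \<open>Rank and trace of a simple algebra\<close>

context simple_euclidean_jordan_algebra
begin

text \<open>Each of the two is non-orthogonal to some member of one fixed frame, and the members of
  a frame have equal norm.\<close>

lemma primitive_norm: "primitive c \<Longrightarrow> primitive p \<Longrightarrow> c \<bullet> c = p \<bullet> p"
proof -
  assume cp: "primitive c" "primitive p"
  obtain C where C: "frame C" using spectral by blast
  obtain a b where "a \<in> C" "a \<bullet> c \<noteq> 0" "b \<in> C" "b \<bullet> p \<noteq> 0"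
    using frame_overlap[OF C cp(1)] frame_overlap[OF C cp(2)] by metis
  then show "c \<bullet> c = p \<bullet> p"
    using primitive_norm_overlap[of a c] primitive_norm_overlap[of b p] cp frameD(2)[OF C]
      frame_norm[OF C, of a b] by simp
qed

text \<open>The members of a frame are orthogonal with sum \<open>e\<close> and have the common norm
  of all primitive idempotents. Consequently all frames are equally large.\<close>

lemma frame_card:
  assumes "frame C" "primitive p"
  shows "real (card C) * (p \<bullet> p) = e \<bullet> e"
proof -
  have "e \<bullet> e = (\<Sum>c\<in>C. c \<bullet> e)" using frameD(6)[OF assms(1)] by (simp add: inner_sum_left[symmetric])
  also have "\<dots> = (\<Sum>c\<in>C. p \<bullet> p)"
    using frameD[OF assms(1)] primitive_norm[OF _ assms(2)] inner_unit by (intro sum.cong) metis+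
  finally show ?thesis by simp
qed

lemma jordan_rank_eq:
  assumes "frame C"
  shows "jordan_rank (\<odot>) e = card C"
proof -
  obtain c where c: "c \<in> C" using frame_card_pos[OF assms] by fastforce
  have cards: "card D = card C" if "frame D" for D
    using frame_card[OF that, of c] frame_card[OF assms, of c] frameD[OF assms] c
      by (metis inner_eq_zero_iff mult_right_cancel of_nat_eq_iff)
  have le: "mindeg x \<le> card C" for x
    using spectral[of x] min_poly_degree_le cards by metis
  obtain h :: "'a \<Rightarrow> nat" where h: "inj_on h C"
    using finite_imp_inj_to_nat_seg frameD(1)[OF assms] by metis
  have "card C \<in> range (mindeg)"
    using min_poly_degree_regular[OF assms, of "\<lambda>c. real (h c)"] h
    by (metis (mono_tags, lifting) inj_on_def of_nat_eq_iff rangeI)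
  moreover have "finite (range (mindeg))"
    by (rule finite_subset[of _ "{..card C}"]) (use le in auto)
  ultimately show ?thesis unfolding jordan_rank_def using le by (intro Max_eqI) auto
qed

text \<open>Existence comes from \<open>frame_relation\<close>. On regular elements two candidate
  values would put the power of degree r - 1 into the span of the lower ones. Linearity extends the
  uniqueness, as every member of a frame is proportional to a difference of two regular
  elements.\<close>

lemma jordan_trace_eq:
  assumes "primitive p"
  shows "jordan_trace (\<odot>) e x = (x \<bullet> e) / (p \<bullet> p)"
proof -
  define T0 where "T0 x = (x \<bullet> e) / (p \<bullet> p)" for x
  let ?R = "jordan_rank (\<odot>) e"
  have p0: "p \<bullet> p \<noteq> 0" using assms by (auto simp: primitive_idempotent_def)
  have lin0: "linear T0" by (auto simp: T0_def inner_add_left add_divide_distrib intro!: linearI)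
  have T0c: "T0 c = 1" if "frame C" "c \<in> C" for C c
    using primitive_norm[OF frameD(2)[OF that] assms] frameD(3)[OF that] inner_unit[of c c] p0
    by (simp add: T0_def)
  have T0s: "T0 (\<Sum>c\<in>C. l c *\<^sub>R c) = (\<Sum>c\<in>C. l c)" if "frame C" for C l
    using T0c[OF that] lin0 by (simp add: linear_sum linear_cmul)
  have prop0: "jpow x ?R - T0 x *\<^sub>R jpow x (?R - 1)
          \<in> span (jpow x ` {..<?R - 1})" for x
  proof -
    obtain C where C: "frame C" "x \<in> span C" by (rule spectral)
    then obtain l where l: "x = (\<Sum>c\<in>C. l c *\<^sub>R c)" using frameD(1) by (auto simp: span_finite)
    show ?thesis using frame_relation[OF C(1) l] T0s[OF C(1), of l] jordan_rank_eq[OF C(1)] l by simp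
  qed
  have "jordan_trace (\<odot>) e = T0"
    unfolding jordan_trace_def
  proof (rule the_equality)
    show "linear T0 \<and> (\<forall>x. mindeg x = ?R \<longrightarrow>
        jpow x ?R - T0 x *\<^sub>R jpow x (?R - 1)
          \<in> span (jpow x ` {..<?R - 1}))"
      using lin0 prop0 by blast
  next
    fix T assume T: "linear T \<and> (\<forall>x. mindeg x = ?R \<longrightarrow>
        jpow x ?R - T x *\<^sub>R jpow x (?R - 1)
          \<in> span (jpow x ` {..<?R - 1}))"
    have reg: "T x = T0 x" if x: "mindeg x = ?R" for x
    proof (rule ccontr)
      assume ne: "T x \<noteq> T0 x"
      have Rpos: "?R > 0" using spectral jordan_rank_eq frame_card_pos by metis
      have "(jpow x ?R - T0 x *\<^sub>R jpow x (?R - 1))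
          - (jpow x ?R - T x *\<^sub>R jpow x (?R - 1))
          \<in> span (jpow x ` {..<?R - 1})"
        using T x prop0[of x] by (intro span_diff[of "_ - _" _ "_ - _"]) blast+
      then have "(T x - T0 x) *\<^sub>R jpow x (?R - 1) \<in> span (jpow x ` {..<?R - 1})"
        by (simp add: scaleR_diff_left)
      then have "jpow x (?R - 1) \<in> span (jpow x ` {..<?R - 1})"
        using span_scale[of "(T x - T0 x) *\<^sub>R jpow x (?R - 1)" _ "1 / (T x - T0 x)"] ne by simp
      then have "mindeg x \<le> ?R - 1"
        unfolding min_poly_degree_def by (rule Least_le)
      then show False using x Rpos by simp
    qed
    have "T x = T0 x" for x
    proof -
      obtain C where C: "frame C" "x \<in> span C" by (rule spectral)
      note F = frameD[OF C(1)]
      have "T c = T0 c" if c: "c \<in> C" for c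
      proof -
        obtain h :: "'a \<Rightarrow> nat" and n where h: "h ` C = {i. i < n}" "inj_on h C"
          using finite_imp_inj_to_nat_seg F(1) by metis
        \<comment> \<open>The values of \<open>l\<close> are 0, ..., n - 1. Adding \<open>n\<close>
          at \<open>c\<close> keeps the coordinates distinct, so both combinations are regular, and
          they differ by n times \<open>c\<close>.\<close>
        define l where "l d = real (h d)" for d
        define m where "m d = l d + (if d = c then real n else 0)" for d
        have "inj_on l C" using h by (auto simp: inj_on_def l_def)
        moreover have "inj_on m C"
        proof (rule inj_onI)
          fix a b assume ab: "a \<in> C" "b \<in> C" "m a = m b"
          then have "h a < n" "h b < n" using h by auto
          then show "a = b" using ab h(2)
            by (auto simp: m_def l_def inj_on_def split: if_splits simp flip: of_nat_add)
        qed
        ultimately have "T (\<Sum>d\<in>C. l d *\<^sub>R d) = T0 (\<Sum>d\<in>C. l d *\<^sub>R d)"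
          "T (\<Sum>d\<in>C. m d *\<^sub>R d) = T0 (\<Sum>d\<in>C. m d *\<^sub>R d)"
          using reg min_poly_degree_regular[OF C(1)] jordan_rank_eq[OF C(1)] by simp_all
        moreover have "(\<Sum>d\<in>C. m d *\<^sub>R d) = (\<Sum>d\<in>C. l d *\<^sub>R d) + real n *\<^sub>R c"
          using F(1) c by (simp add: m_def scaleR_add_left sum.distrib if_distrib[of "\<lambda>a. a *\<^sub>R _"] cong: if_cong)
        ultimately have "real n * T c = real n * T0 c"
          using T lin0 by (simp add: linear_add linear_cmul)
        moreover have "h c < n" using h(1) c by auto
        then have "n > 0" by simp
        ultimately show ?thesis by simp
      qed
      then show ?thesis using linear_eq_on[of T T0 x C] T lin0 C by blast
    qed
    then show "T = T0" by blast
  qed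
  then show ?thesis by (simp add: T0_def)
qed

end

section \<open>The Casimir identity\<close>

context euclidean_jordan_algebra
begin

lemma subspace_peirce: "subspace (peirce c d)"
  by (auto simp: subspace_def peirce_def prod_expand scaleR_add_right)

lemma peirce_commute: "peirce c d = peirce d c"
  by (auto simp: peirce_def)

text \<open>Since \<open>c\<close> and \<open>d\<close> act as 1/2 on the joint Peirce space, the
  orthogonal projection onto it is 4 c(dv); hence the quarter.\<close>

lemma trace_peirce:
  assumes "frame C" "c \<in> C" "d \<in> C" "c \<noteq> d"
  shows "(\<Sum>b\<in>Basis. (c \<odot> (d \<odot> b)) \<bullet> b) = real (dim (peirce c d)) / 4"
proof -
  have "(\<Sum>b\<in>Basis. (4 *\<^sub>R (c \<odot> (d \<odot> b))) \<bullet> b) = real (dim (peirce c d))"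
  proof (rule trace_orthogonal_projection[OF subspace_peirce])
    show "4 *\<^sub>R (c \<odot> (d \<odot> v)) \<in> peirce c d" for v
      using frame_peirce_proj[OF assms] subspace_peirce by (simp add: subspace_scale)
    show "4 *\<^sub>R (c \<odot> (d \<odot> v)) = v" if "v \<in> peirce c d" for v
      using that by (simp add: peirce_def prod_expand)
    show "(4 *\<^sub>R (c \<odot> (d \<odot> v))) \<bullet> w = v \<bullet> (4 *\<^sub>R (c \<odot> (d \<odot> w)))" for v w
      using frame_commute[OF assms(1-3)] by (simp add: inner_assoc)
  qed
  then show ?thesis by (simp add: sum_distrib_left[symmetric])
qed

lemma trace_primitive:
  assumes "primitive c"
  shows "(\<Sum>b\<in>Basis. \<P> c c b \<bullet> b) = 1"
proof -
  have "(\<Sum>b\<in>Basis. \<P> c c b \<bullet> b) = (\<Sum>b\<in>Basis. (c \<bullet> b) * (c \<bullet> b)) / (c \<bullet> c)"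
    by (simp add: primitive_P[OF assms] sum_divide_distrib inner_commute)
  also have "\<dots> = 1"
    using assms by (simp add: euclidean_inner[symmetric] primitive_idempotent_def)
  finally show ?thesis .
qed

text \<open>Multiplication by \<open>x\<close> commutes with \<open>k\<close> and with
  \<open>i + j\<close>, which gives their action on the product. Its \<open>i\<close>-part lies in
  the 1-space of \<open>i\<close> and is killed by \<open>k\<close>, yet \<open>k\<close> acts on it
  as 1/2, so it is 0.\<close>

lemma frame_peirce_mult:
  assumes C: "frame C" "i \<in> C" "j \<in> C" "k \<in> C" "i \<noteq> j" "i \<noteq> k" "j \<noteq> k"
    and x: "x \<in> peirce i j" and v: "v \<in> peirce i k"
  shows "x \<odot> v \<in> peirce j k"
proof -
  note F = frameD[OF C(1)]
  let ?w = "x \<odot> v"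
  have xi: "i \<odot> x = (1/2) *\<^sub>R x" and vi: "i \<odot> v = (1/2) *\<^sub>R v" using x v by (auto simp: peirce_def)
  have kx: "k \<odot> x = 0" using frame_peirce_kill[OF C(1) C(2,3,4) C(5) _ _ x] C by auto
  have jv: "j \<odot> v = 0" using frame_peirce_kill[OF C(1) C(2,4,3) C(6) _ _ v] C by auto
  have kw: "k \<odot> ?w = (1/2) *\<^sub>R ?w"
    using idempotent_commute[of k x v] F C kx v by (simp add: peirce_def prod_expand)
  have f: "(i + j) \<odot> (i + j) = i + j" "(i + j) \<odot> x = x"
    using F C x prod_commute[of j i] by (simp_all add: prod_expand peirce_def flip: scaleR_add_left)
  have "(i + j) \<odot> ?w = x \<odot> ((i + j) \<odot> v)" using idempotent_commute[OF f(1)] f(2) by blast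
  then have ijw: "i \<odot> ?w + j \<odot> ?w = (1/2) *\<^sub>R ?w"
    using jv vi by (simp add: prod_expand)
  have "i \<odot> (i \<odot> ?w) = i \<odot> ?w" using peirce_half_half[OF F(3)[OF C(2)] xi vi] .
  then have "k \<odot> (i \<odot> ?w) = 0" using frame_peirce_1_kill[OF C(1,2,4)] C by blast
  moreover have "k \<odot> (i \<odot> ?w) = (1/2) *\<^sub>R (i \<odot> ?w)"
    using frame_commute[OF C(1,4,2)] kw by (simp add: prod_expand)
  ultimately have "i \<odot> ?w = 0" by simp
  then show ?thesis using ijw kw by (simp add: peirce_def)
qed

text \<open>\<open>jordan_linearized\<close> at \<open>x\<close>, \<open>x\<close>,
  \<open>v\<close>, \<open>i\<close>, where \<open>i\<close> kills the product
  \<open>x \<odot> v\<close>. For positive al it makes multiplication by \<open>x\<close> injective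
  on the Peirce space, which is how dimensions are compared.\<close>

lemma frame_peirce_mult_mult:
  assumes C: "frame C" "i \<in> C" "j \<in> C" "k \<in> C" "i \<noteq> j" "i \<noteq> k" "j \<noteq> k"
    and x: "x \<in> peirce i j" "x \<odot> x = al *\<^sub>R (i + j)" and v: "v \<in> peirce i k"
  shows "x \<odot> (x \<odot> v) = (al / 4) *\<^sub>R v"
proof -
  note F = frameD[OF C(1)]
  have iw: "i \<odot> (x \<odot> v) = 0"
    using frame_peirce_kill[OF C(1,3,4,2) C(7) _ _ frame_peirce_mult[OF C x(1) v]] C by auto
  have jv: "j \<odot> v = 0" using frame_peirce_kill[OF C(1) C(2,4,3) C(6) _ _ v] C by auto
  have xi: "x \<odot> i = (1/2) *\<^sub>R x" "v \<odot> i = (1/2) *\<^sub>R v" "i \<odot> v = (1/2) *\<^sub>R v"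
    using x v prod_commute by (auto simp: peirce_def)
  have "i \<odot> j = 0" "j \<odot> i = 0" using F C by auto
  then have xxi: "(x \<odot> x) \<odot> i = al *\<^sub>R i" using x(2) F C by (simp add: prod_expand)
  have xxv: "(x \<odot> x) \<odot> v = (al / 2) *\<^sub>R v" using x(2) jv xi by (simp add: prod_expand)
  have "x \<odot> ((x \<odot> v) \<odot> i) + x \<odot> ((x \<odot> v) \<odot> i) + v \<odot> ((x \<odot> x) \<odot> i) =
    (x \<odot> v) \<odot> (x \<odot> i) + (x \<odot> v) \<odot> (x \<odot> i) + (x \<odot> x) \<odot> (v \<odot> i)"
    using jordan_linearized[of x x v i] by simp
  moreover have "(x \<odot> v) \<odot> i = 0" "(x \<odot> v) \<odot> x = x \<odot> (x \<odot> v)" using iw prod_commute by metis+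
  ultimately have "(al / 2) *\<^sub>R v = x \<odot> (x \<odot> v) + (al / 4) *\<^sub>R v"
    by (simp add: xi xxi xxv prod_expand flip: scaleR_add_left)
  then have "x \<odot> (x \<odot> v) = (al / 2) *\<^sub>R v - (al / 4) *\<^sub>R v" by simp
  then show ?thesis by (simp flip: scaleR_diff_left)
qed

lemma dim_peirce_le:
  assumes C: "frame C" "i \<in> C" "j \<in> C" "k \<in> C" "i \<noteq> j" "i \<noteq> k" "j \<noteq> k"
    and ne: "peirce i j \<noteq> {0}"
  shows "dim (peirce i k) \<le> dim (peirce j k)"
proof -
  obtain x where x: "x \<in> peirce i j" "x \<noteq> 0"
    using ne subspace_0[OF subspace_peirce] by blast
  obtain al where al: "al > 0" "x \<odot> x = al *\<^sub>R (i + j)"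
    using peirce_square[OF C(1-3,5) x] by metis
  have lin: "linear ((\<odot>) x)" using prod.bounded_linear_right by (rule bounded_linear.linear)
  have "inj_on ((\<odot>) x) (peirce i k)"
  proof (rule inj_onI)
    fix v w assume "v \<in> peirce i k" "w \<in> peirce i k" "x \<odot> v = x \<odot> w"
    then have "(al / 4) *\<^sub>R v = (al / 4) *\<^sub>R w"
      using frame_peirce_mult_mult[OF C x(1) al(2)] by metis
    then show "v = w" using al by simp
  qed
  then have "dim (((\<odot>) x) ` peirce i k) = dim (peirce i k)"
    using lin subspace_peirce by (intro dim_image_eq) (simp_all add: span_eq_iff[THEN iffD2])
  moreover have "((\<odot>) x) ` peirce i k \<subseteq> peirce j k"
    using frame_peirce_mult[OF C x(1)] by blast
  ultimately show ?thesis using dim_subset by metis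
qed

end

context simple_euclidean_jordan_algebra
begin

text \<open>The members coupled to \<open>i\<close> form a class closed under coupling: a nonzero
  element between k and i carries the space between k and l injectively into the one between i and
  l.\<close>

lemma peirce_nonzero:
  assumes C: "frame C" "i \<in> C" "j \<in> C" "i \<noteq> j"
  shows "peirce i j \<noteq> {0}"
proof -
  define S where "S = {k \<in> C. k = i \<or> peirce i k \<noteq> {0}}"
  have "S = {} \<or> S = C"
  proof (rule frame_connected[OF C(1)])
    fix k l assume kl: "k \<in> S" "l \<in> C - S"
    show "peirce k l = {0}"
    proof (cases "k = i")
      case True then show ?thesis using kl by (auto simp: S_def)
    next
      case False
      then have h: "k \<in> C" "peirce i k \<noteq> {0}" "l \<in> C" "l \<noteq> i" "l \<noteq> k" "peirce i l = {0}"
        using kl by (auto simp: S_def)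
      have "dim (peirce k l) \<le> dim (peirce i l)"
        using dim_peirce_le[OF C(1) h(1) C(2) h(3), of] h False peirce_commute[of k i] by auto
      then have "dim (peirce k l) = 0" using h by simp
      then show ?thesis using subspace_0[OF subspace_peirce] by (auto simp: dim_eq_0)
    qed
  qed (auto simp: S_def)
  then have "j \<in> S" using C by (auto simp: S_def)
  then show ?thesis using C by (auto simp: S_def)
qed

lemma dim_peirce_share:
  assumes C: "frame C" "i \<in> C" "j \<in> C" "k \<in> C" "i \<noteq> k" "j \<noteq> k"
  shows "dim (peirce i k) = dim (peirce j k)"
proof (cases "i = j")
  case False
  then show ?thesis
    using dim_peirce_le[OF C(1,2,3,4) _ C(5,6)] dim_peirce_le[OF C(1,3,2,4) _ C(6,5)]
      peirce_nonzero[OF C(1,2,3)] peirce_nonzero[OF C(1,3,2)] by (auto intro: antisym)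
qed simp

text \<open>One index is exchanged at a time. The case \<open>l = i\<close> is separate because the
  intermediate pair would degenerate.\<close>

lemma dim_peirce_const:
  assumes C: "frame C" "i \<in> C" "j \<in> C" "k \<in> C" "l \<in> C" "i \<noteq> j" "k \<noteq> l"
  shows "dim (peirce i j) = dim (peirce k l)"
proof (cases "l = i")
  case True
  have "dim (peirce i j) = dim (peirce k i)"
    using dim_peirce_share[OF C(1,3,4,2)] C True by (simp add: peirce_commute[of i j])
  then show ?thesis using True by simp
next
  case False
  have "dim (peirce i j) = dim (peirce l i)"
    using dim_peirce_share[OF C(1,3,5,2)] C False by (simp add: peirce_commute[of i j])
  also have "\<dots> = dim (peirce k l)"
    using dim_peirce_share[OF C(1,2,4,5)] C False by (simp add: peirce_commute[of l i])
  finally show ?thesis .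
qed

lemma dim_peirce_pos:
  assumes C: "frame C" "i \<in> C" "j \<in> C" "i \<noteq> j"
  shows "dim (peirce i j) > 0"
  using peirce_nonzero[OF assms] subspace_0[OF subspace_peirce, of i j] by (auto simp: dim_eq_0 intro!: Nat.gr0I)

text \<open>Trace of the identity along the frame decomposition. As the other quantities are the
  same for all frames, it transfers the Peirce dimension from one frame to another.\<close>

lemma dim_eq_peirce:
  assumes C: "frame C" "i \<in> C" "j \<in> C" "i \<noteq> j"
  shows "2 * real DIM('a) = 2 * real (card C) + real (card C) * (real (card C) - 1) * dim (peirce i j)"
proof -
  note F = frameD[OF C(1)]
  have "real DIM('a) = (\<Sum>b\<in>Basis. (b::'a) \<bullet> b)" by simp
  also have "\<dots> = (\<Sum>b\<in>Basis. (\<Sum>c\<in>C. \<P> c c b \<bullet> b) + 2 * (\<Sum>c\<in>C. \<Sum>d\<in>C - {c}. (c \<odot> (d \<odot> b)) \<bullet> b))"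
  proof (intro sum.cong refl)
    fix b :: 'a
    show "b \<bullet> b = (\<Sum>c\<in>C. \<P> c c b \<bullet> b) + 2 * (\<Sum>c\<in>C. \<Sum>d\<in>C - {c}. (c \<odot> (d \<odot> b)) \<bullet> b)"
      using arg_cong[OF frame_decomposition[OF C(1), of b], of "\<lambda>v. v \<bullet> b"]
      by (simp add: inner_add_left inner_sum_left)
  qed
  also have "\<dots> = (\<Sum>c\<in>C. \<Sum>b\<in>Basis. \<P> c c b \<bullet> b) + 2 * (\<Sum>c\<in>C. \<Sum>d\<in>C - {c}. \<Sum>b\<in>Basis. (c \<odot> (d \<odot> b)) \<bullet> b)"
    by (simp add: sum.distrib flip: sum_distrib_left)
      (simp add: sum.swap[of _ _ Basis] sum.swap[of _ C Basis])
  also have "(\<Sum>c\<in>C. \<Sum>b\<in>Basis. \<P> c c b \<bullet> b) = real (card C)"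
    using trace_primitive F(2) by simp
  also have "(\<Sum>c\<in>C. \<Sum>d\<in>C - {c}. \<Sum>b\<in>Basis. (c \<odot> (d \<odot> b)) \<bullet> b) = (\<Sum>c\<in>C. \<Sum>d\<in>C - {c}. dim (peirce i j) / 4)"
    using trace_peirce[OF C(1)] dim_peirce_const[OF C(1-3) _ _ C(4)] by (intro sum.cong refl) auto
  also have "\<dots> = real (card C) * (real (card C) - 1) * dim (peirce i j) / 4"
    using F(1) C frame_card_pos[OF C(1)] by (simp add: of_nat_diff)
  finally show ?thesis by simp
qed

end

section \<open>The Casimir identity for the trace form\<close>

text \<open>The last assumption asks for d = 2 lam in every frame at once. A frame of rank 1 has no
  such pairs, which leaves \<open>lam\<close> free there.\<close>

locale bessel_setting = simple_euclidean_jordan_algebra +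
  fixes lam :: real
  assumes trace_form: "x \<bullet> y = jordan_trace (\<odot>) e (x \<odot> y)"
    and lam_pos: "lam > 0"
    and dim_peirce: "frame C \<Longrightarrow> c \<in> C \<Longrightarrow> d \<in> C \<Longrightarrow> c \<noteq> d \<Longrightarrow> real (dim (peirce c d)) = 2 * lam"
begin

abbreviation "tr \<equiv> jordan_trace (\<odot>) e"
abbreviation "rk \<equiv> real (jordan_rank (\<odot>) e)"
abbreviation "heat \<equiv> heat_kernel (\<odot>) e lam"

lemma trace_inner: "tr x = x \<bullet> e"
  using trace_form[of x e] by (simp add: unit_right)

text \<open>The trace of \<open>e\<close> is (e|e) by the trace form and (e|e)/(c|c) by
  \<open>jordan_trace_eq\<close>.\<close>

lemma primitive_inner: assumes "primitive c" shows "c \<bullet> c = 1"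
proof -
  have "e \<bullet> e = (e \<bullet> e) / (c \<bullet> c)" using jordan_trace_eq[OF assms, of e] trace_inner[of e] by simp
  then show ?thesis using unit_nonzero assms by (auto simp: field_simps primitive_idempotent_def)
qed

lemma rank_pos: "rk \<ge> 1"
  using spectral jordan_rank_eq frame_card_pos by (metis One_nat_def Suc_leI of_nat_1 of_nat_mono)

lemma rank_inner: "rk = e \<bullet> e"
proof -
  obtain C where C: "frame C" using spectral by blast
  obtain c where "c \<in> C" using frame_card_pos[OF C] by fastforce
  then have "primitive c" using frameD(2)[OF C] by blast
  then show ?thesis using frame_card[OF C, of c] jordan_rank_eq[OF C] primitive_inner by simp
qed

lemma primitive_trace: "primitive c \<Longrightarrow> tr c = 1"
  using primitive_inner inner_unit[of c c] by (simp add: trace_inner primitive_idempotent_def)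

lemma primitive_P_1: "primitive c \<Longrightarrow> \<P> c c v = (c \<bullet> v) *\<^sub>R c"
  using primitive_P primitive_inner by simp

text \<open>The left side is the trace of L(x)^2. In a frame through \<open>x\<close>, L(x) has the
  eigenvalue \<open>l c\<close> on the line of \<open>c\<close> and \<open>(l c + l d) / 2\<close>
  on the joint Peirce space, of dimension \<open>2 * lam\<close>.\<close>

lemma trace_square:
  "(\<Sum>b\<in>Basis. (x \<odot> b) \<bullet> (x \<odot> b)) = (1 + (rk - 2) * lam / 2) * (x \<bullet> x) + lam / 2 * (x \<bullet> e)^2"
proof -
  obtain C where C: "frame C" and "x \<in> span C" by (rule spectral)
  then obtain l where x: "x = (\<Sum>c\<in>C. l c *\<^sub>R c)" using frameD(1) by (auto simp: span_finite)
  note F = frameD[OF C]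
  have xu: "x \<odot> u = (\<Sum>d\<in>C. l d *\<^sub>R (d \<odot> u))" for u by (simp add: x prod.sum_left prod_expand)
  have x1: "x \<odot> u = l c *\<^sub>R u" if "c \<in> C" "c \<odot> u = u" for c u
  proof -
    have "x \<odot> u = (\<Sum>d\<in>C. if d = c then l c *\<^sub>R u else 0)"
      unfolding xu using that frame_peirce_1_kill[OF C that(1) _ _ that(2)] by (intro sum.cong) auto
    then show ?thesis using that F(1) by simp
  qed
  have x12: "x \<odot> u = ((l c + l d) / 2) *\<^sub>R u" if "c \<in> C" "d \<in> C" "c \<noteq> d" "u \<in> peirce c d" for c d u
  proof -
    have "x \<odot> u = (\<Sum>b\<in>C. (if b = c then (l c / 2) *\<^sub>R u else 0) + (if b = d then (l d / 2) *\<^sub>R u else 0))"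
      unfolding xu using that frame_peirce_kill[OF C that(1,2) _ that(3) _ _ that(4)]
      by (intro sum.cong) (auto simp: peirce_def)
    then show ?thesis using that F(1) by (simp add: sum.distrib add_divide_distrib scaleR_add_left)
  qed
  have main: "(x \<odot> b) \<bullet> (x \<odot> b) = (\<Sum>c\<in>C. (l c)^2 * (\<P> c c b \<bullet> b))
     + 2 * (\<Sum>c\<in>C. \<Sum>d\<in>C - {c}. ((l c + l d) / 2)^2 * ((c \<odot> (d \<odot> b)) \<bullet> b))" for b
  proof -
    have "x \<odot> (x \<odot> b) = (\<Sum>c\<in>C. x \<odot> (x \<odot> \<P> c c b))
      + 2 *\<^sub>R (\<Sum>c\<in>C. \<Sum>d\<in>C - {c}. x \<odot> (x \<odot> (c \<odot> (d \<odot> b))))"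
      by (subst frame_decomposition[OF C, of b]) (simp only: prod.sum_right prod_expand)
    also have "(\<Sum>c\<in>C. x \<odot> (x \<odot> \<P> c c b)) = (\<Sum>c\<in>C. (l c)^2 *\<^sub>R \<P> c c b)"
      using x1 jordan_P_idempotent F(3) by (intro sum.cong refl) (simp add: prod_expand power2_eq_square)
    also have "(\<Sum>c\<in>C. \<Sum>d\<in>C - {c}. x \<odot> (x \<odot> (c \<odot> (d \<odot> b)))) =
       (\<Sum>c\<in>C. \<Sum>d\<in>C - {c}. ((l c + l d) / 2)^2 *\<^sub>R (c \<odot> (d \<odot> b)))"
    proof (intro sum.cong refl)
      fix c d assume "c \<in> C" "d \<in> C - {c}"
      then have "c \<in> C" "d \<in> C" "c \<noteq> d" by auto
      from x12[OF this frame_peirce_proj[OF C this]]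
      show "x \<odot> (x \<odot> (c \<odot> (d \<odot> b))) = ((l c + l d) / 2)^2 *\<^sub>R (c \<odot> (d \<odot> b))"
        by (simp add: prod_expand power2_eq_square)
    qed
    finally have "x \<odot> (x \<odot> b) = (\<Sum>c\<in>C. (l c)^2 *\<^sub>R \<P> c c b)
      + 2 *\<^sub>R (\<Sum>c\<in>C. \<Sum>d\<in>C - {c}. ((l c + l d) / 2)^2 *\<^sub>R (c \<odot> (d \<odot> b)))" .
    moreover have "(x \<odot> b) \<bullet> (x \<odot> b) = (x \<odot> (x \<odot> b)) \<bullet> b"
      by (simp add: inner_assoc)
    ultimately show ?thesis by (simp add: inner_add_left inner_sum_left)
  qed
  have "(\<Sum>b\<in>Basis. (x \<odot> b) \<bullet> (x \<odot> b)) = (\<Sum>c\<in>C. (l c)^2 * (\<Sum>b\<in>Basis. \<P> c c b \<bullet> b))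
     + 2 * (\<Sum>c\<in>C. \<Sum>d\<in>C - {c}. ((l c + l d) / 2)^2 * (\<Sum>b\<in>Basis. (c \<odot> (d \<odot> b)) \<bullet> b))"
    unfolding main sum.distrib
    by (simp add: sum_distrib_left sum.swap[of _ _ Basis] sum.swap[of _ C Basis])
  also have "(\<Sum>c\<in>C. (l c)^2 * (\<Sum>b\<in>Basis. \<P> c c b \<bullet> b)) = (\<Sum>c\<in>C. (l c)^2)"
    using trace_primitive F(2) by simp
  \<comment> \<open>The dimension \<open>2 * lam\<close>, a quarter from \<open>trace_peirce\<close>
    and a quarter from the square make \<open>lam / 8\<close>.\<close>
  also have "(\<Sum>c\<in>C. \<Sum>d\<in>C - {c}. ((l c + l d) / 2)^2 * (\<Sum>b\<in>Basis. (c \<odot> (d \<odot> b)) \<bullet> b)) =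
     (\<Sum>c\<in>C. \<Sum>d\<in>C - {c}. lam / 8 * (l c + l d)^2)"
  proof (intro sum.cong refl)
    fix c d assume "c \<in> C" "d \<in> C - {c}"
    then have "c \<in> C" "d \<in> C" "c \<noteq> d" by auto
    from trace_peirce[OF C this] dim_peirce[OF C this]
    show "((l c + l d) / 2)^2 * (\<Sum>b\<in>Basis. (c \<odot> (d \<odot> b)) \<bullet> b) = lam / 8 * (l c + l d)^2"
      by (simp add: power_divide)
  qed
  also have "\<dots> = lam / 8 * ((\<Sum>c\<in>C. \<Sum>d\<in>C. (l c + l d)^2) - (\<Sum>c\<in>C. (l c + l c)^2))"
    unfolding sum_subtractf[symmetric] sum_distrib_left
  proof (intro sum.cong refl)
    fix c assume "c \<in> C"
    then show "(\<Sum>d\<in>C - {c}. lam / 8 * (l c + l d)^2) = lam / 8 * ((\<Sum>d\<in>C. (l c + l d)^2) - (l c + l c)^2)"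
      using F(1) by (simp only: sum_distrib_left[symmetric] sum_diff1 if_True)
  qed
  also have "(\<Sum>c\<in>C. \<Sum>d\<in>C. (l c + l d)^2) = 2 * real (card C) * (\<Sum>c\<in>C. (l c)^2) + 2 * (\<Sum>c\<in>C. l c)^2"
  proof -
    have "(\<Sum>c\<in>C. \<Sum>d\<in>C. (l c + l d)^2) = (\<Sum>c\<in>C. \<Sum>d\<in>C. (l c)^2 + (l d)^2 + 2 * (l c * l d))"
      by (intro sum.cong refl) (simp add: power2_eq_square algebra_simps)
    also have "\<dots> = 2 * real (card C) * (\<Sum>c\<in>C. (l c)^2) + 2 * ((\<Sum>c\<in>C. l c) * (\<Sum>c\<in>C. l c))"
      by (simp add: sum.distrib sum_product) (simp add: sum_distrib_left)
    finally show ?thesis by (simp add: power2_eq_square)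
  qed
  also have "(\<Sum>c\<in>C. (l c + l c)^2) = 4 * (\<Sum>c\<in>C. (l c)^2)"
    by (simp add: sum_distrib_left power2_eq_square algebra_simps)
  finally have 1: "(\<Sum>b\<in>Basis. (x \<odot> b) \<bullet> (x \<odot> b)) = (\<Sum>c\<in>C. (l c)^2) +
    2 * (lam / 8 * (2 * real (card C) * (\<Sum>c\<in>C. (l c)^2) + 2 * (\<Sum>c\<in>C. l c)^2 - 4 * (\<Sum>c\<in>C. (l c)^2)))" .
  have xc: "x \<bullet> c = l c" if "c \<in> C" for c
  proof -
    have "x \<bullet> c = (\<Sum>d\<in>C. if d = c then l c else 0)"
      unfolding x inner_sum_left using frame_inner[OF C _ that] primitive_inner F(2) that by (intro sum.cong) auto
    then show ?thesis using F(1) that by simp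
  qed
  have "x \<bullet> x = (\<Sum>c\<in>C. l c * (x \<bullet> c))" by (subst (2) x) (simp add: inner_sum_right)
  then have 2: "x \<bullet> x = (\<Sum>c\<in>C. (l c)^2)" using xc by (simp add: power2_eq_square)
  have "x \<bullet> e = (\<Sum>c\<in>C. x \<bullet> c)" using F(6) by (simp add: inner_sum_right[symmetric])
  then have 3: "x \<bullet> e = (\<Sum>c\<in>C. l c)" using xc by simp
  show ?thesis unfolding 1 2 3 using jordan_rank_eq[OF C] by (simp add: field_simps)
qed

lemma trace_mult_mult:
  "(\<Sum>b\<in>Basis. (w \<odot> b) \<bullet> (x \<odot> b)) = (1 + (rk - 2) * lam / 2) * (w \<bullet> x) + lam / 2 * ((w \<bullet> e) * (x \<bullet> e))"
proof -
  define K where "K = 1 + (rk - 2) * lam / 2"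
  have "4 * (\<Sum>b\<in>Basis. (w \<odot> b) \<bullet> (x \<odot> b)) =
    (\<Sum>b\<in>Basis. ((w + x) \<odot> b) \<bullet> ((w + x) \<odot> b)) - (\<Sum>b\<in>Basis. ((w - x) \<odot> b) \<bullet> ((w - x) \<odot> b))"
    unfolding sum_distrib_left sum_subtractf[symmetric]
    by (intro sum.cong refl) (simp add: prod_expand inner_add_left inner_add_right inner_diff_left inner_diff_right inner_commute)
  also have "\<dots> = 4 * (K * (w \<bullet> x) + lam / 2 * ((w \<bullet> e) * (x \<bullet> e)))"
    unfolding trace_square K_def[symmetric] by (simp add: inner_add_left inner_add_right inner_diff_left inner_diff_right inner_commute[of x w] power2_eq_square algebra_simps)
  finally show ?thesis by (simp add: K_def)
qed

text \<open>Tested against \<open>w\<close>, the left side is the trace of L(w)L(x), so this is the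
  polarized \<open>trace_square\<close>.\<close>

lemma casimir: "(\<Sum>b\<in>Basis. b \<odot> (b \<odot> x)) = (1 + (rk - 2) * lam / 2) *\<^sub>R x + (lam / 2 * (x \<bullet> e)) *\<^sub>R e"
proof (rule vector_eq_ldot[THEN iffD1], rule allI)
  fix w
  have "w \<bullet> (\<Sum>b\<in>Basis. b \<odot> (b \<odot> x)) = (\<Sum>b\<in>Basis. (w \<odot> b) \<bullet> (x \<odot> b))"
    unfolding inner_sum_right by (intro sum.cong refl) (metis inner_assoc' prod_commute)
  also have "\<dots> = w \<bullet> ((1 + (rk - 2) * lam / 2) *\<^sub>R x + (lam / 2 * (x \<bullet> e)) *\<^sub>R e)"
    unfolding trace_mult_mult by (simp add: inner_add_right algebra_simps)
  finally show "w \<bullet> (\<Sum>b\<in>Basis. b \<odot> (b \<odot> x)) = \<dots>" .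
qed

end

section \<open>Exponentials in the structure group\<close>

text \<open>A copy of the bounded endomorphisms that becomes a Banach algebra under composition, so
  that \<open>exp\<close> and its derivative rules apply.\<close>

typedef (overloaded) 'a endo = "UNIV :: ('a::euclidean_space \<Rightarrow>\<^sub>L 'a) set"
  morphisms lin_of endo_of by auto

lemma lin_of_endo_of [simp]: "lin_of (endo_of f) = f"
  by (simp add: endo_of_inverse)

lemma endo_eq_iff: "f = g \<longleftrightarrow> lin_of f = lin_of g"
  by (simp add: lin_of_inject)

instantiation endo :: (euclidean_space) real_normed_algebra_1
begin

definition "0 = endo_of 0"
definition "1 = endo_of id_blinfun"
definition "f + g = endo_of (lin_of f + lin_of g)"
definition "f - g = endo_of (lin_of f - lin_of g)"
definition "- f = endo_of (- lin_of f)"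
definition "f * g = endo_of (lin_of f o\<^sub>L lin_of g)"
definition "r *\<^sub>R f = endo_of (r *\<^sub>R lin_of f)"
definition "norm f = norm (lin_of f)"
definition "sgn (f :: 'a endo) = inverse (norm f) *\<^sub>R f"
definition "dist (f :: 'a endo) g = norm (f - g)"
definition "(uniformity :: ('a endo \<times> 'a endo) filter) = (INF e\<in>{0<..}. principal {(x, y). dist x y < e})"
definition "open (U :: 'a endo set) \<longleftrightarrow> (\<forall>x\<in>U. eventually (\<lambda>(x', y). x' = x \<longrightarrow> y \<in> U) uniformity)"

lemmas lin_of_ops = zero_endo_def one_endo_def plus_endo_def minus_endo_def uminus_endo_def
  times_endo_def scaleR_endo_def

instance
proof
  fix f g h :: "'a endo" and a b :: real
  show "norm (f + g) \<le> norm f + norm g"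
    by (simp add: norm_endo_def lin_of_ops norm_triangle_ineq)
  show "norm (f * g) \<le> norm f * norm g"
    by (simp add: norm_endo_def lin_of_ops norm_blinfun_compose)
  show "norm (1 :: 'a endo) = 1"
    by (simp add: norm_endo_def lin_of_ops norm_blinfun_id)
  have "blinfun_apply 0 b \<noteq> blinfun_apply id_blinfun b" if "b \<in> Basis" for b :: 'a
    using that nonzero_Basis by auto
  then show "(0 :: 'a endo) \<noteq> 1"
    using nonempty_Basis by (metis all_not_in_conv lin_of_endo_of one_endo_def zero_endo_def)
qed (auto simp: lin_of_ops endo_eq_iff norm_endo_def sgn_endo_def dist_endo_def uniformity_endo_def
    open_endo_def algebra_simps blinfun_eqI
    blinfun.add_left blinfun.add_right blinfun.scaleR_left blinfun.scaleR_right intro!: blinfun_eqI)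

end

lemma bounded_linear_lin_of: "bounded_linear lin_of"
  by (rule bounded_linear_intro[of _ 1]) (auto simp: lin_of_ops norm_endo_def)

instance endo :: (euclidean_space) banach
proof
  fix X :: "nat \<Rightarrow> 'a endo" assume "Cauchy X"
  then have "Cauchy (\<lambda>n. lin_of (X n))"
    by (simp add: Cauchy_def dist_norm norm_endo_def lin_of_ops)
  then obtain L where "(\<lambda>n. lin_of (X n)) \<longlonglongrightarrow> L"
    using Cauchy_convergent_iff convergent_def by metis
  then have "X \<longlonglongrightarrow> endo_of L"
    by (simp add: LIMSEQ_def dist_norm norm_endo_def lin_of_ops)
  then show "convergent X" by (auto simp: convergent_def)
qed

definition blinfun_exp :: "('a::euclidean_space \<Rightarrow>\<^sub>L 'a) \<Rightarrow> real \<Rightarrow> ('a \<Rightarrow>\<^sub>L 'a)" where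
  "blinfun_exp X s = lin_of (exp (s *\<^sub>R endo_of X))"

lemma blinfun_exp_0 [simp]: "blinfun_exp X 0 = id_blinfun"
proof -
  have "endo_of (0 :: 'a \<Rightarrow>\<^sub>L 'a) = 0" by (simp add: zero_endo_def)
  then have "exp (0 *\<^sub>R endo_of X) = 1" by simp
  then show ?thesis by (simp only: blinfun_exp_def) (simp add: one_endo_def)
qed

lemma has_vector_derivative_reflect:
  assumes "(f has_vector_derivative f') (at (t - s))"
  shows "((\<lambda>s. f (t - s)) has_vector_derivative - f') (at s)"
proof -
  have "((\<lambda>s. t - s) has_vector_derivative (-1)) (at s)"
    using has_vector_derivative_diff[OF has_vector_derivative_const has_vector_derivative_id] by simp
  from vector_diff_chain_at[OF this assms] show ?thesis by (simp add: o_def)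
qed

lemma blinfun_exp_has_vector_derivative:
  "(blinfun_exp X has_vector_derivative X o\<^sub>L blinfun_exp X s) (at s)"
  "(blinfun_exp X has_vector_derivative blinfun_exp X s o\<^sub>L X) (at s)"
proof -
  have "((\<lambda>s. lin_of (exp (s *\<^sub>R endo_of X))) has_vector_derivative lin_of (endo_of X * exp (s *\<^sub>R endo_of X))) (at s)"
    by (rule bounded_linear.has_vector_derivative[OF bounded_linear_lin_of exp_scaleR_has_vector_derivative_left])
  then show "(blinfun_exp X has_vector_derivative X o\<^sub>L blinfun_exp X s) (at s)"
    by (simp add: blinfun_exp_def[abs_def] lin_of_ops)
  have "((\<lambda>s. lin_of (exp (s *\<^sub>R endo_of X))) has_vector_derivative lin_of (exp (s *\<^sub>R endo_of X) * endo_of X)) (at s)"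
    by (rule bounded_linear.has_vector_derivative[OF bounded_linear_lin_of exp_scaleR_has_vector_derivative_right])
  then show "(blinfun_exp X has_vector_derivative blinfun_exp X s o\<^sub>L X) (at s)"
    by (simp add: blinfun_exp_def[abs_def] lin_of_ops)
qed

lemma blinfun_exp_minus:
  "blinfun_exp X s (blinfun_exp X (- s) v) = v" "blinfun_exp X (- s) (blinfun_exp X s v) = v"
proof -
  have "endo_of (blinfun_exp X s) * endo_of (blinfun_exp X (- s)) = 1" for s
    by (simp add: blinfun_exp_def lin_of_inverse exp_minus_inverse)
  then have *: "blinfun_exp X s o\<^sub>L blinfun_exp X (- s) = id_blinfun" for s
    by (simp add: lin_of_ops endo_eq_iff)
  show "blinfun_exp X s (blinfun_exp X (- s) v) = v"
    using arg_cong[OF *[of s], of "\<lambda>f. blinfun_apply f v"] by simp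
  show "blinfun_exp X (- s) (blinfun_exp X s v) = v"
    using arg_cong[OF *[of "- s"], of "\<lambda>f. blinfun_apply f v"] by simp
qed

lemma blinfun_exp_apply_has_vector_derivative:
  "((\<lambda>s. blinfun_exp X s v) has_vector_derivative X (blinfun_exp X s v)) (at s)"
  using bounded_linear.has_vector_derivative[OF blinfun.bounded_linear_left blinfun_exp_has_vector_derivative(1)]
  by simp

text \<open>Uniqueness for a linear differential equation: exp(-sX) applied to c(s) has derivative
  0.\<close>

lemma blinfun_exp_ode:
  assumes "\<And>s. (c has_vector_derivative blinfun_apply X (c s)) (at s)"
  shows "c s = blinfun_exp X s (c 0)"
proof -
  have "((\<lambda>s. blinfun_exp X (- s) (c s)) has_vector_derivative 0) (at s)" for s
  proof -
    have "((\<lambda>s. blinfun_exp X (- s)) has_vector_derivative - (blinfun_exp X (- s) o\<^sub>L X)) (at s)"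
      using has_vector_derivative_reflect[OF blinfun_exp_has_vector_derivative(2), of X 0 s] by simp
    from bounded_bilinear.has_vector_derivative[OF bounded_bilinear_blinfun_apply this assms]
    show ?thesis by (simp add: blinfun.minus_left)
  qed
  then have "(\<lambda>s. blinfun_exp X (- s) (c s)) s = (\<lambda>s. blinfun_exp X (- s) (c s)) 0"
    by (intro has_derivative_zero_unique[of UNIV _ s 0]) (auto simp: has_vector_derivative_def)
  then have "blinfun_exp X (- s) (c s) = c 0" by simp
  then show ?thesis using blinfun_exp_minus(1)[of X s "c s"] by simp
qed

text \<open>The inner product \<open>h s\<close> interpolates between the two sides, its values at 0
  and \<open>t\<close>, and has derivative 0.\<close>

lemma adjoint_blinfun_exp:
  assumes "\<And>v w. blinfun_apply X v \<bullet> w = v \<bullet> blinfun_apply Y w"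
  shows "blinfun_exp X t v \<bullet> w = v \<bullet> blinfun_exp Y t w"
proof -
  define h where "h s = blinfun_exp X (t - s) v \<bullet> blinfun_exp Y s w" for s
  have "(h has_vector_derivative 0) (at s)" for s
  proof -
    have "((\<lambda>s. blinfun_exp X (t - s) v) has_vector_derivative - blinfun_apply X (blinfun_exp X (t - s) v)) (at s)"
      by (rule has_vector_derivative_reflect[OF blinfun_exp_apply_has_vector_derivative])
    from bounded_bilinear.has_vector_derivative[OF bounded_bilinear_inner this blinfun_exp_apply_has_vector_derivative[of Y w s]]
    show ?thesis unfolding h_def[abs_def] by (simp add: assms)
  qed
  then have "h t = h 0"
    by (intro has_derivative_zero_unique[of UNIV _ t 0]) (auto simp: has_vector_derivative_def)
  then show ?thesis by (simp add: h_def)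
qed

lemma continuous_on_blinfun_exp: "continuous_on S (blinfun_exp X)"
  by (meson blinfun_exp_has_vector_derivative(1) continuous_at_imp_continuous_on has_vector_derivative_continuous)

section \<open>One-parameter groups in the structure group\<close>

context euclidean_jordan_algebra
begin

definition mult_op :: "'a \<Rightarrow> 'a \<Rightarrow>\<^sub>L 'a" where
  "mult_op u = Blinfun ((\<odot>) u)"

lemma mult_op_apply [simp]: "mult_op u v = u \<odot> v"
  unfolding mult_op_def by (simp add: bounded_linear_Blinfun_apply prod.bounded_linear_right)

text \<open>The defining relation of the structure group, polarized and differentiated at the
  identity; \<open>Y\<close> is the adjoint of \<open>X\<close>, carried explicitly.\<close>

definition structure_lie :: "('a \<Rightarrow>\<^sub>L 'a) \<Rightarrow> ('a \<Rightarrow>\<^sub>L 'a) \<Rightarrow> bool" where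
  "structure_lie X Y \<longleftrightarrow> (\<forall>v w. X v \<bullet> w = v \<bullet> Y w) \<and>
    (\<forall>z w v. \<P> (X z) w v + \<P> z (X w) v = X (\<P> z w v) + \<P> z w (Y v))"

lemma structure_lie_mult: "structure_lie (mult_op u) (mult_op u)"
  by (simp add: structure_lie_def inner_assoc jordan_P_lie)

definition mult_bracket :: "'a \<Rightarrow> 'a \<Rightarrow> 'a \<Rightarrow>\<^sub>L 'a" where
  "mult_bracket u v = (mult_op u o\<^sub>L mult_op v) - (mult_op v o\<^sub>L mult_op u)"

lemma mult_bracket_apply: "mult_bracket u v x = u \<odot> (v \<odot> x) - v \<odot> (u \<odot> x)"
  by (simp add: mult_bracket_def blinfun.diff_left)

lemma jordan_P_expand:
  "\<P> (z + z') w v = \<P> z w v + \<P> z' w v"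
  "\<P> z (w + w') v = \<P> z w v + \<P> z w' v"
  "\<P> z w (v + v') = \<P> z w v + \<P> z w v'"
  "\<P> (z - z') w v = \<P> z w v - \<P> z' w v"
  "\<P> z (w - w') v = \<P> z w v - \<P> z w' v"
  "\<P> z w (v - v') = \<P> z w v - \<P> z w v'"
  by (simp_all add: jordan_P_def prod_expand algebra_simps)

text \<open>Commutators inherit the Lie condition from the multiplications. As L(u) and L(v) are
  self-adjoint, the adjoint of their commutator is its negative.\<close>

lemma structure_lie_bracket: "structure_lie (mult_bracket u v) (- mult_bracket u v)"
proof -
  have 1: "mult_bracket u v a \<bullet> b = a \<bullet> (- mult_bracket u v b)" for a b
    by (simp add: mult_bracket_apply inner_diff_left inner_diff_right inner_assoc)
  have 2: "\<P> (mult_bracket u v z) w y + \<P> z (mult_bracket u v w) y =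
    mult_bracket u v (\<P> z w y) - \<P> z w (mult_bracket u v y)" for z w y
  proof -
    have P: "\<P> (a \<odot> z) w y = a \<odot> \<P> z w y + \<P> z w (a \<odot> y) - \<P> z (a \<odot> w) y" for a z w y
      using jordan_P_lie[of a z w y] by (simp add: algebra_simps)
    show ?thesis
      by (simp add: mult_bracket_apply jordan_P_expand P prod_expand)
  qed
  have 3: "\<P> z w (- y) = - \<P> z w y" for z w y
    by (simp add: jordan_P_def prod_expand)
  show ?thesis unfolding structure_lie_def using 1 2 by (simp add: blinfun.minus_left 3)
qed

lemma structure_groupD:
  assumes "g \<in> Str"
  shows "bij (blinfun_apply g)"
    "\<P> (g x) (g x) v = g (\<P> x x (adjoint (blinfun_apply g) v))"
  using assms by (auto simp: structure_group_def fun_eq_iff)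

text \<open>With the vector pulled back by exp(-sY), the left side of the group relation becomes a
  curve with c' = Xc, by the Lie condition; \<open>blinfun_exp_ode\<close> then identifies it with
  the right side.\<close>

lemma structure_group_exp:
  assumes "structure_lie X Y"
  shows "blinfun_exp X s \<in> Str"
proof -
  have sym: "X v \<bullet> w = v \<bullet> Y w" and
    lie: "\<P> (X z) w v + \<P> z (X w) v = X (\<P> z w v) + \<P> z w (Y v)" for v w z
    using assms by (auto simp: structure_lie_def)
  have adj: "adjoint (blinfun_apply (blinfun_exp X s)) = blinfun_apply (blinfun_exp Y s)" for s
    using adjoint_blinfun_exp[of X Y, OF sym] by (intro adjoint_unique) (simp add: inner_commute)
  have "bij (blinfun_apply (blinfun_exp X s))"
    by (rule bij_betw_byWitness[where f' = "blinfun_apply (blinfun_exp X (- s))"])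
      (auto simp: blinfun_exp_minus)
  moreover have "\<P> (blinfun_exp X s z) (blinfun_exp X s z) v =
     blinfun_exp X s (\<P> z z (blinfun_exp Y s v))" for z v
  proof -
    let ?w = "blinfun_exp Y s v"
    define c where "c s = \<P> (blinfun_exp X s z) (blinfun_exp X s z) (blinfun_exp Y (- s) ?w)" for s
    have "(c has_vector_derivative X (c s)) (at s)" for s
    proof -
      define x where "x s = blinfun_exp X s z" for s
      define y where "y s = blinfun_exp Y (- s) ?w" for s
      have dx: "(x has_vector_derivative X (x s)) (at s)"
        unfolding x_def[abs_def] by (rule blinfun_exp_apply_has_vector_derivative)
      have dy: "(y has_vector_derivative - blinfun_apply Y (y s)) (at s)"
        unfolding y_def[abs_def]
        using has_vector_derivative_reflect[OF blinfun_exp_apply_has_vector_derivative[of Y ?w "0 - s"]] by simp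
      note bil = bounded_bilinear.has_vector_derivative[OF prod.bounded_bilinear_axioms]
      have "((\<lambda>s. x s \<odot> (x s \<odot> y s) + x s \<odot> (x s \<odot> y s) - (x s \<odot> x s) \<odot> y s) has_vector_derivative
        (x s \<odot> (x s \<odot> (- Y (y s)) + X (x s) \<odot> y s) + X (x s) \<odot> (x s \<odot> y s)) +
        (x s \<odot> (x s \<odot> (- Y (y s)) + X (x s) \<odot> y s) + X (x s) \<odot> (x s \<odot> y s))
         - ((x s \<odot> x s) \<odot> (- Y (y s)) + (x s \<odot> X (x s) + X (x s) \<odot> x s) \<odot> y s)) (at s)"
        by (intro has_vector_derivative_add has_vector_derivative_diff bil dx dy)
      also have "(\<lambda>s. x s \<odot> (x s \<odot> y s) + x s \<odot> (x s \<odot> y s) - (x s \<odot> x s) \<odot> y s) = c"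
        by (simp add: c_def jordan_P_def x_def y_def fun_eq_iff)
      also have "(x s \<odot> (x s \<odot> (- Y (y s)) + X (x s) \<odot> y s) + X (x s) \<odot> (x s \<odot> y s)) +
        (x s \<odot> (x s \<odot> (- Y (y s)) + X (x s) \<odot> y s) + X (x s) \<odot> (x s \<odot> y s))
         - ((x s \<odot> x s) \<odot> (- Y (y s)) + (x s \<odot> X (x s) + X (x s) \<odot> x s) \<odot> y s)
         = \<P> (X (x s)) (x s) (y s) + \<P> (x s) (X (x s)) (y s) - \<P> (x s) (x s) (Y (y s))"
        by (simp add: jordan_P_def prod_expand algebra_simps)
      also have "\<dots> = X (c s)" by (simp add: lie) (simp add: c_def x_def y_def)
      finally show ?thesis .
    qed
    from blinfun_exp_ode[OF this, of s] show ?thesis by (simp add: c_def blinfun_exp_minus)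
  qed
  ultimately show ?thesis by (simp add: structure_group_def adj fun_eq_iff)
qed

lemma id_structure_group: "id_blinfun \<in> Str"
  using structure_group_exp[OF structure_lie_mult[of 0], of 0] by simp

lemma structure_group_compose:
  assumes "g \<in> Str" "h \<in> Str"
  shows "g o\<^sub>L h \<in> Str"
proof -
  have lin: "linear (blinfun_apply f)" for f :: "'a \<Rightarrow>\<^sub>L 'a"
    by (simp add: blinfun.bounded_linear_right bounded_linear.linear)
  have adj: "adjoint (blinfun_apply (g o\<^sub>L h)) = adjoint (blinfun_apply h) \<circ> adjoint (blinfun_apply g)"
    by (intro adjoint_unique) (simp add: adjoint_works[OF lin] adjoint_clauses[OF lin])
  have "bij (blinfun_apply (g o\<^sub>L h))"
  proof -
    have "blinfun_apply (g o\<^sub>L h) = blinfun_apply g \<circ> blinfun_apply h" by (simp add: fun_eq_iff)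
    then show ?thesis
      using bij_comp[OF structure_groupD(1)[OF assms(2)] structure_groupD(1)[OF assms(1)]] by simp
  qed
  then show ?thesis
    using structure_groupD(2)[OF assms(1)] structure_groupD(2)[OF assms(2)]
    by (auto simp: structure_group_def adj fun_eq_iff)
qed

text \<open>Any connected parameter set will do: it is the line for exponentials and the open half
  line for dilations.\<close>

lemma structure_group_0_path:
  assumes "connected T" "f ` T \<subseteq> Str" "continuous_on T f" "a \<in> T" "b \<in> T"
    "f a \<in> Str\<^sub>0"
  shows "f b \<in> Str\<^sub>0"
proof -
  have "connected_component (Str) (f a) (f b)"
    using assms by (auto simp: connected_component_def intro!: exI[of _ "f ` T"] connected_continuous_image)
  then show ?thesis
    using assms(6) connected_component_trans by (auto simp: structure_group_0_def)
qed

lemma structure_group_0_subset: "Str\<^sub>0 \<subseteq> Str"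
  unfolding structure_group_0_def by (rule connected_component_subset)

lemma id_structure_group_0: "id_blinfun \<in> Str\<^sub>0"
  using id_structure_group by (simp add: structure_group_0_def)

lemma structure_group_0_exp:
  assumes "structure_lie X Y" "g \<in> Str\<^sub>0"
  shows "blinfun_exp X s o\<^sub>L g \<in> Str\<^sub>0"
proof (rule structure_group_0_path[of UNIV "\<lambda>s. blinfun_exp X s o\<^sub>L g" 0 s])
  show "(\<lambda>s. blinfun_exp X s o\<^sub>L g) ` UNIV \<subseteq> Str"
    using structure_group_exp[OF assms(1)] structure_group_compose structure_group_0_subset assms(2) by blast
  show "continuous_on UNIV (\<lambda>s. blinfun_exp X s o\<^sub>L g)"
    by (intro continuous_intros continuous_on_blinfun_exp bounded_bilinear.continuous_on[OF bounded_bilinear_blinfun_compose])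
  have "id_blinfun o\<^sub>L g = g" by (rule blinfun_eqI) simp
  then show "blinfun_exp X 0 o\<^sub>L g \<in> Str\<^sub>0" using assms by simp
qed auto

lemma structure_group_0_scale:
  assumes "t > 0" "g \<in> Str\<^sub>0"
  shows "t *\<^sub>R g \<in> Str\<^sub>0"
proof (rule structure_group_0_path[of "{0<..}" "\<lambda>t. t *\<^sub>R g" 1 t])
  have g: "g \<in> Str" using assms structure_group_0_subset by blast
  have lin: "linear (blinfun_apply f)" for f :: "'a \<Rightarrow>\<^sub>L 'a"
    by (simp add: blinfun.bounded_linear_right bounded_linear.linear)
  have "s *\<^sub>R g \<in> Str" if "s > 0" for s
  proof -
    have adj: "adjoint (blinfun_apply (s *\<^sub>R g)) = (\<lambda>v. s *\<^sub>R adjoint (blinfun_apply g) v)"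
      by (intro adjoint_unique) (simp add: blinfun.scaleR_left adjoint_works[OF lin])
    have "bij (\<lambda>v. s *\<^sub>R (v :: 'a))"
      by (rule bij_betw_byWitness[where f' = "\<lambda>v. v /\<^sub>R s"]) (use that in auto)
    then have "bij (blinfun_apply (s *\<^sub>R g))"
    proof -
      have "blinfun_apply (s *\<^sub>R g) = (\<lambda>v. s *\<^sub>R v) \<circ> blinfun_apply g"
        by (simp add: fun_eq_iff blinfun.scaleR_left)
      then show ?thesis
        using bij_comp[OF structure_groupD(1)[OF g] \<open>bij (\<lambda>v. s *\<^sub>R (v :: 'a))\<close>] by simp
    qed
    moreover have "\<P> (s *\<^sub>R x) (s *\<^sub>R x) v = (s * s) *\<^sub>R \<P> x x v"
      "\<P> x x (s *\<^sub>R v) = s *\<^sub>R \<P> x x v" for x v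
      by (simp_all add: jordan_P_def prod_expand scaleR_add_right scaleR_diff_right)
    ultimately show ?thesis
      using structure_groupD(2)[OF g]
      by (simp add: structure_group_def adj fun_eq_iff blinfun.scaleR_left blinfun.scaleR_right)
  qed
  then show "(\<lambda>t. t *\<^sub>R g) ` {0<..} \<subseteq> Str" by auto
qed (use assms in \<open>auto intro!: continuous_intros\<close>)

lemma min_orbit_exp:
  assumes "structure_lie X Y" "x \<in> orbit c"
  shows "blinfun_exp X s x \<in> orbit c"
proof -
  obtain g where g: "g \<in> Str\<^sub>0" "x = g c" using assms by (auto simp: min_orbit_def)
  from structure_group_0_exp[OF assms(1) g(1), of s] g(2) show ?thesis
    unfolding min_orbit_def by (intro image_eqI[of _ _ "blinfun_exp X s o\<^sub>L g"]) simp_all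
qed

lemma min_orbit_scale:
  assumes "t > 0" "x \<in> orbit c"
  shows "t *\<^sub>R x \<in> orbit c"
proof -
  obtain g where g: "g \<in> Str\<^sub>0" "x = g c" using assms by (auto simp: min_orbit_def)
  from structure_group_0_scale[OF assms(1) g(1)] g(2) show ?thesis
    unfolding min_orbit_def by (intro image_eqI[of _ _ "t *\<^sub>R g"]) (simp_all add: blinfun.scaleR_left)
qed

lemma structure_group_K_exp:
  "blinfun_exp (mult_bracket u v) s \<in> structure_group_K (\<odot>) e"
proof -
  have "blinfun_exp (mult_bracket u v) s o\<^sub>L id_blinfun \<in> Str\<^sub>0"
    by (rule structure_group_0_exp[OF structure_lie_bracket id_structure_group_0])
  moreover have "f o\<^sub>L id_blinfun = f" for f :: "'a \<Rightarrow>\<^sub>L 'a" by (rule blinfun_eqI) simp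
  moreover have "((\<lambda>s. e) has_vector_derivative mult_bracket u v e) (at s)" for s
    by (simp add: mult_bracket_apply unit_right prod_commute[of u v])
  from blinfun_exp_ode[of "\<lambda>s. e", OF this] have "blinfun_exp (mult_bracket u v) s e = e" by simp
  ultimately show ?thesis by (simp add: structure_group_K_def)
qed

text \<open>At \<open>e\<close> the structure relation says that the identity P(e) equals k composed
  with its adjoint.\<close>

lemma structure_group_K_isometry:
  assumes "k \<in> structure_group_K (\<odot>) e"
  shows "k v \<bullet> k w = v \<bullet> w" "k v \<bullet> e = v \<bullet> e"
proof -
  have k: "k \<in> Str" "k e = e"
    using assms structure_group_0_subset by (auto simp: structure_group_K_def)
  have lin: "linear (blinfun_apply k)"
    by (simp add: blinfun.bounded_linear_right bounded_linear.linear)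
  have Pe: "\<P> e e v = v" for v
    by (simp add: jordan_P_def unit_left)
  have right: "k (adjoint (blinfun_apply k) v) = v" for v
    using structure_groupD(2)[OF k(1), of e v] by (simp add: k Pe)
  have "adjoint (blinfun_apply k) (k v) = v" for v
    using right[of "k v"] structure_groupD(1)[OF k(1)] by (simp add: bij_def inj_eq)
  then show 1: "k v \<bullet> k w = v \<bullet> w" for v w
    using adjoint_works[OF lin] by (metis inner_commute)
  show "k v \<bullet> e = v \<bullet> e" using 1[of v e] k by simp
qed

end

section \<open>Series identities for the Bessel function\<close>

definition bessel_coeff :: "real \<Rightarrow> nat \<Rightarrow> real" where
  "bessel_coeff lam m = 1 / (fact m * pochhammer lam m)"

lemma bessel_coeff_Suc:
  assumes "lam > 0"
  shows "(real m + 1) * (lam + real m) * bessel_coeff lam (Suc m) = bessel_coeff lam m"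
proof -
  have "fact (Suc m) = (real m + 1) * fact m" by (simp add: add.commute)
  moreover have "lam + real m \<noteq> 0" "real m + 1 \<noteq> 0" using assms by linarith+
  ultimately show ?thesis by (simp add: bessel_coeff_def pochhammer_rec' del: fact_Suc)
qed

lemma bessel_coeff_nonneg: "lam > 0 \<Longrightarrow> bessel_coeff lam m \<ge> 0"
  using pochhammer_pos[of lam m] by (simp add: bessel_coeff_def)

lemma summable_power_pochhammer:
  fixes lam t :: real
  assumes "lam > 0"
  shows "summable (\<lambda>m. \<bar>t\<bar> ^ m / pochhammer lam m)"
proof -
  obtain N :: nat where N: "2 * \<bar>t\<bar> < real N" using reals_Archimedean2 by blast
  show ?thesis
  proof (rule summable_ratio_test[of "1/2" N])
    fix m assume "m \<ge> N"
    then have "2 * \<bar>t\<bar> \<le> lam + real m" using N assms by simp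
    then have "\<bar>t\<bar> / (lam + real m) \<le> 1/2" using assms by (simp add: field_simps)
    then have "\<bar>t\<bar> / (lam + real m) * (\<bar>t\<bar> ^ m / pochhammer lam m) \<le> 1/2 * (\<bar>t\<bar> ^ m / pochhammer lam m)"
      using pochhammer_pos[OF assms, of m] by (intro mult_right_mono) auto
    then show "norm (\<bar>t\<bar> ^ Suc m / pochhammer lam (Suc m)) \<le> 1/2 * norm (\<bar>t\<bar> ^ m / pochhammer lam m)"
      using pochhammer_pos[OF assms, of m] assms by (simp add: pochhammer_rec' mult.commute)
  qed simp
qed

text \<open>The coefficients decay like 1/(m!)^2 up to powers of m, hence beat eps^m/m! for every
  eps. This is needed since radial integration of degree N costs about N!/\<tau>^N with \<tau>
  arbitrarily small.\<close>

lemma bessel_coeff_bound: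
  assumes "lam > 0" "eps > 0"
  obtains K where "K \<ge> 0" "\<And>m. bessel_coeff lam m \<le> K * (eps ^ m / fact m)"
proof -
  have "(\<lambda>m. \<bar>1 / eps\<bar> ^ m / pochhammer lam m) \<longlonglongrightarrow> 0"
    using summable_power_pochhammer[OF assms(1)] by (rule summable_LIMSEQ_zero)
  then have "Bseq (\<lambda>m. \<bar>1 / eps\<bar> ^ m / pochhammer lam m)"
    by (intro convergent_imp_Bseq) (auto simp: convergent_def)
  then obtain K where K: "K > 0" "\<And>m. norm (\<bar>1 / eps\<bar> ^ m / pochhammer lam m) \<le> K"
    by (auto simp: Bseq_def)
  show thesis
  proof (rule that)
    fix m
    have "bessel_coeff lam m = (\<bar>1 / eps\<bar> ^ m / pochhammer lam m) * (eps ^ m / fact m)"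
      using assms by (simp add: bessel_coeff_def field_simps)
    also have "\<dots> \<le> K * (eps ^ m / fact m)"
      using K(2)[of m] assms pochhammer_pos[OF assms(1), of m] by (intro mult_right_mono) auto
    finally show "bessel_coeff lam m \<le> K * (eps ^ m / fact m)" .
  qed (use K in simp)
qed

lemma summable_bessel:
  assumes "lam > 0"
  shows "summable (\<lambda>m. norm (bessel_coeff lam m * t ^ m))"
proof (rule summable_comparison_test'[OF summable_power_pochhammer[OF assms, of t], of 0])
  fix m :: nat
  have "bessel_coeff lam m \<le> 1 / pochhammer lam m"
    using pochhammer_pos[OF assms, of m] fact_ge_1[of m, where 'a = real]
    by (simp add: bessel_coeff_def field_simps)
  then have "bessel_coeff lam m * \<bar>t\<bar> ^ m \<le> 1 / pochhammer lam m * \<bar>t\<bar> ^ m"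
    by (rule mult_right_mono) simp
  then show "norm (norm (bessel_coeff lam m * t ^ m)) \<le> \<bar>t\<bar> ^ m / pochhammer lam m"
    using bessel_coeff_nonneg[OF assms, of m] by (simp add: abs_mult power_abs)
qed

lemma bessel_B_eq:
  assumes "lam > 0"
  shows "bessel_B lam t = (\<Sum>m. bessel_coeff lam m * t ^ m)"
proof -
  have "lam \<notin> \<int>\<^sub>\<le>\<^sub>0" using assms by (auto elim!: nonpos_Ints_cases)
  then have "Gamma lam / (fact m * Gamma (lam + real m)) = bessel_coeff lam m" for m
    using Gamma_real_pos[OF assms] by (simp add: bessel_coeff_def pochhammer_Gamma)
  then show ?thesis using bessel_B_series(2)[OF assms] by simp
qed

definition bessel_B1 :: "real \<Rightarrow> real \<Rightarrow> real" where
  "bessel_B1 lam t = (\<Sum>m. diffs (bessel_coeff lam) m * t ^ m)"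

definition bessel_B2 :: "real \<Rightarrow> real \<Rightarrow> real" where
  "bessel_B2 lam t = (\<Sum>m. diffs (diffs (bessel_coeff lam)) m * t ^ m)"

lemma summable_bessel_diffs:
  assumes "lam > 0"
  shows "summable (\<lambda>m. bessel_coeff lam m * t ^ m)" "summable (\<lambda>m. diffs (bessel_coeff lam) m * t ^ m)"
    "summable (\<lambda>m. diffs (diffs (bessel_coeff lam)) m * t ^ m)"
proof -
  show 1: "summable (\<lambda>m. bessel_coeff lam m * t ^ m)" for t
    using summable_bessel[OF assms] by (rule summable_norm_cancel)
  show 2: "summable (\<lambda>m. diffs (bessel_coeff lam) m * t ^ m)" for t
    by (rule termdiff_converges_all) (rule 1)
  show "summable (\<lambda>m. diffs (diffs (bessel_coeff lam)) m * t ^ m)"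
    by (rule termdiff_converges_all) (rule 2)
qed

lemma bessel_B_derivative:
  assumes "lam > 0"
  shows "(bessel_B lam has_real_derivative bessel_B1 lam t) (at t)"
proof -
  have "bessel_B lam = (\<lambda>x. \<Sum>m. bessel_coeff lam m * x ^ m)"
    by (rule ext) (rule bessel_B_eq[OF assms])
  then show ?thesis
    using termdiffs_strong_converges_everywhere[OF summable_bessel_diffs(1)[OF assms], of t]
    by (simp add: bessel_B1_def)
qed

lemma bessel_B1_derivative:
  "lam > 0 \<Longrightarrow> (bessel_B1 lam has_real_derivative bessel_B2 lam t) (at t)"
  using termdiffs_strong_converges_everywhere[OF summable_bessel_diffs(2), of lam t]
  unfolding bessel_B1_def[abs_def] bessel_B2_def .

lemma bessel_B2_derivative:
  "lam > 0 \<Longrightarrow> (bessel_B2 lam has_real_derivative (\<Sum>m. diffs (diffs (diffs (bessel_coeff lam))) m * t ^ m)) (at t)"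
  using termdiffs_strong_converges_everywhere[OF summable_bessel_diffs(3), of lam t]
  unfolding bessel_B2_def[abs_def] .

text \<open>At t^m this is the coefficient recurrence \<open>bessel_coeff_Suc\<close>.\<close>

lemma bessel_ode:
  assumes "lam > 0"
  shows "t * bessel_B2 lam t + lam * bessel_B1 lam t = bessel_B lam t"
proof -
  define c where "c = bessel_coeff lam"
  have "(\<lambda>m. diffs (diffs c) m * t ^ m) sums bessel_B2 lam t"
    unfolding c_def bessel_B2_def using summable_bessel_diffs(3)[OF assms] by (rule summable_sums)
  then have "(\<lambda>m. t * (diffs (diffs c) m * t ^ m)) sums (t * bessel_B2 lam t)" by (rule sums_mult)
  moreover have "t * (diffs (diffs c) m * t ^ m) = real (Suc m) * diffs c (Suc m) * t ^ Suc m" for m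
    by (simp add: diffs_def)
  ultimately have "(\<lambda>m. real (Suc m) * diffs c (Suc m) * t ^ Suc m) sums (t * bessel_B2 lam t)" by simp
  then have 1: "(\<lambda>m. real m * diffs c m * t ^ m) sums (t * bessel_B2 lam t)"
    using sums_Suc_iff[of "\<lambda>m. real m * diffs c m * t ^ m"] by simp
  have "(\<lambda>m. diffs c m * t ^ m) sums bessel_B1 lam t"
    unfolding c_def bessel_B1_def using summable_bessel_diffs(2)[OF assms] by (rule summable_sums)
  then have "(\<lambda>m. lam * (diffs c m * t ^ m)) sums (lam * bessel_B1 lam t)" by (rule sums_mult)
  from sums_add[OF 1 this]
  have "(\<lambda>m. real m * diffs c m * t ^ m + lam * (diffs c m * t ^ m)) sums (t * bessel_B2 lam t + lam * bessel_B1 lam t)" .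
  moreover have "real m * diffs c m * t ^ m + lam * (diffs c m * t ^ m) = c m * t ^ m" for m
  proof -
    have "real m * diffs c m * t ^ m + lam * (diffs c m * t ^ m) =
      ((real m + 1) * (lam + real m) * c (Suc m)) * t ^ m"
      by (simp add: diffs_def algebra_simps)
    then show ?thesis using bessel_coeff_Suc[OF assms] by (simp add: c_def)
  qed
  ultimately show ?thesis
    by (simp add: bessel_B_eq[OF assms] c_def sums_iff)
qed

lemma continuous_on_bessel:
  assumes "lam > 0"
  shows "continuous_on S (bessel_B lam)" "continuous_on S (bessel_B1 lam)" "continuous_on S (bessel_B2 lam)"
  using bessel_B_derivative[OF assms] bessel_B1_derivative[OF assms] bessel_B2_derivative[OF assms]
  by (meson DERIV_isCont continuous_at_imp_continuous_on)+

lemma bessel_B_0: "lam > 0 \<Longrightarrow> bessel_B lam 0 = 1"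
  using powser_zero[of "bessel_coeff lam"] by (simp add: bessel_B_eq) (simp add: bessel_coeff_def)

section \<open>Recurrences for the Taylor coefficients of the product kernel\<close>

text \<open>The coefficient of u^m in u^j exp(a u).\<close>

definition shifted_exp :: "real \<Rightarrow> nat \<Rightarrow> nat \<Rightarrow> real" where
  "shifted_exp a m j = (if j \<le> m then a ^ (m - j) / fact (m - j) else 0)"

lemma fact_Suc_cancel: "real (Suc k) * (x / fact (Suc k)) = x / fact k"
  unfolding fact_Suc by (simp del: of_nat_Suc)

lemma shifted_exp_Suc: "(real (Suc m) - real j) * shifted_exp a (Suc m) j = a * shifted_exp a m j"
proof (cases "j \<le> m")
  case True
  then obtain k where "m = j + k" using le_Suc_ex by blast
  moreover have "real (Suc m) - real j = real (Suc k)" using \<open>m = j + k\<close> by simp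
  moreover have "m - j = k" "Suc m - j = Suc k" using \<open>m = j + k\<close> by simp_all
  ultimately show ?thesis
    using fact_Suc_cancel[of k "a ^ Suc k"] True by (simp add: shifted_exp_def del: fact_Suc of_nat_Suc)
qed (auto simp: shifted_exp_def)

lemma shifted_exp_Suc_Suc: "shifted_exp a (Suc m) (Suc j) = shifted_exp a m j"
  by (simp add: shifted_exp_def)

text \<open>The Taylor coefficients of \<open>exp (a u + b w) B(g u w)\<close> and \<open>exp (a u + b w) B'(g u w)\<close>
  at \<open>u\<^sup>m w\<^sup>n\<close>.\<close>

definition kernel_coeff :: "real \<Rightarrow> real \<Rightarrow> real \<Rightarrow> real \<Rightarrow> nat \<Rightarrow> nat \<Rightarrow> real" where
  "kernel_coeff lam a b g m n = (\<Sum>j\<le>n. shifted_exp a m j * shifted_exp b n j * (bessel_coeff lam j * g ^ j))"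

definition kernel_coeff1 :: "real \<Rightarrow> real \<Rightarrow> real \<Rightarrow> real \<Rightarrow> nat \<Rightarrow> nat \<Rightarrow> real" where
  "kernel_coeff1 lam a b g m n = (\<Sum>j\<le>n. shifted_exp a m j * shifted_exp b n j * (diffs (bessel_coeff lam) j * g ^ j))"

text \<open>Terms with \<open>j\<close> above \<open>n\<close> vanish, so the one-sided range of
  summation hides no asymmetry between \<open>m\<close> and \<open>n\<close>.\<close>

lemma kernel_sum_extend:
  assumes "n \<le> N" shows "(\<Sum>j\<le>n. shifted_exp a m j * shifted_exp b n j * f j) = (\<Sum>j\<le>N. shifted_exp a m j * shifted_exp b n j * f j)"
  using assms by (intro sum.mono_neutral_left) (auto simp: shifted_exp_def)

lemma kernel_sum_swap:
  "(\<Sum>j\<le>n. shifted_exp a m j * shifted_exp b n j * f j) = (\<Sum>j\<le>m. shifted_exp b n j * shifted_exp a m j * f j)"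
proof -
  have "(\<Sum>j\<le>n. shifted_exp a m j * shifted_exp b n j * f j) = (\<Sum>j\<le>max m n. shifted_exp a m j * shifted_exp b n j * f j)"
    by (rule kernel_sum_extend) simp
  also have "\<dots> = (\<Sum>j\<le>max m n. shifted_exp b n j * shifted_exp a m j * f j)"
    by (simp add: mult_ac)
  also have "\<dots> = (\<Sum>j\<le>m. shifted_exp b n j * shifted_exp a m j * f j)"
    by (rule kernel_sum_extend[symmetric]) simp
  finally show ?thesis .
qed

lemma kernel_coeff_swap: "kernel_coeff lam a b g m n = kernel_coeff lam b a g n m"
  "kernel_coeff1 lam a b g m n = kernel_coeff1 lam b a g n m"
  unfolding kernel_coeff_def kernel_coeff1_def by (rule kernel_sum_swap)+

text \<open>Coefficients of the derivative in u: the exponential contributes a, and the argument g u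
  w contributes g w together with B'.\<close>

lemma kernel_coeff_Suc:
  "(real m + 1) * kernel_coeff lam a b g (Suc m) n =
   a * kernel_coeff lam a b g m n + (if n = 0 then 0 else g * kernel_coeff1 lam a b g m (n - 1))"
proof -
  let ?c = "bessel_coeff lam"
  have "(real m + 1) * kernel_coeff lam a b g (Suc m) n =
    (\<Sum>j\<le>n. ((real (Suc m) - real j) * shifted_exp a (Suc m) j) * shifted_exp b n j * (?c j * g ^ j)) +
    (\<Sum>j\<le>n. shifted_exp a (Suc m) j * shifted_exp b n j * (real j * ?c j * g ^ j))"
    unfolding kernel_coeff_def sum_distrib_left sum.distrib[symmetric]
    by (intro sum.cong refl) (simp add: algebra_simps)
  also have "(\<Sum>j\<le>n. ((real (Suc m) - real j) * shifted_exp a (Suc m) j) * shifted_exp b n j * (?c j * g ^ j)) =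
    a * kernel_coeff lam a b g m n"
    unfolding shifted_exp_Suc kernel_coeff_def sum_distrib_left by (simp add: mult_ac)
  also have "(\<Sum>j\<le>n. shifted_exp a (Suc m) j * shifted_exp b n j * (real j * ?c j * g ^ j)) =
    (if n = 0 then 0 else g * kernel_coeff1 lam a b g m (n - 1))"
  proof (cases n)
    case (Suc k)
    then show ?thesis
      by (simp only: sum.atMost_Suc_shift shifted_exp_Suc_Suc kernel_coeff1_def)
        (simp add: sum_distrib_left diffs_def mult_ac)
  qed simp
  finally show ?thesis .
qed

text \<open>Coefficients of (u d/du + lam) applied to exp(a u + b w) B'(g u w), where Bessel's
  equation replaces z B'' + lam B' by B.\<close>

lemma kernel_coeff1_rec:
  assumes "lam > 0"
  shows "(real m + lam) * kernel_coeff1 lam a b g m n =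
    kernel_coeff lam a b g m n + (if m = 0 then 0 else a * kernel_coeff1 lam a b g (m - 1) n)"
proof -
  let ?d = "diffs (bessel_coeff lam)"
  have "(real m + lam) * kernel_coeff1 lam a b g m n =
    (\<Sum>j\<le>n. shifted_exp a m j * shifted_exp b n j * ((lam + real j) * ?d j * g ^ j)) +
    (\<Sum>j\<le>n. ((real m - real j) * shifted_exp a m j) * shifted_exp b n j * (?d j * g ^ j))"
    unfolding kernel_coeff1_def sum_distrib_left sum.distrib[symmetric]
    by (intro sum.cong refl) (simp add: algebra_simps)
  also have "(lam + real j) * ?d j = bessel_coeff lam j" for j
    using bessel_coeff_Suc[OF assms, of j] by (simp add: diffs_def mult_ac add_ac)
  then have "(\<Sum>j\<le>n. shifted_exp a m j * shifted_exp b n j * ((lam + real j) * ?d j * g ^ j)) = kernel_coeff lam a b g m n"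
    by (simp add: kernel_coeff_def)
  also have "(\<Sum>j\<le>n. ((real m - real j) * shifted_exp a m j) * shifted_exp b n j * (?d j * g ^ j)) =
    (if m = 0 then 0 else a * kernel_coeff1 lam a b g (m - 1) n)"
  proof (cases m)
    case 0
    have "(real 0 - real j) * shifted_exp a 0 j = 0" for j by (simp add: shifted_exp_def)
    then show ?thesis unfolding 0 by (simp only:) simp
  next
    case (Suc k)
    then show ?thesis
      unfolding Suc shifted_exp_Suc kernel_coeff1_def by (simp add: sum_distrib_left mult_ac)
  qed
  finally show ?thesis .
qed

text \<open>\<open>J\<close> will be the moments and \<open>A\<close> the moments with the extra
  factor (xy|\<xi>). The recurrences determine both, and the coefficients of the kernel with B and
  with B' solve them. Where \<open>m - 1\<close> or \<open>n - 1\<close> is truncated, its prefactor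
  is 0.\<close>

lemma moment_recurrence:
  fixes J A :: "nat \<Rightarrow> nat \<Rightarrow> real"
  assumes lam: "lam > 0" and q: "q > 0"
    and J0: "J 0 0 = 1"
    and J1: "\<And>m n. (real (m + n) + q) * J (Suc m) n = (real m + lam) * a * J m n + real n * A m (n - 1)"
    and J2: "\<And>m n. (real (m + n) + q) * J m (Suc n) = (real n + lam) * b * J m n + real m * A (m - 1) n"
    and A: "\<And>m n. (real (m + n) + q) * A m n = (real (m + n) / 2 + lam) * g * J m n
       + (real m * a * A (m - 1) n + real n * b * A m (n - 1)) / 2"
  shows "bessel_coeff lam m * bessel_coeff lam n * (pochhammer q (m + n) * J m n) = kernel_coeff lam a b g m n"
proof -
  define c where "c m = fact m * pochhammer lam m" for m
  have cSuc: "c (Suc m) = (real m + 1) * (real m + lam) * c m" for m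
    by (simp add: c_def pochhammer_rec' algebra_simps)
  have qSuc: "pochhammer q (Suc m) = pochhammer q m * (real m + q)" for m
    by (simp add: pochhammer_rec' algebra_simps)
  let ?S = "kernel_coeff lam a b g" and ?T = "kernel_coeff1 lam a b g"
  \<comment> \<open>For a positive first index, \<open>J\<close> in degree N refers to
    \<open>A\<close> in degree N - 2, while \<open>A\<close> in degree N refers to \<open>J\<close>
    in degree N. So the claims go together, with \<open>J\<close> first.\<close>
  have "\<forall>m n. m + n = N \<longrightarrow> pochhammer q N * J m n = c m * c n * ?S m n \<and>
     pochhammer q (Suc N) * A m n = c m * (real m + lam) * (c n * (real n + lam)) * (g * ?T m n)" for N
  proof (induction N rule: less_induct)
    case (less N)
    have JN: "pochhammer q N * J m n = c m * c n * ?S m n" if "m + n = N" for m n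
    proof (cases m)
      case (Suc k)
      have N: "N = Suc (k + n)" using Suc that by simp
      have "pochhammer q N * J m n = pochhammer q (k + n) * ((real (k + n) + q) * J (Suc k) n)"
        unfolding N Suc qSuc by (simp add: mult_ac)
      also have "\<dots> = (real k + lam) * a * (pochhammer q (k + n) * J k n) + real n * (pochhammer q (k + n) * A k (n - 1))"
        unfolding J1 by (simp add: algebra_simps)
      also have "pochhammer q (k + n) * J k n = c k * c n * ?S k n" using less N by simp
      also have "real n * (pochhammer q (k + n) * A k (n - 1)) =
         c k * (real k + lam) * c n * (if n = 0 then 0 else g * ?T k (n - 1))"
      proof (cases n)
        case (Suc l)
        then have "pochhammer q (k + n) * A k (n - 1) = c k * (real k + lam) * (c l * (real l + lam)) * (g * ?T k l)"
          using less[of "k + l"] N by simp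
        then show ?thesis using Suc by (simp add: cSuc algebra_simps)
      qed simp
      also have "(real k + lam) * a * (c k * c n * ?S k n) + \<dots> =
         c k * (real k + lam) * c n * (a * ?S k n + (if n = 0 then 0 else g * ?T k (n - 1)))"
        by (simp add: algebra_simps)
      also have "\<dots> = c m * c n * ?S m n"
        unfolding kernel_coeff_Suc[symmetric] Suc cSuc by (simp add: algebra_simps)
      finally show ?thesis .
    next
      case m0: 0
      show ?thesis
      proof (cases n)
        case 0
        then show ?thesis using that m0 J0
          by (simp add: c_def kernel_coeff_def shifted_exp_def bessel_coeff_def)
      next
        case (Suc k)
        then have N: "N = Suc k" using that m0 by simp
        have "pochhammer q N * J m n = pochhammer q k * ((real (0 + k) + q) * J 0 (Suc k))"
          unfolding N Suc m0 by (simp add: qSuc mult_ac)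
        also have "\<dots> = (real k + lam) * b * (pochhammer q k * J 0 k)"
          unfolding J2 by simp
        also have "pochhammer q k * J 0 k = c 0 * c k * ?S 0 k" using less[of k] Suc that by simp
        also have "(real k + lam) * b * (c 0 * c k * ?S 0 k) = c 0 * (real k + lam) * c k * ((real k + 1) * ?S 0 (Suc k))"
          using kernel_coeff_Suc[of k lam b a g 0] by (simp add: kernel_coeff_swap[of lam a b g 0] algebra_simps)
        also have "\<dots> = c m * c n * ?S m n" using m0 Suc by (simp add: cSuc algebra_simps)
        finally show ?thesis .
      qed
    qed
    moreover have "pochhammer q (Suc N) * A m n = c m * (real m + lam) * (c n * (real n + lam)) * (g * ?T m n)"
      if mn: "m + n = N" for m n
    proof -
      have "pochhammer q (Suc N) * A m n = pochhammer q N * ((real (m + n) + q) * A m n)"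
        using mn by (simp add: qSuc mult_ac)
      also have "\<dots> = (real (m + n) / 2 + lam) * g * (pochhammer q N * J m n)
         + (a * (real m * (pochhammer q N * A (m - 1) n)) + b * (real n * (pochhammer q N * A m (n - 1)))) / 2"
        unfolding A by (simp add: algebra_simps)
      also have "pochhammer q N * J m n = c m * c n * ?S m n" using JN mn by blast
      also have "real m * (pochhammer q N * A (m - 1) n) = c m * c n * (real n + lam) * g * (if m = 0 then 0 else ?T (m - 1) n)"
      proof (cases m)
        case (Suc k)
        then have "pochhammer q N * A (m - 1) n = c k * (real k + lam) * (c n * (real n + lam)) * (g * ?T k n)"
          using less[of "k + n"] mn by auto
        then show ?thesis using Suc by (simp add: cSuc algebra_simps)
      qed simp
      also have "real n * (pochhammer q N * A m (n - 1)) = c m * c n * (real m + lam) * g * (if n = 0 then 0 else ?T m (n - 1))"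
      proof (cases n)
        case (Suc k)
        then have "pochhammer q N * A m (n - 1) = c m * (real m + lam) * (c k * (real k + lam)) * (g * ?T m k)"
          using less[of "m + k"] mn by auto
        then show ?thesis using Suc by (simp add: cSuc algebra_simps)
      qed simp
      \<comment> \<open>As (m + n)/2 + lam is the mean of m + lam and n + lam, the sum splits into
        two halves, each of which is \<open>kernel_coeff1_rec\<close> in one of the two
        variables.\<close>
      also have "(real (m + n) / 2 + lam) * g * (c m * c n * ?S m n) +
         (a * (c m * c n * (real n + lam) * g * (if m = 0 then 0 else ?T (m - 1) n)) +
          b * (c m * c n * (real m + lam) * g * (if n = 0 then 0 else ?T m (n - 1)))) / 2 =
         c m * c n * g / 2 * ((real n + lam) * (?S m n + (if m = 0 then 0 else a * ?T (m - 1) n)) +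
           (real m + lam) * (?S m n + (if n = 0 then 0 else b * ?T m (n - 1))))"
        by (simp add: field_simps)
      also have "?S m n + (if m = 0 then 0 else a * ?T (m - 1) n) = (real m + lam) * ?T m n"
        using kernel_coeff1_rec[OF lam, of m a b g n] by simp
      also have "?S m n + (if n = 0 then 0 else b * ?T m (n - 1)) = (real n + lam) * ?T m n"
        using kernel_coeff1_rec[OF lam, of n b a g m] by (simp add: kernel_coeff_swap[of lam a b])
      also have "c m * c n * g / 2 * ((real n + lam) * ((real m + lam) * ?T m n) + (real m + lam) * ((real n + lam) * ?T m n)) =
         c m * (real m + lam) * (c n * (real n + lam)) * (g * ?T m n)" by (simp add: field_simps)
      finally show ?thesis .
    qed
    ultimately show ?case by blast
  qed
  then have "pochhammer q (m + n) * J m n = c m * c n * ?S m n" by blast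
  moreover have "bessel_coeff lam m * c m = 1" for m
    using pochhammer_pos[OF lam, of m] by (simp add: bessel_coeff_def c_def)
  ultimately show ?thesis by (simp add: mult_ac) (metis mult.assoc mult.left_commute mult.right_neutral)
qed

section \<open>Homogeneous expansions and their convergence\<close>

text \<open>The homogeneous part of degree N of a double power series; scaling both variables by the
  radius t multiplies it by t^N.\<close>

definition graded_sum :: "(nat \<Rightarrow> nat \<Rightarrow> real) \<Rightarrow> real \<Rightarrow> real \<Rightarrow> nat \<Rightarrow> real" where
  "graded_sum w X Y N = (\<Sum>m\<le>N. X ^ m * Y ^ (N - m) * w m (N - m))"

lemma graded_sum_scale: "graded_sum w (s * X) (s * Y) N = s ^ N * graded_sum w X Y N"
  unfolding graded_sum_def sum_distrib_left
proof (intro sum.cong refl)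
  fix m assume "m \<in> {..N}"
  then have "s ^ N = s ^ m * s ^ (N - m)" by (simp add: power_add[symmetric])
  then show "(s * X) ^ m * (s * Y) ^ (N - m) * w m (N - m) = s ^ N * (X ^ m * Y ^ (N - m) * w m (N - m))"
    by (simp add: power_mult_distrib mult_ac)
qed

lemma graded_sum_bound:
  assumes "\<And>m n. w m n \<ge> 0" "\<bar>X\<bar> \<le> P" "\<bar>Y\<bar> \<le> R"
  shows "\<bar>graded_sum w X Y N\<bar> \<le> graded_sum w P R N"
  unfolding graded_sum_def
proof (rule order_trans[OF sum_abs], rule sum_mono)
  fix m
  have "\<bar>X\<bar> ^ m * \<bar>Y\<bar> ^ (N - m) * w m (N - m) \<le> P ^ m * R ^ (N - m) * w m (N - m)"
    using assms by (intro mult_right_mono mult_mono power_mono) auto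
  then show "\<bar>X ^ m * Y ^ (N - m) * w m (N - m)\<bar> \<le> P ^ m * R ^ (N - m) * w m (N - m)"
    using assms(1) by (simp add: abs_mult power_abs)
qed

abbreviation "bessel_product_coeff lam \<equiv> (\<lambda>m n. bessel_coeff lam m * bessel_coeff lam n)"

lemma bessel_product_sums:
  assumes "lam > 0"
  shows "graded_sum (bessel_product_coeff lam) X Y sums (bessel_B lam X * bessel_B lam Y)"
  using Cauchy_product_sums[OF summable_bessel[OF assms, of X] summable_bessel[OF assms, of Y]]
  by (simp add: bessel_B_eq[OF assms] graded_sum_def[abs_def] mult_ac)

lemma exp_coeff_add:
  "(u + v :: real) ^ n / fact n = (\<Sum>k\<le>n. (u ^ k / fact k) * (v ^ (n - k) / fact (n - k)))"
  using exp_series_add_commuting[of u v n] by (simp add: divide_inverse mult_ac)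

text \<open>Both shifted exponentials start at \<open>j\<close>, so nothing is left unless 2j \<le>
  N. After (pr)^j is taken out, the binomial formula in degree N - 2j remains.\<close>

lemma kernel_inner_sum:
  "(\<Sum>m\<le>N. p ^ m * r ^ (N - m) * (shifted_exp a m j * shifted_exp b (N - m) j)) =
   (if 2 * j \<le> N then (p * r) ^ j * ((a * p + b * r) ^ (N - 2 * j) / fact (N - 2 * j)) else 0)"
proof (cases "2 * j \<le> N")
  case False
  then have "shifted_exp a m j * shifted_exp b (N - m) j = 0" if "m \<le> N" for m
    using that by (auto simp: shifted_exp_def)
  then have "(\<Sum>m\<le>N. p ^ m * r ^ (N - m) * (shifted_exp a m j * shifted_exp b (N - m) j)) = 0"
    by (intro sum.neutral) simp
  then show ?thesis using False by simp
next
  case True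
  define n where "n = N - 2 * j"
  have N: "N = n + 2 * j" using True by (simp add: n_def)
  let ?f = "\<lambda>m. p ^ m * r ^ (N - m) * (shifted_exp a m j * shifted_exp b (N - m) j)"
  have "(\<Sum>m\<le>N. ?f m) = (\<Sum>m\<in>{0 + j..n + j}. ?f m)"
    by (rule sum.mono_neutral_right) (auto simp: shifted_exp_def N)
  also have "\<dots> = (\<Sum>k\<in>{0..n}. ?f (k + j))" by (rule sum.shift_bounds_cl_nat_ivl)
  also have "\<dots> = (\<Sum>k\<le>n. (p * r) ^ j * (((a * p) ^ k / fact k) * ((b * r) ^ (n - k) / fact (n - k))))"
  proof (rule sum.cong)
    fix k assume "k \<in> {..n}"
    then have k: "k \<le> n" by simp
    then have "N - (k + j) = (n - k) + j" "j \<le> (n - k) + j" by (simp_all add: N)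
    then show "?f (k + j) = (p * r) ^ j * (((a * p) ^ k / fact k) * ((b * r) ^ (n - k) / fact (n - k)))"
      by (simp add: shifted_exp_def power_add power_mult_distrib)
  qed auto
  also have "\<dots> = (p * r) ^ j * ((a * p + b * r) ^ n / fact n)"
    by (simp only: exp_coeff_add sum_distrib_left)
  finally show ?thesis using True by (simp add: n_def)
qed

text \<open>Cauchy product of the exponential series with that of B(p r g). The m-th term of the
  latter is homogeneous of degree 2m, so \<open>C\<close> places it at the even index 2m and is 0 at
  odd ones.\<close>

lemma kernel_coeff_sums:
  assumes "lam > 0"
  shows "graded_sum (kernel_coeff lam a b g) p r sums
    (exp (a * p + b * r) * bessel_B lam (p * r * g))"
proof -
  define c where "c = bessel_coeff lam"
  define C where "C i = (if even i then c (i div 2) * (p * r * g) ^ (i div 2) else 0)" for i :: nat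
  define E where "E k = (a * p + b * r) ^ k / fact k" for k :: nat
  have even_sums: "(\<lambda>i. if even i then f (i div 2) else 0) sums s" if "f sums s" for f :: "nat \<Rightarrow> real" and s
    using sums_if[OF sums_zero that] by (simp cong: if_cong)
  have "(\<lambda>m. c m * (p * r * g) ^ m) sums bessel_B lam (p * r * g)"
    unfolding c_def bessel_B_eq[OF assms] using summable_bessel_diffs(1)[OF assms] by (rule summable_sums)
  from even_sums[OF this] have C: "C sums bessel_B lam (p * r * g)" by (simp add: C_def[abs_def])
  from even_sums[OF summable_sums[OF summable_bessel[OF assms, of "p * r * g"]]]
  have "summable (\<lambda>i. if even i then norm (c (i div 2) * (p * r * g) ^ (i div 2)) else 0)"
    unfolding c_def by (rule sums_summable)
  moreover have "(\<lambda>i. if even i then norm (c (i div 2) * (p * r * g) ^ (i div 2)) else 0) = (\<lambda>i. norm (C i))"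
    by (simp add: C_def fun_eq_iff)
  ultimately have normC: "summable (\<lambda>i. norm (C i))" by simp
  have E: "E sums exp (a * p + b * r)"
    unfolding E_def using exp_converges[of "a * p + b * r"] by (simp add: divide_inverse mult.commute)
  have normE: "summable (\<lambda>i. norm (E i))"
    unfolding E_def using summable_norm_exp[of "a * p + b * r"] by (simp add: divide_inverse mult.commute)
  have "(\<lambda>N. \<Sum>i\<le>N. C i * E (N - i)) sums (bessel_B lam (p * r * g) * exp (a * p + b * r))"
    using Cauchy_product_sums[OF normC normE] C E by (simp add: sums_iff)
  moreover have "(\<Sum>i\<le>N. C i * E (N - i)) = graded_sum (kernel_coeff lam a b g) p r N" for N
  proof -
    have "graded_sum (kernel_coeff lam a b g) p r N =
      (\<Sum>m\<le>N. \<Sum>j\<le>N. p ^ m * r ^ (N - m) * (shifted_exp a m j * shifted_exp b (N - m) j) * (c j * g ^ j))"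
      unfolding graded_sum_def
    proof (intro sum.cong refl)
      fix m
      have "kernel_coeff lam a b g m (N - m) = (\<Sum>j\<le>N. shifted_exp a m j * shifted_exp b (N - m) j * (c j * g ^ j))"
        unfolding kernel_coeff_def c_def by (rule kernel_sum_extend) simp
      then show "p ^ m * r ^ (N - m) * kernel_coeff lam a b g m (N - m) =
        (\<Sum>j\<le>N. p ^ m * r ^ (N - m) * (shifted_exp a m j * shifted_exp b (N - m) j) * (c j * g ^ j))"
        by (simp add: sum_distrib_left mult_ac)
    qed
    also have "\<dots> = (\<Sum>j\<le>N. (\<Sum>m\<le>N. p ^ m * r ^ (N - m) * (shifted_exp a m j * shifted_exp b (N - m) j)) * (c j * g ^ j))"
      by (subst sum.swap) (simp add: sum_distrib_right)
    also have "\<dots> = (\<Sum>j\<le>N. if 2 * j \<le> N then C (2 * j) * E (N - 2 * j) else 0)"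
      unfolding kernel_inner_sum by (intro sum.cong refl) (simp add: C_def E_def power_mult_distrib)
    also have "\<dots> = (\<Sum>j\<in>{j. 2 * j \<le> N}. C (2 * j) * E (N - 2 * j))"
      by (subst sum.inter_filter[symmetric]) (auto intro!: sum.cong)
    also have "\<dots> = (\<Sum>i\<in>(\<lambda>j. 2 * j) ` {j. 2 * j \<le> N}. C i * E (N - i))"
      by (subst sum.reindex) (auto simp: inj_on_def)
    also have "\<dots> = (\<Sum>i\<le>N. C i * E (N - i))"
      by (rule sum.mono_neutral_left) (auto simp: C_def elim!: evenE)
    finally show ?thesis by simp
  qed
  ultimately show ?thesis by (simp add: mult.commute)
qed

lemma summable_pochhammer_half:
  fixes q :: real assumes "q > 0"
  shows "summable (\<lambda>N. (1/2) ^ N / fact N * pochhammer q N)"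
proof -
  obtain M :: nat where M: "2 * q < real M" using reals_Archimedean2 by blast
  show ?thesis
  proof (rule summable_ratio_test[of "3/4" M])
    fix n assume "n \<ge> M"
    then have "2 * q < real n" using M by linarith
    then have r: "(q + real n) / (2 * (real n + 1)) \<le> 3/4" by (simp add: field_simps)
    define x where "x = (1/2) ^ n / fact n * pochhammer q n"
    have x: "x \<ge> 0" using pochhammer_pos[OF assms, of n] by (simp add: x_def)
    have "(1/2) ^ Suc n / fact (Suc n) * pochhammer q (Suc n) = (q + real n) / (2 * (real n + 1)) * x"
      unfolding fact_Suc pochhammer_rec' x_def by (simp add: distrib_left distrib_right mult_ac add.commute)
    also have "\<dots> \<le> 3/4 * x" using r x by (rule mult_right_mono)
    finally have "(1/2) ^ Suc n / fact (Suc n) * pochhammer q (Suc n) \<le> 3/4 * x" .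
    moreover have "(1/2) ^ Suc n / fact (Suc n) * pochhammer q (Suc n) \<ge> 0"
      using pochhammer_pos[OF assms, of "Suc n"] by (simp del: fact_Suc)
    ultimately show "norm ((1/2) ^ Suc n / fact (Suc n) * pochhammer q (Suc n)) \<le> 3/4 * norm ((1/2) ^ n / fact n * pochhammer q n)"
      using x unfolding x_def by (simp only: real_norm_def abs_of_nonneg)
  qed simp
qed

lemma summable_bessel_product_bound:
  fixes q :: real
  assumes lam: "lam > 0" and q: "q > 0" and t: "\<tau> > 0" and PR: "P \<ge> 0" "R \<ge> 0"
  shows "summable (\<lambda>N. graded_sum (bessel_product_coeff lam) P R N * (pochhammer q N / \<tau> ^ N))"
proof -
  define D where "D = graded_sum (bessel_product_coeff lam) P R"
  \<comment> \<open>Chosen so that eps (P + R) \<le> \<tau>/2, which leaves (1/2)^N/N! against the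
    Pochhammer factor; the summand 1 keeps the denominator positive.\<close>
  define eps where "eps = \<tau> / (2 * (P + R + 1))"
  have eps: "eps > 0" using t PR by (simp add: eps_def)
  have small: "eps * (P + R) \<le> \<tau> / 2" using t PR by (simp add: eps_def field_simps)
  obtain K where K: "K \<ge> 0" "\<And>m. bessel_coeff lam m \<le> K * (eps ^ m / fact m)"
    using bessel_coeff_bound[OF lam eps] by blast
  have bd: "D N \<le> K * K * ((\<tau> / 2) ^ N / fact N)" for N
  proof -
    have "D N \<le> (\<Sum>m\<le>N. P ^ m * R ^ (N - m) * ((K * (eps ^ m / fact m)) * (K * (eps ^ (N - m) / fact (N - m)))))"
      unfolding D_def graded_sum_def using K PR bessel_coeff_nonneg[OF lam] eps
      by (intro sum_mono mult_left_mono mult_mono) auto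
    also have "\<dots> = K * K * (\<Sum>m\<le>N. ((eps * P) ^ m / fact m) * ((eps * R) ^ (N - m) / fact (N - m)))"
      by (simp add: sum_distrib_left power_mult_distrib mult_ac)
    also have "\<dots> = K * K * ((eps * (P + R)) ^ N / fact N)"
      unfolding exp_coeff_add[symmetric] by (simp add: distrib_left)
    also have "\<dots> \<le> K * K * ((\<tau> / 2) ^ N / fact N)"
      using small K eps PR by (intro mult_left_mono divide_right_mono power_mono) auto
    finally show ?thesis .
  qed
  show ?thesis
    unfolding D_def[symmetric]
  proof (rule summable_comparison_test'[of "\<lambda>N. K * K * ((1/2) ^ N / fact N * pochhammer q N)" 0])
    show "summable (\<lambda>N. K * K * ((1/2) ^ N / fact N * pochhammer q N))"
      by (intro summable_mult summable_pochhammer_half q)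
    fix N :: nat
    have D: "D N \<ge> 0"
      unfolding D_def graded_sum_def using bessel_coeff_nonneg[OF lam] PR by (intro sum_nonneg) auto
    have pn: "pochhammer q N / \<tau> ^ N \<ge> 0" using pochhammer_pos[OF q, of N] t by simp
    have "D N * (pochhammer q N / \<tau> ^ N) \<le> K * K * ((\<tau> / 2) ^ N / fact N) * (pochhammer q N / \<tau> ^ N)"
      using pn by (rule mult_right_mono[OF bd])
    also have "\<dots> = K * K * ((1/2) ^ N / fact N * pochhammer q N)"
      using t by (simp add: power_divide)
    finally show "norm (D N * (pochhammer q N / \<tau> ^ N)) \<le> K * K * ((1/2) ^ N / fact N * pochhammer q N)"
      using mult_nonneg_nonneg[OF D pn] by (simp only: real_norm_def abs_of_nonneg)
  qed
qed

section \<open>The orbit of primitive idempotents and its Haar moments\<close>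

context bessel_setting
begin

text \<open>The structure relation carries the rank-one formula for P(c) to every point of the
  orbit.\<close>

lemma orbit_P:
  assumes "primitive c" "x \<in> orbit c"
  shows "\<P> x x v = (x \<bullet> v) *\<^sub>R x"
proof -
  obtain g where g: "g \<in> Str\<^sub>0" "x = blinfun_apply g c" using assms by (auto simp: min_orbit_def)
  have "linear (blinfun_apply g)" by (simp add: blinfun.bounded_linear_right bounded_linear.linear)
  then have adj: "c \<bullet> adjoint (blinfun_apply g) v = x \<bullet> v" using g by (simp add: adjoint_works)
  show ?thesis
    using structure_groupD(2)[of g c v] structure_group_0_subset g
    by (auto simp: primitive_P_1[OF assms(1)] adj blinfun.scaleR_right)
qed

lemma orbit_square:
  assumes "primitive c" "x \<in> orbit c"
  shows "x \<odot> x = tr x *\<^sub>R x"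
  using orbit_P[OF assms, of e] by (simp add: jordan_P_same unit_right trace_inner scaleR_2)

text \<open>The rank-one formula solved for the iterated product. Returning only \<open>x\<close>
  and \<open>x \<odot> v\<close>, it closes the system of moments.\<close>

lemma orbit_mult_mult:
  assumes "primitive c" "x \<in> orbit c"
  shows "x \<odot> (x \<odot> v) = (1/2) *\<^sub>R ((x \<bullet> v) *\<^sub>R x + tr x *\<^sub>R (x \<odot> v))"
  by (rule half_eqI)
    (use orbit_P[OF assms, of v] orbit_square[OF assms] in \<open>simp add: jordan_P_same prod_expand algebra_simps\<close>)

lemma orbit_inner_self:
  assumes "primitive c" "x \<in> orbit c"
  shows "x \<bullet> x = tr x ^ 2"
  using inner_unit[of x x] orbit_square[OF assms] by (simp add: trace_inner power2_eq_square)

text \<open>The trace cannot vanish, as its square is (x|x) and group elements are injective. It is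
  1 at \<open>c\<close>, and the identity component is connected.\<close>

lemma orbit_trace_pos:
  assumes "primitive c" "x \<in> orbit c"
  shows "tr x > 0"
proof -
  define f where "f g = tr (blinfun_apply g c)" for g
  have c0: "c \<noteq> 0" using assms by (simp add: primitive_idempotent_def)
  have ne: "f g \<noteq> 0" if "g \<in> Str\<^sub>0" for g
  proof
    assume "f g = 0"
    moreover have "g c \<in> orbit c" using that by (auto simp: min_orbit_def)
    ultimately have "g c \<bullet> g c = 0" by (metis f_def orbit_inner_self[OF assms(1)] power_zero_numeral)
    then have "g c = 0" by simp
    moreover have "inj (blinfun_apply g)"
      using structure_groupD(1)[of g] that structure_group_0_subset by (auto simp: bij_def)
    ultimately show False using c0 injD[of g c 0] by (simp add: blinfun.zero_right)
  qed
  have "connected (f ` Str\<^sub>0)"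
    unfolding f_def trace_inner structure_group_0_def
    by (intro connected_continuous_image continuous_intros) auto
  moreover obtain g where g: "g \<in> Str\<^sub>0" "x = blinfun_apply g c" using assms by (auto simp: min_orbit_def)
  moreover have "f id_blinfun = 1" using primitive_trace[OF assms(1)] by (simp add: f_def)
  then have "1 \<in> f ` Str\<^sub>0" using id_structure_group_0 by force
  ultimately have "0 \<in> f ` Str\<^sub>0" if "f g \<le> 0"
    using connectedD_interval[of "f ` Str\<^sub>0" "f g" 1 0] that by auto
  then have "f g > 0" using ne by force
  then show ?thesis using g by (simp add: f_def)
qed

lemma orbit_norm:
  assumes "primitive c" "x \<in> orbit c"
  shows "norm x = tr x"
  using orbit_inner_self[OF assms] orbit_trace_pos[OF assms] by (simp add: norm_eq_sqrt_inner)

end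

section \<open>Invariance of the Haar measure under inner derivations\<close>

locale bessel_orbit = bessel_setting +
  fixes c\<^sub>1 :: 'a and \<kappa> :: "('a \<Rightarrow>\<^sub>L 'a) measure"
  assumes prim: "primitive c\<^sub>1"
    and haar: "normalized_haar (structure_group_K (\<odot>) e) \<kappa>"
begin

abbreviation "K \<equiv> structure_group_K (\<odot>) e"
abbreviation "\<Xi> \<equiv> orbit c\<^sub>1"
abbreviation "orb k \<equiv> blinfun_apply k c\<^sub>1"

lemma sets_haar: "sets \<kappa> = sets (restrict_space borel K)"
  using haar by (simp add: normalized_haar_def)

lemma space_haar: "space \<kappa> = K"
  using sets_eq_imp_space_eq[OF sets_haar] by (simp add: space_restrict_space)

lemma emeasure_haar: "emeasure \<kappa> K = 1"
  using haar by (simp add: normalized_haar_def)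

sublocale haar: finite_measure \<kappa>
  by (rule finite_measureI) (simp add: space_haar emeasure_haar)

lemma K_orbit:
  assumes "k \<in> K"
  shows "orb k \<in> \<Xi>" "tr (orb k) = 1" "norm (orb k) = 1"
proof -
  show 1: "orb k \<in> \<Xi>" using assms by (auto simp: structure_group_K_def min_orbit_def)
  show 2: "tr (orb k) = 1"
    using structure_group_K_isometry(2)[OF assms, of c\<^sub>1] primitive_trace[OF prim] by (simp add: trace_inner)
  show "norm (orb k) = 1" using orbit_norm[OF prim 1] 2 by simp
qed

lemma haar_measurable:
  assumes "continuous_on UNIV f"
  shows "f \<in> borel_measurable \<kappa>"
proof -
  have "f \<in> borel_measurable (restrict_space borel K)"
    using borel_measurable_continuous_onI[OF assms] by (rule measurable_restrict_space1)
  then show ?thesis by (simp add: measurable_cong_sets[OF sets_haar refl])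
qed

lemma haar_measurable_orbit:
  assumes "continuous_on UNIV f"
  shows "(\<lambda>k. f (orb k)) \<in> borel_measurable \<kappa>"
  by (rule haar_measurable, rule continuous_on_compose2[OF assms]) (auto intro!: continuous_intros)

lemma haar_integrable:
  fixes f :: "'a \<Rightarrow> real"
  assumes "continuous_on UNIV f"
  shows "integrable \<kappa> (\<lambda>k. f (orb k))"
proof -
  have "compact (f ` sphere 0 1)"
    by (intro compact_continuous_image continuous_on_subset[OF assms]) auto
  then obtain M where "\<And>v. v \<in> sphere 0 1 \<Longrightarrow> \<bar>f v\<bar> \<le> M"
    by (force dest!: compact_imp_bounded simp: bounded_iff)
  then show ?thesis
    using haar_measurable_orbit[OF assms] K_orbit
    by (intro haar.integrable_const_bound[of _ M]) (auto simp: space_haar)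
qed

lemma K_exp_compose:
  assumes "k \<in> K"
  shows "blinfun_exp (mult_bracket u v) s o\<^sub>L k \<in> K"
proof -
  have "blinfun_exp (mult_bracket u v) s e = e"
    using structure_group_K_exp[of u v s] by (simp add: structure_group_K_def)
  then show ?thesis
    using assms structure_group_0_exp[OF structure_lie_bracket] by (auto simp: structure_group_K_def)
qed

lemma haar_translation_measurable:
  "(\<lambda>g. blinfun_exp (mult_bracket u v) s o\<^sub>L g) \<in> \<kappa> \<rightarrow>\<^sub>M \<kappa>"
proof -
  have "(\<lambda>g. blinfun_exp (mult_bracket u v) s o\<^sub>L g) \<in> borel_measurable \<kappa>"
    by (rule haar_measurable) (intro bounded_bilinear.continuous_on[OF bounded_bilinear_blinfun_compose] continuous_intros)
  then have "(\<lambda>g. blinfun_exp (mult_bracket u v) s o\<^sub>L g) \<in> \<kappa> \<rightarrow>\<^sub>M restrict_space borel K"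
    using K_exp_compose by (intro measurable_restrict_space2) (auto simp: space_haar)
  then show ?thesis by (simp add: measurable_cong_sets[OF refl sets_haar])
qed

text \<open>\<open>normalized_haar\<close> speaks of images, so the preimage under a translation is
  rewritten as the image under the inverse exponential.\<close>

lemma haar_distr_exp: "distr \<kappa> \<kappa> (\<lambda>g. blinfun_exp (mult_bracket u v) s o\<^sub>L g) = \<kappa>"
proof (rule measure_eqI)
  let ?E = "blinfun_exp (mult_bracket u v)"
  fix A assume "A \<in> sets (distr \<kappa> \<kappa> (\<lambda>g. ?E s o\<^sub>L g))"
  then have A: "A \<in> sets \<kappa>" by simp
  have inv: "?E s o\<^sub>L (?E (- s) o\<^sub>L g) = g" "?E (- s) o\<^sub>L (?E s o\<^sub>L g) = g" for g
    by (rule blinfun_eqI, simp add: blinfun_exp_minus)+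
  have "A \<subseteq> K" using sets.sets_into_space[OF A] by (simp add: space_haar)
  then have "(\<lambda>g. ?E s o\<^sub>L g) -` A \<inter> space \<kappa> = (\<lambda>g. ?E (- s) o\<^sub>L g) ` A"
  proof (intro set_eqI iffI)
    fix g assume "g \<in> (\<lambda>g. ?E s o\<^sub>L g) -` A \<inter> space \<kappa>"
    then have "?E s o\<^sub>L g \<in> A" by simp
    then show "g \<in> (\<lambda>g. ?E (- s) o\<^sub>L g) ` A" using inv(2)[of g] by (metis image_eqI)
  next
    fix g assume "g \<in> (\<lambda>g. ?E (- s) o\<^sub>L g) ` A"
    then obtain h where h: "h \<in> A" "g = ?E (- s) o\<^sub>L h" by blast
    then show "g \<in> (\<lambda>g. ?E s o\<^sub>L g) -` A \<inter> space \<kappa>"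
      using K_exp_compose[of h] \<open>A \<subseteq> K\<close> inv(1)[of h] by (auto simp: space_haar)
  qed
  then show "emeasure (distr \<kappa> \<kappa> (\<lambda>g. ?E s o\<^sub>L g)) A = emeasure \<kappa> A"
    using haar A structure_group_K_exp[of u v "- s"] haar_translation_measurable
    by (simp add: emeasure_distr normalized_haar_def)
qed simp

text \<open>The integral of F(exp(sD) k c) is independent of s. Its difference quotients at s =
  1/(n+1) may be taken to the limit under the integral: the mean value theorem bounds them by the
  maximum of the derivative on the unit sphere, which exp(sD) preserves.\<close>

lemma haar_derivation:
  fixes F :: "'a \<Rightarrow> real"
  assumes F: "\<And>x. (F has_derivative F' x) (at x)"
    and cont: "continuous_on UNIV (\<lambda>x. F' x (mult_bracket u v x))"
  shows "(\<integral>k. F' (orb k) (mult_bracket u v (orb k)) \<partial>\<kappa>) = 0"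
proof -
  let ?D = "mult_bracket u v"
  let ?E = "blinfun_exp ?D"
  define G where "G x = F' x (?D x)" for x
  have contF: "continuous_on UNIV F"
    using F by (meson continuous_at_imp_continuous_on has_derivative_continuous)
  have "compact (G ` sphere 0 1)"
    unfolding G_def by (intro compact_continuous_image continuous_on_subset[OF cont]) auto
  then obtain M where M: "\<And>x. x \<in> sphere 0 1 \<Longrightarrow> \<bar>G x\<bar> \<le> M"
    by (force dest!: compact_imp_bounded simp: bounded_iff)
  have der: "((\<lambda>s. F (?E s x)) has_real_derivative G (?E s x)) (at s)" for x s
  proof -
    have "((\<lambda>s. F (?E s x)) has_derivative (\<lambda>h. F' (?E s x) (h *\<^sub>R ?D (?E s x)))) (at s)"
      using has_derivative_compose[OF blinfun_exp_apply_has_vector_derivative[unfolded has_vector_derivative_def] F] .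
    moreover have "F' y (h *\<^sub>R z) = G' * h" if "G' = F' y z" for y z h G'
      using linear_cmul[OF has_derivative_linear[OF F], of y h z] that by simp
    ultimately show ?thesis by (simp add: has_field_derivative_def G_def mult_commute_abs)
  qed
  have norm_E: "norm (?E s x) = norm x" for s x
    using structure_group_K_isometry(1)[OF structure_group_K_exp] by (simp add: norm_eq_sqrt_inner)
  define q where "q n x = (F (?E (1 / real (Suc n)) x) - F x) / (1 / real (Suc n))" for n x
  have int0: "(\<integral>k. q n (orb k) \<partial>\<kappa>) = 0" for n
  proof -
    let ?s = "1 / real (Suc n)"
    have i1: "integrable \<kappa> (\<lambda>k. F (orb k))" using haar_integrable[OF contF] .
    have i2: "integrable \<kappa> (\<lambda>k. F (?E ?s (orb k)))"
      by (rule haar_integrable, rule continuous_on_compose2[OF contF]) (auto intro!: continuous_intros)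
    have "(\<integral>k. F (orb k) \<partial>\<kappa>) = (\<integral>k. F (orb k) \<partial>(distr \<kappa> \<kappa> (\<lambda>g. ?E ?s o\<^sub>L g)))"
      by (simp only: haar_distr_exp)
    also have "\<dots> = (\<integral>k. F (blinfun_apply (?E ?s o\<^sub>L k) c\<^sub>1) \<partial>\<kappa>)"
      by (rule integral_distr[OF haar_translation_measurable haar_measurable_orbit[OF contF]])
    finally show ?thesis using i1 i2 by (simp add: q_def)
  qed
  have "(\<lambda>n. \<integral>k. q n (orb k) \<partial>\<kappa>) \<longlonglongrightarrow> (\<integral>k. G (orb k) \<partial>\<kappa>)"
  proof (rule integral_dominated_convergence[where w = "\<lambda>_. M"])
    show "(\<lambda>k. G (orb k)) \<in> borel_measurable \<kappa>"
      by (rule haar_measurable_orbit) (use cont in \<open>simp add: G_def\<close>)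
    show "(\<lambda>k. q n (orb k)) \<in> borel_measurable \<kappa>" for n
    proof (rule haar_measurable_orbit)
      have "continuous_on UNIV (\<lambda>x. F (?E (1 / real (Suc n)) x))"
        by (rule continuous_on_compose2[OF contF]) (auto intro!: continuous_intros)
      then show "continuous_on UNIV (q n)"
        unfolding q_def by (intro continuous_intros contF) auto
    qed
    show "AE k in \<kappa>. (\<lambda>n. q n (orb k)) \<longlonglongrightarrow> G (orb k)"
    proof (rule AE_I2)
      fix k :: "'a \<Rightarrow>\<^sub>L 'a"
      let ?x = "orb k"
      have "((\<lambda>h. (F (?E (0 + h) ?x) - F (?E 0 ?x)) / h) \<longlongrightarrow> G (?E 0 ?x)) (at 0)"
        using der[of ?x 0] by (simp only: DERIV_def)
      then have "((\<lambda>h. (F (?E h ?x) - F ?x) / h) \<longlongrightarrow> G ?x) (at 0)" by simp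
      moreover have "filterlim (\<lambda>n. 1 / real (Suc n)) (at 0) sequentially"
        using LIMSEQ_inverse_real_of_nat by (intro filterlim_atI) (auto simp: inverse_eq_divide)
      ultimately show "(\<lambda>n. q n ?x) \<longlonglongrightarrow> G ?x"
        unfolding q_def by (rule filterlim_compose)
    qed
    show "AE k in \<kappa>. norm (q n (orb k)) \<le> M" for n
    proof (rule AE_I2)
      fix k assume "k \<in> space \<kappa>"
      then have nx: "norm (orb k) = 1" using K_orbit by (simp add: space_haar)
      let ?x = "orb k" and ?s = "1 / real (Suc n)"
      obtain z where "F (?E ?s ?x) - F (?E 0 ?x) = (?s - 0) * G (?E z ?x)"
        using MVT2[of 0 ?s "\<lambda>s. F (?E s ?x)" "\<lambda>s. G (?E s ?x)"] der by auto
      then have "q n ?x = G (?E z ?x)" by (simp add: q_def)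
      then show "norm (q n ?x) \<le> M" using M[of "?E z ?x"] norm_E nx by simp
    qed
  qed simp
  then have "(\<integral>k. G (orb k) \<partial>\<kappa>) = 0"
    unfolding int0 by (simp add: LIMSEQ_const_iff)
  then show ?thesis by (simp add: G_def)
qed

end

section \<open>Moments of the Haar measure\<close>

context bessel_orbit
begin

text \<open>\<open>w\<close> is the extra linear factor; at w = x or w = y it merely raises an
  exponent of \<open>moment0\<close>.\<close>

definition moment :: "'a \<Rightarrow> 'a \<Rightarrow> 'a \<Rightarrow> nat \<Rightarrow> nat \<Rightarrow> real" where
  "moment w x y m n = (\<integral>k. (w \<bullet> orb k) * ((x \<bullet> orb k) ^ m * (y \<bullet> orb k) ^ n) \<partial>\<kappa>)"

definition moment0 :: "'a \<Rightarrow> 'a \<Rightarrow> nat \<Rightarrow> nat \<Rightarrow> real" where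
  "moment0 x y m n = (\<integral>k. (x \<bullet> orb k) ^ m * (y \<bullet> orb k) ^ n \<partial>\<kappa>)"

lemma moment_add: "moment (w + w') x y m n = moment w x y m n + moment w' x y m n"
  unfolding moment_def inner_add_left distrib_right
  by (rule Bochner_Integration.integral_add; rule haar_integrable) (auto intro!: continuous_intros)

lemma moment_scale: "moment (r *\<^sub>R w) x y m n = r * moment w x y m n"
  by (simp add: moment_def mult.assoc)

text \<open>The coefficients reassemble \<open>\<xi>\<close>, so the left side is
  [L(\<xi>), L(v)]\<xi>, which the orbit relations evaluate.\<close>

lemma sum_bracket_coordinates:
  assumes "\<xi> \<in> \<Xi>" "tr \<xi> = 1"
  shows "(\<Sum>b\<in>Basis. (b \<bullet> \<xi>) *\<^sub>R mult_bracket b v \<xi>) = (1/2) *\<^sub>R ((\<xi> \<bullet> v) *\<^sub>R \<xi> - v \<odot> \<xi>)"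
proof -
  have rep: "(\<Sum>b\<in>Basis. (b \<bullet> \<xi>) *\<^sub>R b) = \<xi>"
    using euclidean_representation[of \<xi>] by (simp add: inner_commute)
  have "(\<Sum>b\<in>Basis. (b \<bullet> \<xi>) *\<^sub>R mult_bracket b v \<xi>) =
    (\<Sum>b\<in>Basis. (b \<bullet> \<xi>) *\<^sub>R b) \<odot> (v \<odot> \<xi>) - v \<odot> ((\<Sum>b\<in>Basis. (b \<bullet> \<xi>) *\<^sub>R b) \<odot> \<xi>)"
    by (simp add: mult_bracket_apply prod.sum_left prod.sum_right prod_expand scaleR_diff_right sum_subtractf)
  also have "\<dots> = \<xi> \<odot> (\<xi> \<odot> v) - v \<odot> \<xi>"
    unfolding rep using orbit_square[OF prim assms(1)] assms(2) by (simp add: prod_commute[of v \<xi>])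
  also have "\<xi> \<odot> (\<xi> \<odot> v) = (1/2) *\<^sub>R ((\<xi> \<bullet> v) *\<^sub>R \<xi> + v \<odot> \<xi>)"
    using orbit_mult_mult[OF prim assms(1), of v] assms(2) by (simp add: prod_commute[of v \<xi>])
  also have "\<dots> - v \<odot> \<xi> = (1/2) *\<^sub>R ((\<xi> \<bullet> v) *\<^sub>R \<xi> - v \<odot> \<xi>)"
    by (rule half_eqI) (simp add: scaleR_diff_right scaleR_2)
  finally show ?thesis .
qed

text \<open>The two halves of the bracket are the Casimir identity at \<open>e\<close> and the trace
  of L(v)L(\<xi>); the term with 1 + (rk - 2) lam/2 occurs in both and cancels.\<close>

lemma sum_bracket_divergence:
  assumes "tr \<xi> = 1"
  shows "(\<Sum>b\<in>Basis. b \<bullet> mult_bracket b v \<xi>) = lam / 2 * (rk * (v \<bullet> \<xi>) - v \<bullet> e)"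
proof -
  have "(\<Sum>b\<in>Basis. b \<bullet> mult_bracket b v \<xi>) =
    (\<Sum>b\<in>Basis. b \<odot> (b \<odot> e)) \<bullet> (v \<odot> \<xi>) - (\<Sum>b\<in>Basis. (v \<odot> b) \<bullet> (\<xi> \<odot> b))"
    unfolding inner_sum_left sum_subtractf[symmetric]
  proof (intro sum.cong refl)
    fix b
    have "b \<bullet> (b \<odot> (v \<odot> \<xi>)) = (b \<odot> (b \<odot> e)) \<bullet> (v \<odot> \<xi>)"
      by (simp add: inner_assoc unit_right)
    moreover have "b \<bullet> (v \<odot> (b \<odot> \<xi>)) = (v \<odot> b) \<bullet> (\<xi> \<odot> b)"
      by (simp add: inner_assoc prod_commute[of \<xi> b])
    ultimately show "b \<bullet> mult_bracket b v \<xi> = (b \<odot> (b \<odot> e)) \<bullet> (v \<odot> \<xi>) - (v \<odot> b) \<bullet> (\<xi> \<odot> b)"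
      by (simp add: mult_bracket_apply inner_diff_right)
  qed
  also have "e \<bullet> (v \<odot> \<xi>) = v \<bullet> \<xi>"
    using inner_unit[of v \<xi>] by (simp add: inner_commute)
  then have "(\<Sum>b\<in>Basis. b \<odot> (b \<odot> e)) \<bullet> (v \<odot> \<xi>) = (1 + (rk - 2) * lam / 2 + lam / 2 * rk) * (v \<bullet> \<xi>)"
    unfolding casimir by (simp add: inner_add_left rank_inner[symmetric] algebra_simps)
  also have "(\<Sum>b\<in>Basis. (v \<odot> b) \<bullet> (\<xi> \<odot> b)) = (1 + (rk - 2) * lam / 2) * (v \<bullet> \<xi>) + lam / 2 * (v \<bullet> e)"
    unfolding trace_mult_mult using assms by (simp add: trace_inner)
  finally show ?thesis by (simp add: algebra_simps)
qed

text \<open>\<open>haar_derivation\<close> for the function (b|\<xi>) f(\<xi>) and the derivation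
  [L(b), L(v)], summed over \<open>b\<close>. The basis sums collapse to Euler's derivative of f,
  which yields m + n, the derivative along v\<xi>, and a divergence, which yields
  \<open>rk * lam\<close>.\<close>

lemma moment_identity:
  "(real (m + n) + rk * lam) * moment v x y m n =
   real m * moment (v \<odot> x) x y (m - 1) n + real n * moment (v \<odot> y) x y m (n - 1) + lam * (v \<bullet> e) * moment0 x y m n"
proof -
  define f where "f \<xi> = (x \<bullet> \<xi>) ^ m * (y \<bullet> \<xi>) ^ n" for \<xi>
  define f' where "f' \<xi> h = real m * ((x \<bullet> \<xi>) ^ (m - 1) * (y \<bullet> \<xi>) ^ n) * (x \<bullet> h)
     + real n * ((x \<bullet> \<xi>) ^ m * (y \<bullet> \<xi>) ^ (n - 1)) * (y \<bullet> h)" for \<xi> h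
  define G where "G b \<xi> = (b \<bullet> mult_bracket b v \<xi>) * f \<xi> + (b \<bullet> \<xi>) * f' \<xi> (mult_bracket b v \<xi>)" for b \<xi>
  have contb: "continuous_on UNIV (blinfun_apply (mult_bracket b v))" for b
    by (intro continuous_intros)
  have contG: "continuous_on UNIV (G b)" for b
    unfolding G_def f_def f'_def by (intro continuous_intros contb)
  have df: "(f has_derivative f' \<xi>) (at \<xi>)" for \<xi>
    unfolding f_def[abs_def] f'_def[abs_def]
    by (auto intro!: derivative_eq_intros simp: fun_eq_iff algebra_simps)
  have int0: "(\<integral>k. G b (orb k) \<partial>\<kappa>) = 0" for b
  proof -
    have d: "((\<lambda>\<xi>. (b \<bullet> \<xi>) * f \<xi>) has_derivative (\<lambda>h. (b \<bullet> \<xi>) * f' \<xi> h + (b \<bullet> h) * f \<xi>)) (at \<xi>)" for \<xi>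
      by (intro derivative_intros df)
    have c: "continuous_on UNIV (\<lambda>\<xi>. (b \<bullet> \<xi>) * f' \<xi> (mult_bracket b v \<xi>) + (b \<bullet> mult_bracket b v \<xi>) * f \<xi>)"
      using contG[of b] by (simp add: G_def add.commute)
    from haar_derivation[OF d c] show ?thesis by (simp add: G_def add.commute)
  qed
  \<comment> \<open>Twice the summed integrand; the two agree only at orbit points of trace 1, which
    is where \<open>orb\<close> takes its values.\<close>
  define R where "R \<xi> = (real (m + n) + rk * lam) * ((v \<bullet> \<xi>) * f \<xi>)
    - (real m * (((v \<odot> x) \<bullet> \<xi>) * ((x \<bullet> \<xi>) ^ (m - 1) * (y \<bullet> \<xi>) ^ n))
       + real n * (((v \<odot> y) \<bullet> \<xi>) * ((x \<bullet> \<xi>) ^ m * (y \<bullet> \<xi>) ^ (n - 1))) + lam * (v \<bullet> e) * f \<xi>)" for \<xi>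
  have pt: "2 * (\<Sum>b\<in>Basis. G b \<xi>) = R \<xi>" if \<xi>: "\<xi> \<in> \<Xi>" "tr \<xi> = 1" for \<xi>
  proof -
    have lin': "f' \<xi> (\<Sum>b\<in>Basis. g b) = (\<Sum>b\<in>Basis. f' \<xi> (g b))" "f' \<xi> (r *\<^sub>R h) = r * f' \<xi> h"
      "f' \<xi> (h - h') = f' \<xi> h - f' \<xi> h'" for g r h h'
      using has_derivative_linear[OF df[of \<xi>]] by (simp_all add: linear_sum linear_cmul linear_diff)
    have "(\<Sum>b\<in>Basis. G b \<xi>) = (\<Sum>b\<in>Basis. b \<bullet> mult_bracket b v \<xi>) * f \<xi>
       + f' \<xi> (\<Sum>b\<in>Basis. (b \<bullet> \<xi>) *\<^sub>R mult_bracket b v \<xi>)"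
      by (simp add: G_def sum.distrib sum_distrib_right lin')
    also have "\<dots> = lam / 2 * (rk * (v \<bullet> \<xi>) - v \<bullet> e) * f \<xi> + (1/2) * ((v \<bullet> \<xi>) * f' \<xi> \<xi> - f' \<xi> (v \<odot> \<xi>))"
      unfolding sum_bracket_coordinates[OF \<xi>] sum_bracket_divergence[OF \<xi>(2)] lin' by (simp add: inner_commute)
    finally have 1: "2 * (\<Sum>b\<in>Basis. G b \<xi>) = lam * (rk * (v \<bullet> \<xi>) - v \<bullet> e) * f \<xi> + ((v \<bullet> \<xi>) * f' \<xi> \<xi> - f' \<xi> (v \<odot> \<xi>))"
      by simp
    have 2: "f' \<xi> \<xi> = real (m + n) * f \<xi>"
      by (cases m; cases n) (simp_all add: f'_def f_def algebra_simps)
    have "x \<bullet> (v \<odot> \<xi>) = (v \<odot> x) \<bullet> \<xi>" "y \<bullet> (v \<odot> \<xi>) = (v \<odot> y) \<bullet> \<xi>" by (simp_all add: inner_assoc)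
    then have 3: "f' \<xi> (v \<odot> \<xi>) = real m * (((v \<odot> x) \<bullet> \<xi>) * ((x \<bullet> \<xi>) ^ (m - 1) * (y \<bullet> \<xi>) ^ n))
       + real n * (((v \<odot> y) \<bullet> \<xi>) * ((x \<bullet> \<xi>) ^ m * (y \<bullet> \<xi>) ^ (n - 1)))"
      by (simp add: f'_def mult_ac)
    show ?thesis unfolding 1 2 3 R_def by (simp add: algebra_simps)
  qed
  have "(\<integral>k. R (orb k) \<partial>\<kappa>) = (\<integral>k. 2 * (\<Sum>b\<in>Basis. G b (orb k)) \<partial>\<kappa>)"
    using pt K_orbit by (intro Bochner_Integration.integral_cong refl) (simp add: space_haar)
  also have "\<dots> = 2 * (\<Sum>b\<in>Basis. \<integral>k. G b (orb k) \<partial>\<kappa>)"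
    using haar_integrable[OF contG] by simp
  finally have "(\<integral>k. R (orb k) \<partial>\<kappa>) = 0" using int0 by simp
  moreover have "(\<integral>k. R (orb k) \<partial>\<kappa>) = (real (m + n) + rk * lam) * moment v x y m n -
     (real m * moment (v \<odot> x) x y (m - 1) n + real n * moment (v \<odot> y) x y m (n - 1) + lam * (v \<bullet> e) * moment0 x y m n)"
  proof -
    have i: "integrable \<kappa> (\<lambda>k. (w \<bullet> orb k) * ((x \<bullet> orb k) ^ m * (y \<bullet> orb k) ^ n))" for w m n
      by (rule haar_integrable) (intro continuous_intros)
    have i0: "integrable \<kappa> (\<lambda>k. (x \<bullet> orb k) ^ m * (y \<bullet> orb k) ^ n)" for m n
      by (rule haar_integrable) (intro continuous_intros)
    show ?thesis unfolding R_def f_def moment_def moment0_def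
      by (simp add: i i0 del: of_nat_add)
  qed
  ultimately show ?thesis by simp
qed

lemma moment_Suc1: "moment x x y m n = moment0 x y (Suc m) n"
  by (simp add: moment_def moment0_def mult.assoc)

lemma moment_Suc2: "moment y x y m n = moment0 x y m (Suc n)"
  by (simp add: moment_def moment0_def mult_ac)

text \<open>\<open>moment_identity\<close> with v equal to \<open>x\<close>, \<open>y\<close> and
  \<open>x \<odot> y\<close>. The relations xx = tr(x) x and \<open>orbit_mult_mult\<close> turn the
  new linear factors back into the two families of \<open>moment_recurrence\<close>.\<close>

lemma moments:
  assumes x: "x \<in> \<Xi>" and y: "y \<in> \<Xi>"
  shows "bessel_coeff lam m * bessel_coeff lam n * (pochhammer (rk * lam) (m + n) * moment0 x y m n) =
    kernel_coeff lam (tr x) (tr y) (x \<bullet> y) m n"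
proof (rule moment_recurrence[where A = "moment (x \<odot> y) x y", OF lam_pos])
  show "rk * lam > 0" using rank_pos lam_pos by simp
  show "moment0 x y 0 0 = 1" using emeasure_haar by (simp add: moment0_def space_haar measure_def)
  note xx = orbit_square[OF prim x] and yy = orbit_square[OF prim y]
  fix m n
  show "(real (m + n) + rk * lam) * moment0 x y (Suc m) n =
    (real m + lam) * tr x * moment0 x y m n + real n * moment (x \<odot> y) x y m (n - 1)"
  proof -
    have "real m * moment (x \<odot> x) x y (m - 1) n = real m * tr x * moment0 x y m n"
      by (cases m) (simp_all add: xx moment_scale moment_Suc1)
    then show ?thesis
      using moment_identity[of m n x x y] by (simp add: moment_Suc1 trace_inner algebra_simps)
  qed
  show "(real (m + n) + rk * lam) * moment0 x y m (Suc n) =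
    (real n + lam) * tr y * moment0 x y m n + real m * moment (x \<odot> y) x y (m - 1) n"
  proof -
    have "real n * moment (y \<odot> y) x y m (n - 1) = real n * tr y * moment0 x y m n"
      by (cases n) (simp_all add: yy moment_scale moment_Suc2)
    then show ?thesis
      using moment_identity[of m n y x y] by (simp add: moment_Suc2 trace_inner prod_commute[of y x] algebra_simps)
  qed
  show "(real (m + n) + rk * lam) * moment (x \<odot> y) x y m n =
    (real (m + n) / 2 + lam) * (x \<bullet> y) * moment0 x y m n +
     (real m * tr x * moment (x \<odot> y) x y (m - 1) n + real n * tr y * moment (x \<odot> y) x y m (n - 1)) / 2"
  proof -
    have "(x \<odot> y) \<odot> x = (1/2) *\<^sub>R ((x \<bullet> y) *\<^sub>R x + tr x *\<^sub>R (x \<odot> y))"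
      using orbit_mult_mult[OF prim x, of y] prod_commute[of x "x \<odot> y"] by simp
    then have 1: "real m * moment ((x \<odot> y) \<odot> x) x y (m - 1) n =
      real m * ((x \<bullet> y) * moment0 x y m n + tr x * moment (x \<odot> y) x y (m - 1) n) / 2"
      by (cases m) (simp_all add: moment_scale moment_add moment_Suc1)
    have "(x \<odot> y) \<odot> y = (1/2) *\<^sub>R ((x \<bullet> y) *\<^sub>R y + tr y *\<^sub>R (x \<odot> y))"
      using orbit_mult_mult[OF prim y, of x] prod_commute[of y "x \<odot> y"] by (simp add: prod_commute[of y x] inner_commute[of y x])
    then have 2: "real n * moment ((x \<odot> y) \<odot> y) x y m (n - 1) =
      real n * ((x \<bullet> y) * moment0 x y m n + tr y * moment (x \<odot> y) x y m (n - 1)) / 2"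
      by (cases n) (simp_all add: moment_scale moment_add moment_Suc2)
    have 3: "(x \<odot> y) \<bullet> e = x \<bullet> y" by (simp add: inner_unit[symmetric])
    show ?thesis
      using moment_identity[of m n "x \<odot> y" x y] unfolding 1 2 3 by (simp add: field_simps)
  qed
qed

end

section \<open>Integration on the orbit\<close>

lemma nn_integral_Gamma_scaled:
  fixes s :: real
  assumes s: "s > 0" and t: "\<tau> > 0"
  shows "(\<integral>\<^sup>+t. ennreal (indicator {0<..} t * (t powr (s - 1) * exp (- \<tau> * t))) \<partial>lborel) = ennreal (Gamma s / \<tau> powr s)"
proof -
  let ?I = "\<integral>\<^sup>+t. ennreal (indicator {0<..} t * (t powr (s - 1) * exp (- \<tau> * t))) \<partial>lborel"
  have "ennreal (Gamma s) = (\<integral>\<^sup>+t. ennreal (indicator {0..} t * t powr (s - 1) / exp t) \<partial>lborel)"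
    by (rule Gamma_conv_nn_integral_real[OF s])
  also have "\<dots> = ennreal \<bar>\<tau>\<bar> * (\<integral>\<^sup>+t. ennreal (indicator {0..} (0 + \<tau> * t) * (0 + \<tau> * t) powr (s - 1) / exp (0 + \<tau> * t)) \<partial>lborel)"
    using t by (intro nn_integral_real_affine) auto
  also have "(\<lambda>t. ennreal (indicator {0..} (0 + \<tau> * t) * (0 + \<tau> * t) powr (s - 1) / exp (0 + \<tau> * t))) =
    (\<lambda>t. ennreal (\<tau> powr (s - 1)) * ennreal (indicator {0<..} t * (t powr (s - 1) * exp (- \<tau> * t))))"
    using t by (auto simp: fun_eq_iff indicator_def powr_mult exp_minus divide_inverse zero_le_mult_iff
        ennreal_mult'[symmetric] mult_ac)
  also have "(\<integral>\<^sup>+t. ennreal (\<tau> powr (s - 1)) * ennreal (indicator {0<..} t * (t powr (s - 1) * exp (- \<tau> * t))) \<partial>lborel) =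
    ennreal (\<tau> powr (s - 1)) * ?I"
    by (rule nn_integral_cmult) simp
  also have "ennreal \<bar>\<tau>\<bar> * (ennreal (\<tau> powr (s - 1)) * ?I) = ennreal (\<tau> powr s) * ?I"
    using t by (simp add: mult.assoc[symmetric] ennreal_mult'[symmetric] powr_diff)
  finally have eq: "ennreal (\<tau> powr s) * ?I = ennreal (Gamma s)" by simp
  have "?I = ennreal (1 / \<tau> powr s) * (ennreal (\<tau> powr s) * ?I)"
    using t by (simp add: mult.assoc[symmetric] ennreal_mult'[symmetric])
  also have "\<dots> = ennreal (Gamma s / \<tau> powr s)"
    unfolding eq using t by (simp add: ennreal_mult'[symmetric])
  finally show ?thesis .
qed

lemma (in pair_sigma_finite) has_bochner_integral_mult:
  fixes f :: "'a \<Rightarrow> real" and g :: "'b \<Rightarrow> real"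
  assumes f: "has_bochner_integral M1 f I" and g: "has_bochner_integral M2 g J"
  shows "has_bochner_integral (M1 \<Otimes>\<^sub>M M2) (\<lambda>z. f (fst z) * g (snd z)) (I * J)"
proof -
  have fi: "integrable M1 f" "integral\<^sup>L M1 f = I" and gi: "integrable M2 g" "integral\<^sup>L M2 g = J"
    using f g by (auto simp: has_bochner_integral_iff)
  have [measurable]: "f \<in> borel_measurable M1" "g \<in> borel_measurable M2" using fi gi by auto
  have int: "integrable (M1 \<Otimes>\<^sub>M M2) (\<lambda>z. f (fst z) * g (snd z))"
    by (rule Fubini_integrable) (use fi gi in \<open>auto simp: abs_mult\<close>)
  from integral_fst'[OF int] have "integral\<^sup>L (M1 \<Otimes>\<^sub>M M2) (\<lambda>z. f (fst z) * g (snd z)) = I * J"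
    using fi gi by simp
  with int show ?thesis by (simp add: has_bochner_integral_iff)
qed

section \<open>Radial and polar integration\<close>

context bessel_orbit
begin

definition radial_measure :: "real measure" where
  "radial_measure = density (restrict_space lborel {0<..})
     (\<lambda>t. ennreal (2 powr (rk * lam) / Gamma (rk * lam) * t powr (rk * lam - 1)))"

abbreviation "polar_measure \<equiv> \<kappa> \<Otimes>\<^sub>M radial_measure"
abbreviation "\<mu> \<equiv> orbit_measure (\<odot>) e lam c\<^sub>1 \<kappa>"

lemma orbit_measure_eq:
  "\<mu> = distr polar_measure (restrict_space borel \<Xi>) (\<lambda>(k, t). blinfun_apply k (t *\<^sub>R c\<^sub>1))"
  by (simp add: orbit_measure_def radial_measure_def Let_def)

lemma rank_lam_pos: "rk * lam > 0"
  using rank_pos lam_pos by simp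

lemma radial_density_measurable:
  "(\<lambda>t. ennreal (2 powr (rk * lam) / Gamma (rk * lam) * t powr (rk * lam - 1)))
     \<in> borel_measurable (restrict_space lborel {0<..})"
  by (rule measurable_restrict_space1) simp

lemma space_radial: "space radial_measure = {0<..}"
  by (simp add: radial_measure_def space_restrict_space)

lemma radial_measurable:
  assumes "f \<in> borel_measurable borel"
  shows "f \<in> borel_measurable radial_measure"
proof -
  have "f \<in> borel_measurable lborel" using assms by simp
  then have "f \<in> borel_measurable (restrict_space lborel {0<..})" by (rule measurable_restrict_space1)
  then show ?thesis by (simp add: radial_measure_def)
qed

lemma sigma_finite_radial: "sigma_finite_measure radial_measure"
proof -
  interpret R: sigma_finite_measure "restrict_space lborel {0<..} :: real measure"
    by (rule sigma_finite_measure_restrict_space) (auto intro: lborel.sigma_finite_measure_axioms)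
  show ?thesis
    unfolding radial_measure_def using R.sigma_finite_iff_density_finite[OF radial_density_measurable] by simp
qed

sublocale radial: sigma_finite_measure radial_measure by (rule sigma_finite_radial)
sublocale polar: pair_sigma_finite \<kappa> radial_measure ..

text \<open>The Pochhammer factor is Gamma(q + N)/Gamma(q) with q = \<open>rk * lam\<close>; it
  cancels the denominator in \<open>haar_graded_sum\<close>.\<close>

lemma radial_integral:
  assumes t: "\<tau> > 0"
  shows "has_bochner_integral radial_measure (\<lambda>t. t ^ N * exp (- \<tau> * t))
    ((2 / \<tau>) powr (rk * lam) * (pochhammer (rk * lam) N / \<tau> ^ N))"
proof -
  define q where "q = rk * lam"
  have q: "q > 0" using rank_lam_pos by (simp add: q_def)
  define V where "V = 2 powr q / Gamma q * (Gamma (q + real N) / \<tau> powr (q + real N))"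
  have Gq: "Gamma q > 0" using q by (rule Gamma_real_pos)
  have V0: "V \<ge> 0" using q t by (simp add: V_def Gamma_real_nonneg)
  have "(\<integral>\<^sup>+t. ennreal (t ^ N * exp (- \<tau> * t)) \<partial>radial_measure) =
    (\<integral>\<^sup>+t. ennreal (2 powr q / Gamma q * t powr (q - 1)) * ennreal (t ^ N * exp (- \<tau> * t)) \<partial>restrict_space lborel {0<..})"
    unfolding radial_measure_def q_def
    by (rule nn_integral_density[OF radial_density_measurable]) (rule measurable_restrict_space1, simp)
  also have "\<dots> = (\<integral>\<^sup>+t. ennreal (2 powr q / Gamma q * t powr (q - 1)) * ennreal (t ^ N * exp (- \<tau> * t)) * indicator {0<..} t \<partial>lborel)"
    by (rule nn_integral_restrict_space) simp
  also have "\<dots> = (\<integral>\<^sup>+t. ennreal (2 powr q / Gamma q) * ennreal (indicator {0<..} t * (t powr (q + real N - 1) * exp (- \<tau> * t))) \<partial>lborel)"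
  proof (rule nn_integral_cong)
    fix t :: real
    show "ennreal (2 powr q / Gamma q * t powr (q - 1)) * ennreal (t ^ N * exp (- \<tau> * t)) * indicator {0<..} t =
      ennreal (2 powr q / Gamma q) * ennreal (indicator {0<..} t * (t powr (q + real N - 1) * exp (- \<tau> * t)))"
    proof (cases "t > 0")
      case True
      then have "t powr (q + real N - 1) = t powr (q - 1) * t ^ N"
        by (simp add: powr_add[symmetric] powr_realpow[symmetric] algebra_simps)
      then show ?thesis using True Gq by (simp add: ennreal_mult'[symmetric] mult_ac)
    qed simp
  qed
  also have "\<dots> = ennreal (2 powr q / Gamma q) * (\<integral>\<^sup>+t. ennreal (indicator {0<..} t * (t powr (q + real N - 1) * exp (- \<tau> * t))) \<partial>lborel)"
    by (rule nn_integral_cmult) simp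
  also have "\<dots> = ennreal V"
    using nn_integral_Gamma_scaled[of "q + real N" \<tau>] q t Gq
    by (simp add: V_def ennreal_mult'[symmetric])
  finally have nn: "(\<integral>\<^sup>+t. ennreal (t ^ N * exp (- \<tau> * t)) \<partial>radial_measure) = ennreal V" .
  have "has_bochner_integral radial_measure (\<lambda>t. t ^ N * exp (- \<tau> * t)) V"
  proof (rule has_bochner_integral_nn_integral)
    show "(\<lambda>t. t ^ N * exp (- \<tau> * t)) \<in> borel_measurable radial_measure"
      by (rule radial_measurable) simp
    show "AE t in radial_measure. 0 \<le> t ^ N * exp (- \<tau> * t)"
      by (rule AE_I2) (simp add: space_radial)
  qed (use nn V0 in auto)
  moreover have "V = (2 / \<tau>) powr q * (pochhammer q N / \<tau> ^ N)"
  proof -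
    have "q \<notin> \<int>\<^sub>\<le>\<^sub>0" using q by (auto elim!: nonpos_Ints_cases)
    then have "pochhammer q N = Gamma (q + real N) / Gamma q" by (rule pochhammer_Gamma)
    then show ?thesis using t Gq by (simp add: V_def powr_add powr_realpow powr_divide)
  qed
  ultimately show ?thesis by (simp add: q_def)
qed

lemma haar_graded_sum:
  assumes x: "x \<in> \<Xi>" and y: "y \<in> \<Xi>"
  shows "has_bochner_integral \<kappa>
    (\<lambda>k. graded_sum (bessel_product_coeff lam) (p * (x \<bullet> orb k)) (r * (y \<bullet> orb k)) N)
    (graded_sum (kernel_coeff lam (tr x) (tr y) (x \<bullet> y)) p r N / pochhammer (rk * lam) N)"
proof -
  let ?c = "bessel_coeff lam"
  have q: "pochhammer (rk * lam) N > 0" using rank_lam_pos by (rule pochhammer_pos)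
  have "has_bochner_integral \<kappa> (\<lambda>k. (x \<bullet> orb k) ^ m * (y \<bullet> orb k) ^ n) (moment0 x y m n)" for m n
    unfolding has_bochner_integral_iff moment0_def by (auto intro!: haar_integrable continuous_intros)
  then have "has_bochner_integral \<kappa>
      (\<lambda>k. \<Sum>m\<le>N. (p ^ m * r ^ (N - m) * (?c m * ?c (N - m))) * ((x \<bullet> orb k) ^ m * (y \<bullet> orb k) ^ (N - m)))
      (\<Sum>m\<le>N. (p ^ m * r ^ (N - m) * (?c m * ?c (N - m))) * moment0 x y m (N - m))"
    by (intro has_bochner_integral_sum has_bochner_integral_mult_right)
  moreover have "p ^ m * r ^ (N - m) * (?c m * ?c (N - m)) * moment0 x y m (N - m) =
      p ^ m * r ^ (N - m) * kernel_coeff lam (tr x) (tr y) (x \<bullet> y) m (N - m) / pochhammer (rk * lam) N"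
    if "m \<le> N" for m
    using moments[OF x y, of m "N - m"] that q by (simp add: field_simps)
  ultimately show ?thesis by (simp add: graded_sum_def power_mult_distrib sum_divide_distrib mult_ac)
qed

text \<open>The part of degree N of the Bessel product is a function of k times t^N, so it
  integrates as a product. Termwise integration is justified by the majorant \<open>Db\<close>,
  based on |(x|k c)| \<le> norm x = tr x. The integrated terms form the series of
  \<open>kernel_coeff_sums\<close> at p/\<tau> and r/\<tau>.\<close>

lemma polar_integral:
  assumes x: "x \<in> \<Xi>" and y: "y \<in> \<Xi>" and t: "\<tau> > 0"
  shows "has_bochner_integral polar_measure
    (\<lambda>z. exp (- \<tau> * snd z) * (bessel_B lam (p * (snd z * (x \<bullet> orb (fst z)))) *
       bessel_B lam (r * (snd z * (y \<bullet> orb (fst z))))))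
    ((2 / \<tau>) powr (rk * lam) * (exp ((p * tr x + r * tr y) / \<tau>) * bessel_B lam (p * r * (x \<bullet> y) / \<tau>\<^sup>2)))"
proof -
  let ?M = "polar_measure" and ?w = "bessel_product_coeff lam"
    and ?S = "kernel_coeff lam (tr x) (tr y) (x \<bullet> y)"
  define q where "q = rk * lam"
  have q: "q > 0" using rank_lam_pos by (simp add: q_def)
  define D where "D N k = graded_sum ?w (p * (x \<bullet> orb k)) (r * (y \<bullet> orb k)) N" for N k
  define Db where "Db = graded_sum ?w (\<bar>p\<bar> * tr x) (\<bar>r\<bar> * tr y)"
  define f where "f N z = D N (fst z) * (snd z ^ N * exp (- \<tau> * snd z))" for N z
  define \<rho> where "\<rho> N = (2 / \<tau>) powr q * (pochhammer q N / \<tau> ^ N)" for N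
  have trx: "tr x > 0" "tr y > 0" using orbit_trace_pos[OF prim] x y by auto
  have radial: "has_bochner_integral radial_measure (\<lambda>t. t ^ N * exp (- \<tau> * t)) (\<rho> N)" for N
    unfolding \<rho>_def q_def by (rule radial_integral[OF t])
  have fN: "has_bochner_integral ?M (f N) (graded_sum ?S p r N / pochhammer q N * \<rho> N)" for N
    unfolding f_def D_def q_def by (rule polar.has_bochner_integral_mult[OF haar_graded_sum[OF x y] radial])
  have integrable_f: "integrable ?M (f N)" for N
    using fN by (simp add: has_bochner_integral_iff)
  have bound: "\<bar>D N k\<bar> \<le> Db N" if "k \<in> K" for k N
    unfolding D_def Db_def
  proof (rule graded_sum_bound)
    have "\<bar>x \<bullet> orb k\<bar> \<le> tr x" "\<bar>y \<bullet> orb k\<bar> \<le> tr y"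
      using Cauchy_Schwarz_ineq2[of x "orb k"] Cauchy_Schwarz_ineq2[of y "orb k"]
        orbit_norm[OF prim x] orbit_norm[OF prim y] K_orbit(3)[OF that] by simp_all
    then show "\<bar>p * (x \<bullet> orb k)\<bar> \<le> \<bar>p\<bar> * tr x" "\<bar>r * (y \<bullet> orb k)\<bar> \<le> \<bar>r\<bar> * tr y"
      by (simp_all add: abs_mult mult_left_mono)
  qed (simp add: bessel_coeff_nonneg[OF lam_pos])
  have fsum: "(\<lambda>N. f N z) sums (exp (- \<tau> * snd z) * (bessel_B lam (p * (snd z * (x \<bullet> orb (fst z)))) *
       bessel_B lam (r * (snd z * (y \<bullet> orb (fst z))))))" for z
  proof -
    have "f N z = exp (- \<tau> * snd z) * graded_sum ?w (snd z * (p * (x \<bullet> orb (fst z))))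
      (snd z * (r * (y \<bullet> orb (fst z)))) N" for N
      unfolding graded_sum_scale by (simp add: f_def D_def mult_ac)
    then show ?thesis
      using sums_mult[OF bessel_product_sums[OF lam_pos]] by (simp add: mult.left_commute)
  qed
  have le_f: "\<bar>f N z\<bar> \<le> Db N * (snd z ^ N * exp (- \<tau> * snd z))" if "z \<in> space ?M" for N z
    using bound[of "fst z" N] that
    by (auto simp: f_def abs_mult mult_right_mono space_pair_measure space_haar space_radial)
  have AE_sum: "AE z in ?M. summable (\<lambda>N. norm (f N z))"
  proof (rule AE_I2)
    fix z assume z: "z \<in> space ?M"
    have "summable (\<lambda>N. graded_sum ?w (snd z * (\<bar>p\<bar> * tr x)) (snd z * (\<bar>r\<bar> * tr y)) N * exp (- \<tau> * snd z))"
      by (intro summable_mult2 sums_summable[OF bessel_product_sums[OF lam_pos]])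
    then have "summable (\<lambda>N. Db N * (snd z ^ N * exp (- \<tau> * snd z)))"
      unfolding graded_sum_scale Db_def by (simp only: mult_ac)
    then show "summable (\<lambda>N. norm (f N z))"
      by (rule summable_comparison_test'[where N = 0]) (use le_f[OF z] in simp)
  qed
  have sum_int: "summable (\<lambda>N. \<integral>z. norm (f N z) \<partial>?M)"
  proof (rule summable_comparison_test')
    have "summable (\<lambda>N. (2 / \<tau>) powr q * (Db N * (pochhammer q N / \<tau> ^ N)))"
      unfolding Db_def using trx by (intro summable_mult summable_bessel_product_bound lam_pos q t) auto
    then show "summable (\<lambda>N. Db N * \<rho> N)" by (simp add: \<rho>_def mult_ac)
    fix N
    have "has_bochner_integral \<kappa> (\<lambda>_. Db N) (Db N)"
      using emeasure_haar by (simp add: has_bochner_integral_iff space_haar measure_def)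
    from polar.has_bochner_integral_mult[OF this radial]
    have g: "integrable ?M (\<lambda>z. Db N * (snd z ^ N * exp (- \<tau> * snd z)))"
      "(\<integral>z. Db N * (snd z ^ N * exp (- \<tau> * snd z)) \<partial>?M) = Db N * \<rho> N"
      unfolding has_bochner_integral_iff by blast+
    have "(\<integral>z. norm (f N z) \<partial>?M) \<le> Db N * \<rho> N"
      unfolding g(2)[symmetric] by (rule integral_mono[OF integrable_norm[OF integrable_f] g(1)]) (use le_f in simp)
    then show "norm (\<integral>z. norm (f N z) \<partial>?M) \<le> Db N * \<rho> N" by simp
  qed
  note main = integrable_suminf[OF integrable_f AE_sum sum_int] sums_integral[OF integrable_f AE_sum sum_int]
  have "graded_sum ?S p r N / pochhammer q N * \<rho> N = (2 / \<tau>) powr q * graded_sum ?S (1 / \<tau> * p) (1 / \<tau> * r) N" for N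
    unfolding graded_sum_scale using pochhammer_pos[OF q, of N] by (simp add: \<rho>_def power_one_over)
  then have "(\<lambda>N. (2 / \<tau>) powr q * graded_sum ?S (1 / \<tau> * p) (1 / \<tau> * r) N) sums (\<integral>z. (\<Sum>N. f N z) \<partial>?M)"
    using main(2) fN by (simp add: has_bochner_integral_iff)
  moreover have "(\<lambda>N. (2 / \<tau>) powr q * graded_sum ?S (1 / \<tau> * p) (1 / \<tau> * r) N) sums
    ((2 / \<tau>) powr q * (exp (tr x * (1 / \<tau> * p) + tr y * (1 / \<tau> * r)) * bessel_B lam (1 / \<tau> * p * (1 / \<tau> * r) * (x \<bullet> y))))"
    by (intro sums_mult kernel_coeff_sums lam_pos)
  ultimately have "(\<integral>z. (\<Sum>N. f N z) \<partial>?M) =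
    (2 / \<tau>) powr q * (exp (tr x * (1 / \<tau> * p) + tr y * (1 / \<tau> * r)) * bessel_B lam (1 / \<tau> * p * (1 / \<tau> * r) * (x \<bullet> y)))"
    by (rule sums_unique2)
  then show ?thesis
    using main(1) sums_unique[OF fsum, symmetric]
    by (simp add: has_bochner_integral_iff q_def add_divide_distrib power2_eq_square mult_ac)
qed

lemma polar_measurable:
  "(\<lambda>(k, t). blinfun_apply k (t *\<^sub>R c\<^sub>1)) \<in> polar_measure \<rightarrow>\<^sub>M restrict_space borel \<Xi>"
proof (rule measurable_restrict_space2)
  show "(\<lambda>(k, t). blinfun_apply k (t *\<^sub>R c\<^sub>1)) \<in> space polar_measure \<rightarrow> \<Xi>"
    using min_orbit_scale K_orbit
    by (auto simp: space_pair_measure space_haar space_radial blinfun.scaleR_right)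
  have [measurable]: "(\<lambda>k. orb k) \<in> borel_measurable \<kappa>"
    using haar_measurable_orbit[of "\<lambda>v. v"] by simp
  have [measurable]: "(\<lambda>t. t) \<in> borel_measurable radial_measure"
    by (rule radial_measurable) simp
  have "(\<lambda>z. snd z *\<^sub>R orb (fst z)) \<in> borel_measurable polar_measure"
    by measurable
  then show "(\<lambda>(k, t). blinfun_apply k (t *\<^sub>R c\<^sub>1)) \<in> borel_measurable polar_measure"
    by (simp add: split_beta' blinfun.scaleR_right)
qed

lemma orbit_integral:
  assumes x: "x \<in> \<Xi>" and y: "y \<in> \<Xi>" and t: "\<tau> > 0"
  shows "has_bochner_integral \<mu> (\<lambda>\<xi>. exp (- \<tau> * tr \<xi>) * (bessel_B lam (p * (x \<bullet> \<xi>)) * bessel_B lam (r * (y \<bullet> \<xi>))))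
    ((2 / \<tau>) powr (rk * lam) * (exp ((p * tr x + r * tr y) / \<tau>) * bessel_B lam (p * r * (x \<bullet> y) / \<tau>\<^sup>2)))"
proof -
  let ?f = "\<lambda>\<xi>. exp (- \<tau> * tr \<xi>) * (bessel_B lam (p * (x \<bullet> \<xi>)) * bessel_B lam (r * (y \<bullet> \<xi>)))"
  let ?T = "\<lambda>(k, t). blinfun_apply k (t *\<^sub>R c\<^sub>1)"
  have "continuous_on UNIV ?f"
    unfolding trace_inner
    by (intro continuous_intros continuous_on_compose2[OF continuous_on_bessel(1)[OF lam_pos, of UNIV]]) auto
  then have f: "?f \<in> borel_measurable (restrict_space borel \<Xi>)"
    by (intro measurable_restrict_space1 borel_measurable_continuous_onI)
  have "?f (?T z) = exp (- \<tau> * snd z) * (bessel_B lam (p * (snd z * (x \<bullet> orb (fst z)))) *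
       bessel_B lam (r * (snd z * (y \<bullet> orb (fst z)))))"
    if "z \<in> space polar_measure" for z
  proof -
    have "fst z \<in> K" using that by (auto simp: space_pair_measure space_haar)
    then have "orb (fst z) \<bullet> e = 1" using K_orbit(2) by (simp add: trace_inner)
    then show ?thesis by (simp add: split_beta blinfun.scaleR_right trace_inner)
  qed
  then have "has_bochner_integral polar_measure (\<lambda>z. ?f (?T z))
    ((2 / \<tau>) powr (rk * lam) * (exp ((p * tr x + r * tr y) / \<tau>) * bessel_B lam (p * r * (x \<bullet> y) / \<tau>\<^sup>2)))"
    using polar_integral[OF x y t, of p r] by (subst has_bochner_integral_cong[OF refl _ refl]) auto
  then show ?thesis
    using integrable_distr_eq[OF polar_measurable f] integral_distr[OF polar_measurable f]
    by (simp add: has_bochner_integral_iff orbit_measure_eq)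
qed

end

section \<open>The Bessel operator on the orbit\<close>

lemma linear_expand:
  fixes f :: "'b::euclidean_space \<Rightarrow> real"
  assumes "linear f"
  shows "f v = (\<Sum>b\<in>Basis. f b * (v \<bullet> b))"
proof -
  have "f v = f (\<Sum>b\<in>Basis. (v \<bullet> b) *\<^sub>R b)" by (simp add: euclidean_representation)
  also have "\<dots> = (\<Sum>b\<in>Basis. f b * (v \<bullet> b))"
    using assms by (simp add: linear_sum linear_cmul mult.commute)
  finally show ?thesis .
qed

abbreviation partial_deriv :: "('b::euclidean_space \<Rightarrow> real) \<Rightarrow> 'b \<Rightarrow> 'b \<Rightarrow> real" where
  "partial_deriv F b \<equiv> \<lambda>z. frechet_derivative F (at z) b"

abbreviation hessian :: "('b::euclidean_space \<Rightarrow> real) \<Rightarrow> 'b \<Rightarrow> 'b \<Rightarrow> 'b \<Rightarrow> real" where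
  "hessian F x a b \<equiv> frechet_derivative (partial_deriv F b) (at x) a"

text \<open>The curve has velocity X\<gamma> and acceleration X(X\<gamma>). The first-order formula
  is established on a neighbourhood of 0, since it has to be differentiated again.\<close>

lemma derivatives_along_exp_curve:
  fixes F :: "'b::euclidean_space \<Rightarrow> real" and X :: "'b \<Rightarrow>\<^sub>L 'b"
  assumes U: "open U" "x \<in> U" and C2: "C2_on U F"
  defines "\<phi> \<equiv> \<lambda>s. F (blinfun_exp X s x)"
  shows "deriv \<phi> 0 = (\<Sum>b\<in>Basis. partial_deriv F b x * (X x \<bullet> b))"
    and "deriv (deriv \<phi>) 0 = (\<Sum>a\<in>Basis. \<Sum>b\<in>Basis. hessian F x a b * (X x \<bullet> a) * (X x \<bullet> b))
       + (\<Sum>b\<in>Basis. partial_deriv F b x * (X (X x) \<bullet> b))"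
proof -
  define \<gamma> where "\<gamma> s = blinfun_exp X s x" for s
  have \<gamma>0: "\<gamma> 0 = x" by (simp add: \<gamma>_def)
  have d\<gamma>: "(\<gamma> has_derivative (\<lambda>h. h *\<^sub>R X (\<gamma> s))) (at s)" for s
    using blinfun_exp_apply_has_vector_derivative[of X x s] by (simp add: \<gamma>_def[abs_def] has_vector_derivative_def)
  have chain: "((\<lambda>s. G (\<gamma> s)) has_real_derivative (\<Sum>a\<in>Basis. frechet_derivative G (at (\<gamma> s)) a * (X (\<gamma> s) \<bullet> a))) (at s)"
    if "G differentiable at (\<gamma> s)" for G :: "'b \<Rightarrow> real" and s
  proof -
    have G: "(G has_derivative frechet_derivative G (at (\<gamma> s))) (at (\<gamma> s))"
      using that by (simp add: frechet_derivative_works)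
    have lin: "linear (frechet_derivative G (at (\<gamma> s)))" by (rule has_derivative_linear[OF G])
    have "((\<lambda>s. G (\<gamma> s)) has_derivative (\<lambda>h. frechet_derivative G (at (\<gamma> s)) (h *\<^sub>R X (\<gamma> s)))) (at s)"
      by (rule has_derivative_compose[OF d\<gamma> G])
    moreover have "frechet_derivative G (at (\<gamma> s)) (h *\<^sub>R X (\<gamma> s)) =
      (\<Sum>a\<in>Basis. frechet_derivative G (at (\<gamma> s)) a * (X (\<gamma> s) \<bullet> a)) * h" for h
      using linear_cmul[OF lin, of h "X (\<gamma> s)"] linear_expand[OF lin, of "X (\<gamma> s)"] by simp
    ultimately show ?thesis by (simp add: has_field_derivative_def fun_eq_iff)
  qed
  define \<phi>' where "\<phi>' s = (\<Sum>b\<in>Basis. partial_deriv F b (\<gamma> s) * (X (\<gamma> s) \<bullet> b))" for s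
  have "open (\<gamma> -` U)"
    unfolding \<gamma>_def using U by (intro open_vimage continuous_intros continuous_on_blinfun_exp)
  moreover have "0 \<in> \<gamma> -` U" using U \<gamma>0 by simp
  ultimately have "eventually (\<lambda>s. s \<in> \<gamma> -` U) (nhds 0)" by (rule eventually_nhds_in_open)
  then have "eventually (\<lambda>s. \<gamma> s \<in> U) (nhds 0)" by simp
  then have ev: "eventually (\<lambda>s. deriv \<phi> s = \<phi>' s) (nhds 0)"
  proof (rule eventually_mono)
    fix s assume "\<gamma> s \<in> U"
    then have "(\<phi> has_real_derivative \<phi>' s) (at s)"
      using chain[of F s] C2 by (simp add: \<phi>_def \<phi>'_def \<gamma>_def[symmetric] C2_on_def)
    then show "deriv \<phi> s = \<phi>' s" by (rule DERIV_imp_deriv)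
  qed
  show "deriv \<phi> 0 = (\<Sum>b\<in>Basis. partial_deriv F b x * (X x \<bullet> b))"
    using eventually_nhds_x_imp_x[OF ev] by (simp add: \<phi>'_def \<gamma>0)
  have "(\<phi>' has_real_derivative (\<Sum>b\<in>Basis. (\<Sum>a\<in>Basis. hessian F x a b * (X x \<bullet> a)) * (X x \<bullet> b)
     + partial_deriv F b x * (X (X x) \<bullet> b))) (at 0)"
    unfolding \<phi>'_def
  proof (rule DERIV_sum)
    fix b :: 'b assume "b \<in> Basis"
    then have "partial_deriv F b differentiable at (\<gamma> 0)" using C2 U by (simp add: C2_on_def \<gamma>0)
    from chain[OF this] have 1: "((\<lambda>s. partial_deriv F b (\<gamma> s)) has_real_derivative (\<Sum>a\<in>Basis. hessian F x a b * (X x \<bullet> a))) (at 0)"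
      by (simp add: \<gamma>0)
    have "((\<lambda>s. X (\<gamma> s) \<bullet> b) has_derivative (\<lambda>h. X (h *\<^sub>R X (\<gamma> 0)) \<bullet> b)) (at 0)"
      by (intro has_derivative_inner_left bounded_linear.has_derivative[OF blinfun.bounded_linear_right] d\<gamma>)
    then have 2: "((\<lambda>s. X (\<gamma> s) \<bullet> b) has_real_derivative X (X x) \<bullet> b) (at 0)"
      by (simp add: has_field_derivative_def \<gamma>0 blinfun.scaleR_right mult_commute_abs)
    show "((\<lambda>s. partial_deriv F b (\<gamma> s) * (X (\<gamma> s) \<bullet> b)) has_real_derivative
      (\<Sum>a\<in>Basis. hessian F x a b * (X x \<bullet> a)) * (X x \<bullet> b) + partial_deriv F b x * (X (X x) \<bullet> b)) (at 0)"
      using DERIV_mult[OF 1 2] by (simp add: \<gamma>0 mult.commute add.commute)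
  qed
  then have "deriv \<phi>' 0 = (\<Sum>b\<in>Basis. (\<Sum>a\<in>Basis. hessian F x a b * (X x \<bullet> a)) * (X x \<bullet> b)
     + partial_deriv F b x * (X (X x) \<bullet> b))" by (rule DERIV_imp_deriv)
  also have "\<dots> = (\<Sum>a\<in>Basis. \<Sum>b\<in>Basis. hessian F x a b * (X x \<bullet> a) * (X x \<bullet> b))
       + (\<Sum>b\<in>Basis. partial_deriv F b x * (X (X x) \<bullet> b))"
    unfolding sum.distrib sum_distrib_right by (subst sum.swap) (rule refl)
  finally show "deriv (deriv \<phi>) 0 = \<dots>"
    using deriv_cong_ev[OF ev refl] by simp
qed

context bessel_setting
begin

text \<open>By associativity of the inner product, each of the three terms of P(a, b)x pairs with
  \<open>e\<close> to (xa|b), and the signs leave one.\<close>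

lemma unit_bessel_operator:
  "e \<bullet> bessel_operator (\<odot>) lam F x =
    (\<Sum>a\<in>Basis. \<Sum>b\<in>Basis. hessian F x a b * ((x \<odot> a) \<bullet> b)) + lam * (\<Sum>b\<in>Basis. partial_deriv F b x * (e \<bullet> b))"
proof -
  have "e \<bullet> \<P> a b x = (x \<odot> a) \<bullet> b" for a b
  proof -
    have "e \<bullet> (a \<odot> (b \<odot> x)) = (x \<odot> a) \<bullet> b"
      by (metis inner_assoc' inner_commute prod_commute unit_right)
    moreover have "e \<bullet> (b \<odot> (a \<odot> x)) = (x \<odot> a) \<bullet> b"
      by (metis inner_assoc' inner_commute prod_commute unit_right)
    moreover have "e \<bullet> ((a \<odot> b) \<odot> x) = (x \<odot> a) \<bullet> b"
      by (metis inner_assoc inner_assoc' inner_commute prod_commute unit_right)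
    ultimately show ?thesis by (simp add: jordan_P_def inner_add_right inner_diff_right)
  qed
  then show ?thesis by (simp add: bessel_operator_def inner_add_right inner_sum_right)
qed

text \<open>The right-hand side only involves the values of \<open>F\<close> along curves in the orbit, so this
  identity is what makes the operator tangential.\<close>

lemma bessel_operator_tangential:
  assumes c: "primitive c" "x \<in> orbit c" and U: "open U" "x \<in> U" and C2: "C2_on U F"
  shows "tr x / 2 * (e \<bullet> bessel_operator (\<odot>) lam F x) =
    (\<Sum>u\<in>Basis. deriv (deriv (\<lambda>s. F (blinfun_exp (mult_op u) s x))) 0)
    - deriv (deriv (\<lambda>s. F (blinfun_exp (mult_op e) s x))) 0 / 2
    - (1/2 + (rk - 2) * lam / 2) * deriv (\<lambda>s. F (blinfun_exp (mult_op e) s x)) 0"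
proof -
  note D = derivatives_along_exp_curve[OF U C2]
  let ?H = "hessian F x" and ?d = "\<lambda>b. partial_deriv F b x"
  define Hx where "Hx = (\<Sum>a\<in>Basis. \<Sum>b\<in>Basis. ?H a b * (x \<bullet> a) * (x \<bullet> b))"
  define HL where "HL = (\<Sum>a\<in>Basis. \<Sum>b\<in>Basis. ?H a b * ((x \<odot> a) \<bullet> b))"
  define dx where "dx = (\<Sum>b\<in>Basis. ?d b * (x \<bullet> b))"
  define de where "de = (\<Sum>b\<in>Basis. ?d b * (e \<bullet> b))"
  \<comment> \<open>The contraction over the basis is (xa|xb). The orbit relation splits it into a
    rank-one part and the symbol (xa|b) of the operator.\<close>
  have sumu: "(\<Sum>u\<in>Basis. ((u \<odot> x) \<bullet> a) * ((u \<odot> x) \<bullet> b)) = ((x \<bullet> a) * (x \<bullet> b) + tr x * ((x \<odot> a) \<bullet> b)) / 2" for a b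
  proof -
    have "(\<Sum>u\<in>Basis. ((u \<odot> x) \<bullet> a) * ((u \<odot> x) \<bullet> b)) = (\<Sum>u\<in>Basis. ((x \<odot> a) \<bullet> u) * ((x \<odot> b) \<bullet> u))"
      by (intro sum.cong refl) (metis inner_assoc inner_commute prod_commute)
    also have "\<dots> = (x \<odot> a) \<bullet> (x \<odot> b)" by (simp add: euclidean_inner[symmetric])
    also have "\<dots> = (x \<odot> (x \<odot> a)) \<bullet> b" by (simp add: inner_assoc)
    finally show ?thesis unfolding orbit_mult_mult[OF c] by (simp add: inner_add_left mult_ac)
  qed
  have "(\<Sum>u\<in>Basis. deriv (deriv (\<lambda>s. F (blinfun_exp (mult_op u) s x))) 0) =
    (\<Sum>u\<in>Basis. \<Sum>a\<in>Basis. \<Sum>b\<in>Basis. ?H a b * (((u \<odot> x) \<bullet> a) * ((u \<odot> x) \<bullet> b))) +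
    (\<Sum>u\<in>Basis. \<Sum>b\<in>Basis. ?d b * ((u \<odot> (u \<odot> x)) \<bullet> b))"
    unfolding D(2) by (simp add: sum.distrib mult.assoc)
  also have "(\<Sum>u\<in>Basis. \<Sum>a\<in>Basis. \<Sum>b\<in>Basis. ?H a b * (((u \<odot> x) \<bullet> a) * ((u \<odot> x) \<bullet> b))) =
    (\<Sum>a\<in>Basis. \<Sum>u\<in>Basis. \<Sum>b\<in>Basis. ?H a b * (((u \<odot> x) \<bullet> a) * ((u \<odot> x) \<bullet> b)))"
    by (rule sum.swap)
  also have "\<dots> = (\<Sum>a\<in>Basis. \<Sum>b\<in>Basis. ?H a b * (\<Sum>u\<in>Basis. ((u \<odot> x) \<bullet> a) * ((u \<odot> x) \<bullet> b)))"
    unfolding sum_distrib_left by (rule sum.cong[OF refl]) (rule sum.swap)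
  also have "\<dots> = Hx / 2 + tr x / 2 * HL"
    unfolding sumu Hx_def HL_def sum_divide_distrib sum_distrib_left sum.distrib[symmetric]
    by (intro sum.cong refl) (simp add: field_simps)
  also have "(\<Sum>u\<in>Basis. \<Sum>b\<in>Basis. ?d b * ((u \<odot> (u \<odot> x)) \<bullet> b)) =
    (\<Sum>b\<in>Basis. ?d b * ((\<Sum>u\<in>Basis. u \<odot> (u \<odot> x)) \<bullet> b))"
    unfolding inner_sum_left sum_distrib_left by (rule sum.swap)
  also have "\<dots> = (1 + (rk - 2) * lam / 2) * dx + lam / 2 * tr x * de"
    unfolding casimir dx_def de_def sum_distrib_left sum.distrib[symmetric]
    by (intro sum.cong refl) (simp add: inner_add_left trace_inner algebra_simps)
  finally have 1: "(\<Sum>u\<in>Basis. deriv (deriv (\<lambda>s. F (blinfun_exp (mult_op u) s x))) 0) =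
    Hx / 2 + tr x / 2 * HL + ((1 + (rk - 2) * lam / 2) * dx + lam / 2 * tr x * de)" .
  \<comment> \<open>\<open>mult_op e\<close> is the identity, so its curve is the dilation exp(s) x;
    its derivatives remove the surplus terms \<open>Hx\<close> and \<open>dx\<close> of the sum over
    \<open>u\<close>.\<close>
  have 2: "deriv (deriv (\<lambda>s. F (blinfun_exp (mult_op e) s x))) 0 = Hx + dx"
    unfolding D(2) by (simp add: Hx_def dx_def unit_left)
  have 3: "deriv (\<lambda>s. F (blinfun_exp (mult_op e) s x)) 0 = dx"
    unfolding D(1) by (simp add: dx_def unit_left)
  have 4: "e \<bullet> bessel_operator (\<odot>) lam F x = HL + lam * de"
    by (simp add: unit_bessel_operator HL_def de_def)
  show ?thesis unfolding 1 2 3 4 by (simp add: field_simps)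
qed

text \<open>The exponential curves stay in the orbit and, for small s, in both neighbourhoods, so
  the extensions agree along them. The factor tr x > 0 then cancels.\<close>

lemma bessel_operator_extension_unique:
  assumes c: "primitive c" "x \<in> orbit c"
    and F: "C2_extension (orbit c) f x F" and G: "C2_extension (orbit c) f x G"
  shows "e \<bullet> bessel_operator (\<odot>) lam F x = e \<bullet> bessel_operator (\<odot>) lam G x"
proof -
  obtain U where U: "open U" "x \<in> U" "C2_on U F" "\<And>z. z \<in> U \<Longrightarrow> z \<in> orbit c \<Longrightarrow> F z = f z"
    using F by (auto simp: C2_extension_def)
  obtain V where V: "open V" "x \<in> V" "C2_on V G" "\<And>z. z \<in> V \<Longrightarrow> z \<in> orbit c \<Longrightarrow> G z = f z"
    using G by (auto simp: C2_extension_def)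
  have ev: "eventually (\<lambda>s. F (blinfun_exp (mult_op u) s x) = G (blinfun_exp (mult_op u) s x)) (nhds 0)" for u
  proof -
    have "open ((\<lambda>s. blinfun_exp (mult_op u) s x) -` (U \<inter> V))"
      by (intro open_vimage open_Int U V continuous_intros continuous_on_blinfun_exp)
    moreover have "0 \<in> (\<lambda>s. blinfun_exp (mult_op u) s x) -` (U \<inter> V)" using U V by simp
    ultimately have "eventually (\<lambda>s. s \<in> (\<lambda>s. blinfun_exp (mult_op u) s x) -` (U \<inter> V)) (nhds 0)"
      by (rule eventually_nhds_in_open)
    then show ?thesis
      by (rule eventually_mono) (use U(4) V(4) min_orbit_exp[OF structure_lie_mult c(2)] in auto)
  qed
  have 1: "deriv (\<lambda>s. F (blinfun_exp (mult_op u) s x)) 0 = deriv (\<lambda>s. G (blinfun_exp (mult_op u) s x)) 0" for u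
    using deriv_cong_ev[OF ev refl] .
  have 2: "deriv (deriv (\<lambda>s. F (blinfun_exp (mult_op u) s x))) 0 = deriv (deriv (\<lambda>s. G (blinfun_exp (mult_op u) s x))) 0" for u
  proof (rule deriv_cong_ev[OF _ refl])
    \<comment> \<open>Agreement near 0 is agreement near every point close to 0, so the first
      derivatives agree as functions and can be differentiated once more.\<close>
    have "eventually (\<lambda>t. eventually (\<lambda>s. F (blinfun_exp (mult_op u) s x) = G (blinfun_exp (mult_op u) s x)) (nhds t)) (nhds 0)"
      using ev by (simp add: eventually_eventually)
    then show "eventually (\<lambda>t. deriv (\<lambda>s. F (blinfun_exp (mult_op u) s x)) t = deriv (\<lambda>s. G (blinfun_exp (mult_op u) s x)) t) (nhds 0)"
      by (rule eventually_mono) (rule deriv_cong_ev[OF _ refl])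
  qed
  have "tr x / 2 * (e \<bullet> bessel_operator (\<odot>) lam F x) = tr x / 2 * (e \<bullet> bessel_operator (\<odot>) lam G x)"
    unfolding bessel_operator_tangential[OF c U(1-3)] bessel_operator_tangential[OF c V(1-3)] 1 2 ..
  then show ?thesis using orbit_trace_pos[OF c] by simp
qed

section \<open>Derivatives of the heat kernel and the heat equation\<close>

lemma heat_kernel_eq:
  "heat t x y =
    (2 * t) powr (- (rk * lam)) * exp (- (1 / t) * (x \<bullet> e + y \<bullet> e)) * bessel_B lam ((x \<bullet> y) / t\<^sup>2)"
  by (simp add: heat_kernel_def trace_inner power2_eq_square divide_inverse mult_ac)

lemma heat_kernel_derivatives:
  fixes t y
  assumes t: "t > 0"
  defines "F \<equiv> \<lambda>x. heat t x y"
    and "\<psi> \<equiv> \<lambda>x. (2 * t) powr (- (rk * lam)) * exp (- (1 / t) * (x \<bullet> e + y \<bullet> e))"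
    and "z \<equiv> \<lambda>x. (x \<bullet> y) / t\<^sup>2"
  shows "(F has_derivative (\<lambda>h. \<psi> x * (bessel_B1 lam (z x) * ((h \<bullet> y) / t\<^sup>2) - bessel_B lam (z x) * ((h \<bullet> e) / t)))) (at x)"
    and "(partial_deriv F b has_derivative (\<lambda>h. \<psi> x *
       (bessel_B2 lam (z x) * ((h \<bullet> y) / t\<^sup>2 * ((b \<bullet> y) / t\<^sup>2))
        - bessel_B1 lam (z x) * ((h \<bullet> y) / t\<^sup>2 * ((b \<bullet> e) / t) + (h \<bullet> e) / t * ((b \<bullet> y) / t\<^sup>2))
        + bessel_B lam (z x) * ((h \<bullet> e) / t * ((b \<bullet> e) / t))))) (at x)"
proof -
  have dB: "((\<lambda>x. g (z x)) has_derivative (\<lambda>h. g' (z x) * ((h \<bullet> y) / t\<^sup>2))) (at x)"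
    if "\<And>s. (g has_real_derivative g' s) (at s)" for g g' :: "real \<Rightarrow> real" and x
  proof -
    have "(z has_derivative (\<lambda>h. (h \<bullet> y) / t\<^sup>2)) (at x)"
      unfolding z_def divide_inverse
      by (intro has_derivative_mult_left has_derivative_inner_left has_derivative_ident)
    from has_derivative_compose[OF this that[unfolded has_field_derivative_def]] show ?thesis .
  qed
  have d\<psi>: "(\<psi> has_derivative (\<lambda>h. \<psi> x * (- (h \<bullet> e) / t))) (at x)" for x
    unfolding \<psi>_def using t by (auto intro!: derivative_eq_intros simp: fun_eq_iff)
  have Feq: "F = (\<lambda>x. \<psi> x * bessel_B lam (z x))"
    by (simp add: F_def \<psi>_def z_def heat_kernel_eq)
  show 1: "(F has_derivative (\<lambda>h. \<psi> x * (bessel_B1 lam (z x) * ((h \<bullet> y) / t\<^sup>2) - bessel_B lam (z x) * ((h \<bullet> e) / t)))) (at x)" for x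
    unfolding Feq
    by (rule has_derivative_eq_rhs[OF has_derivative_mult[OF d\<psi> dB[OF bessel_B_derivative[OF lam_pos]]]])
      (simp add: fun_eq_iff algebra_simps)
  have p: "partial_deriv F b = (\<lambda>x. \<psi> x * (bessel_B1 lam (z x) * ((b \<bullet> y) / t\<^sup>2) - bessel_B lam (z x) * ((b \<bullet> e) / t)))"
    using frechet_derivative_at[OF 1, symmetric] by (simp add: fun_eq_iff)
  have d: "((\<lambda>x. \<psi> x * (bessel_B1 lam (z x) * ((b \<bullet> y) / t\<^sup>2) - bessel_B lam (z x) * ((b \<bullet> e) / t))) has_derivative
    (\<lambda>h. \<psi> x * (bessel_B2 lam (z x) * ((h \<bullet> y) / t\<^sup>2) * ((b \<bullet> y) / t\<^sup>2) - bessel_B1 lam (z x) * ((h \<bullet> y) / t\<^sup>2) * ((b \<bullet> e) / t))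
      + \<psi> x * (- (h \<bullet> e) / t) * (bessel_B1 lam (z x) * ((b \<bullet> y) / t\<^sup>2) - bessel_B lam (z x) * ((b \<bullet> e) / t)))) (at x)"
    by (intro has_derivative_mult d\<psi> has_derivative_diff has_derivative_mult_left
        dB bessel_B_derivative bessel_B1_derivative lam_pos)
  show "(partial_deriv F b has_derivative (\<lambda>h. \<psi> x *
       (bessel_B2 lam (z x) * ((h \<bullet> y) / t\<^sup>2 * ((b \<bullet> y) / t\<^sup>2))
        - bessel_B1 lam (z x) * ((h \<bullet> y) / t\<^sup>2 * ((b \<bullet> e) / t) + (h \<bullet> e) / t * ((b \<bullet> y) / t\<^sup>2))
        + bessel_B lam (z x) * ((h \<bullet> e) / t * ((b \<bullet> e) / t))))) (at x)"
    unfolding p by (rule has_derivative_eq_rhs[OF d]) (simp add: fun_eq_iff algebra_simps)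
qed

lemma heat_kernel_C2:
  assumes t: "t > 0"
  shows "C2_on U (\<lambda>x. heat t x y)"
proof -
  note D = heat_kernel_derivatives[OF t, of y]
  have H: "hessian (\<lambda>x. heat t x y) x a b =
    (2 * t) powr (- (rk * lam)) * exp (- (1 / t) * (x \<bullet> e + y \<bullet> e)) *
       (bessel_B2 lam ((x \<bullet> y) / t\<^sup>2) * ((a \<bullet> y) / t\<^sup>2 * ((b \<bullet> y) / t\<^sup>2))
        - bessel_B1 lam ((x \<bullet> y) / t\<^sup>2) * ((a \<bullet> y) / t\<^sup>2 * ((b \<bullet> e) / t) + (a \<bullet> e) / t * ((b \<bullet> y) / t\<^sup>2))
        + bessel_B lam ((x \<bullet> y) / t\<^sup>2) * ((a \<bullet> e) / t * ((b \<bullet> e) / t)))" for x a b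
    by (rule fun_cong[OF frechet_derivative_at[OF D(2), symmetric]])
  have z: "continuous_on U (\<lambda>x. (x \<bullet> y) / t\<^sup>2)" using t by (auto intro!: continuous_intros)
  have "continuous_on U (\<lambda>x. hessian (\<lambda>x. heat t x y) x a b)" for a b
    unfolding H
    by (intro continuous_intros z continuous_on_compose2[OF continuous_on_bessel(1)[OF lam_pos, of UNIV] z]
        continuous_on_compose2[OF continuous_on_bessel(2)[OF lam_pos, of UNIV] z]
        continuous_on_compose2[OF continuous_on_bessel(3)[OF lam_pos, of UNIV] z]) auto
  moreover have "(\<lambda>x. heat t x y) differentiable at x" for x
    using D(1) by (rule differentiableI)
  moreover have "partial_deriv (\<lambda>x. heat t x y) b differentiable at x" for b x
    using D(2) by (rule differentiableI)
  ultimately show ?thesis unfolding C2_on_def by blast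
qed

lemma sum_basis_form:
  "(\<Sum>a\<in>Basis. \<Sum>b\<in>Basis. ((a \<bullet> u) * (b \<bullet> w)) * ((x \<odot> a) \<bullet> b)) = u \<bullet> (x \<odot> w)"
proof -
  have "(\<Sum>a\<in>Basis. \<Sum>b\<in>Basis. ((a \<bullet> u) * (b \<bullet> w)) * ((x \<odot> a) \<bullet> b)) =
    (\<Sum>a\<in>Basis. (u \<bullet> a) * (\<Sum>b\<in>Basis. (w \<bullet> b) * ((x \<odot> a) \<bullet> b)))"
    unfolding sum_distrib_left by (simp add: inner_commute[of u] inner_commute[of w] mult_ac)
  also have "\<dots> = (\<Sum>a\<in>Basis. (u \<bullet> a) * (w \<bullet> (x \<odot> a)))" by (simp add: euclidean_inner[symmetric])
  also have "\<dots> = (\<Sum>a\<in>Basis. (u \<bullet> a) * ((x \<odot> w) \<bullet> a))"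
    by (intro sum.cong refl arg_cong2[of _ _ _ _ "(*)"]) (simp add: inner_assoc inner_commute[of w])
  also have "\<dots> = u \<bullet> (x \<odot> w)" by (simp add: euclidean_inner[symmetric])
  finally show ?thesis .
qed

text \<open>Since \<open>y\<close> is on the orbit, (y|xy) = tr(y) (x|y): the B'' term and the
  first-order term in B' acquire the common factor (y|e), and Bessel's equation merges them into
  B.\<close>

lemma bessel_operator_heat_kernel:
  assumes c: "primitive c" "x \<in> orbit c" "y \<in> orbit c" and t: "t > 0"
  shows "e \<bullet> bessel_operator (\<odot>) lam (\<lambda>x. heat t x y) x =
    (2 * t) powr (- (rk * lam)) * exp (- (1 / t) * (x \<bullet> e + y \<bullet> e)) *
     (((x \<bullet> e + y \<bullet> e) / t\<^sup>2 - rk * lam / t) * bessel_B lam ((x \<bullet> y) / t\<^sup>2)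
       - 2 * (x \<bullet> y) / t ^ 3 * bessel_B1 lam ((x \<bullet> y) / t\<^sup>2))"
proof -
  note D = heat_kernel_derivatives[OF t, of y]
  define P where "P = (2 * t) powr (- (rk * lam)) * exp (- (1 / t) * (x \<bullet> e + y \<bullet> e))"
  define z where "z = (x \<bullet> y) / t\<^sup>2"
  define k1 where "k1 = P * bessel_B2 lam z / t ^ 4"
  define k2 where "k2 = P * bessel_B1 lam z / t ^ 3"
  define k3 where "k3 = P * bessel_B lam z / t\<^sup>2"
  let ?F = "\<lambda>x. heat t x y"
  have H: "hessian ?F x a b = k1 * ((a \<bullet> y) * (b \<bullet> y)) - k2 * ((a \<bullet> y) * (b \<bullet> e)) - k2 * ((a \<bullet> e) * (b \<bullet> y)) + k3 * ((a \<bullet> e) * (b \<bullet> e))" for a b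
    unfolding fun_cong[OF frechet_derivative_at[OF D(2), symmetric], of b x a] k1_def k2_def k3_def P_def z_def
    using t by (simp add: field_simps power2_eq_square power3_eq_cube power4_eq_xxxx)
  have d: "partial_deriv ?F b x = P * bessel_B1 lam z / t\<^sup>2 * (y \<bullet> b) - P * bessel_B lam z / t * (e \<bullet> b)" for b
    unfolding fun_cong[OF frechet_derivative_at[OF D(1), symmetric], of x b] P_def z_def
    by (simp add: inner_commute algebra_simps)
  have "(\<Sum>a\<in>Basis. \<Sum>b\<in>Basis. hessian ?F x a b * ((x \<odot> a) \<bullet> b)) =
    k1 * (y \<bullet> (x \<odot> y)) - k2 * (y \<bullet> (x \<odot> e)) - k2 * (e \<bullet> (x \<odot> y)) + k3 * (e \<bullet> (x \<odot> e))"
    unfolding H sum_basis_form[symmetric]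
    by (simp add: algebra_simps sum.distrib sum_subtractf sum_distrib_left)
  also have "y \<bullet> (x \<odot> y) = (y \<bullet> e) * (x \<bullet> y)"
  proof -
    have "y \<bullet> (x \<odot> y) = (y \<odot> y) \<bullet> x" by (metis inner_assoc inner_commute prod_commute)
    then show ?thesis using orbit_square[OF c(1,3)] by (simp add: trace_inner inner_commute)
  qed
  also have "y \<bullet> (x \<odot> e) = x \<bullet> y" by (simp add: unit_right inner_commute)
  also have "e \<bullet> (x \<odot> y) = x \<bullet> y" using inner_unit[of x y] by (simp add: inner_commute)
  also have "e \<bullet> (x \<odot> e) = x \<bullet> e" by (simp add: unit_right inner_commute)
  finally have 1: "(\<Sum>a\<in>Basis. \<Sum>b\<in>Basis. hessian ?F x a b * ((x \<odot> a) \<bullet> b)) =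
    k1 * ((y \<bullet> e) * (x \<bullet> y)) - k2 * (x \<bullet> y) - k2 * (x \<bullet> y) + k3 * (x \<bullet> e)" .
  have "(\<Sum>b\<in>Basis. partial_deriv ?F b x * (e \<bullet> b)) =
    P * bessel_B1 lam z / t\<^sup>2 * (\<Sum>b\<in>Basis. (y \<bullet> b) * (e \<bullet> b)) - P * bessel_B lam z / t * (\<Sum>b\<in>Basis. (e \<bullet> b) * (e \<bullet> b))"
    unfolding d sum_distrib_left sum_subtractf[symmetric] by (intro sum.cong refl) (simp add: algebra_simps)
  then have 2: "(\<Sum>b\<in>Basis. partial_deriv ?F b x * (e \<bullet> b)) = P * bessel_B1 lam z / t\<^sup>2 * (y \<bullet> e) - P * bessel_B lam z / t * rk"
    by (simp add: euclidean_inner[symmetric] rank_inner)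
  have "k1 * ((y \<bullet> e) * (x \<bullet> y)) + lam * (P * bessel_B1 lam z / t\<^sup>2 * (y \<bullet> e)) =
    P * (y \<bullet> e) / t\<^sup>2 * (z * bessel_B2 lam z + lam * bessel_B1 lam z)"
    using t by (simp add: k1_def z_def field_simps power2_eq_square power4_eq_xxxx)
  also have "\<dots> = P * (y \<bullet> e) / t\<^sup>2 * bessel_B lam z" by (simp add: bessel_ode[OF lam_pos])
  finally have 3: "k1 * ((y \<bullet> e) * (x \<bullet> y)) = P * (y \<bullet> e) / t\<^sup>2 * bessel_B lam z - lam * (P * bessel_B1 lam z / t\<^sup>2 * (y \<bullet> e))"
    by simp
  show ?thesis
    unfolding unit_bessel_operator 1 2 3 k2_def k3_def P_def[symmetric] z_def[symmetric]
    by (simp add: algebra_simps add_divide_distrib)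
qed

lemma heat_kernel_time_derivative:
  assumes t: "t > 0"
  shows "((\<lambda>t. heat t x y) has_real_derivative
    (2 * t) powr (- (rk * lam)) * exp (- (1 / t) * (x \<bullet> e + y \<bullet> e)) *
     (((x \<bullet> e + y \<bullet> e) / t\<^sup>2 - rk * lam / t) * bessel_B lam ((x \<bullet> y) / t\<^sup>2)
       - 2 * (x \<bullet> y) / t ^ 3 * bessel_B1 lam ((x \<bullet> y) / t\<^sup>2))) (at t)"
proof -
  define q where "q = rk * lam"
  define A where "A = x \<bullet> e + y \<bullet> e"
  have 1: "((\<lambda>t. (2 * t) powr (- q)) has_real_derivative (2 * t) powr (- q) * (- q / t)) (at t)"
    using t by (auto intro!: derivative_eq_intros simp: powr_diff field_simps)
  have 2: "((\<lambda>t. exp (- (1 / t) * A)) has_real_derivative exp (- (1 / t) * A) * (A / t\<^sup>2)) (at t)"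
    using t by (auto intro!: derivative_eq_intros simp: power2_eq_square field_simps)
  have "((\<lambda>t. (x \<bullet> y) / t\<^sup>2) has_real_derivative - 2 * (x \<bullet> y) / t ^ 3) (at t)"
    using t by (auto intro!: derivative_eq_intros simp: power2_eq_square power3_eq_cube field_simps)
  from DERIV_chain2[OF bessel_B_derivative[OF lam_pos] this]
  have 3: "((\<lambda>t. bessel_B lam ((x \<bullet> y) / t\<^sup>2)) has_real_derivative
    bessel_B1 lam ((x \<bullet> y) / t\<^sup>2) * (- 2 * (x \<bullet> y) / t ^ 3)) (at t)" .
  show ?thesis
    unfolding heat_kernel_eq q_def[symmetric] A_def[symmetric]
    by (rule DERIV_cong[OF DERIV_mult[OF DERIV_mult[OF 1 2] 3]]) (simp add: algebra_simps)
qed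

text \<open>The kernel formula makes sense on the whole algebra and is its own C^2 extension; the
  operator and the time derivative give the same closed expression.\<close>

lemma heat_equation:
  assumes c: "primitive c" "x \<in> orbit c" "y \<in> orbit c" and t: "t > 0"
  shows "\<exists>D. has_bessel_e (\<odot>) e lam c (\<lambda>x. heat t x y) x D \<and>
    ((\<lambda>t. heat t x y) has_real_derivative D) (at t)"
proof -
  let ?F = "\<lambda>x. heat t x y"
  have ext: "C2_extension (orbit c) ?F x ?F"
    using heat_kernel_C2[OF t] by (auto simp: C2_extension_def intro!: exI[of _ UNIV])
  then have "has_bessel_e (\<odot>) e lam c ?F x (e \<bullet> bessel_operator (\<odot>) lam ?F x)"
    unfolding has_bessel_e_def using bessel_operator_extension_unique[OF c(1,2)] by blast
  then show ?thesis
    using heat_kernel_time_derivative[OF t] unfolding bessel_operator_heat_kernel[OF c t] by blast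
qed

end

section \<open>The heat kernel\<close>

context bessel_orbit
begin

lemma heat_kernel_trace:
  "heat t x y =
    (2 * t) powr (- (rk * lam)) * exp (- (1 / t) * (tr x + tr y)) * bessel_B lam ((x \<bullet> y) / t\<^sup>2)"
  by (simp add: heat_kernel_eq trace_inner)

lemma heat_kernel_spectral:
  assumes x: "x \<in> \<Xi>" and y: "y \<in> \<Xi>" and t: "t > 0"
  shows "has_bochner_integral \<mu> (\<lambda>\<xi>. exp (- t * tr \<xi>) * bessel_B lam (- (x \<bullet> \<xi>)) * bessel_B lam (- (y \<bullet> \<xi>)))
    (2 powr (2 * rk * lam) * heat t x y)"
proof -
  have "(2 / t) powr (rk * lam) = 2 powr (2 * rk * lam) * (2 * t) powr (- (rk * lam))"
  proof -
    have "2 powr (2 * rk * lam) = 2 powr (rk * lam) * 2 powr (rk * lam)"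
      by (simp only: powr_add[symmetric]) (simp add: algebra_simps)
    then show ?thesis using t by (simp add: powr_divide powr_mult powr_minus field_simps)
  qed
  moreover have "(-1 * tr x + -1 * tr y) / t = - (1 / t) * (tr x + tr y)"
    by (simp add: diff_divide_distrib add_divide_distrib)
  ultimately have "(2 / t) powr (rk * lam) * (exp ((-1 * tr x + -1 * tr y) / t) * bessel_B lam (-1 * -1 * (x \<bullet> y) / t\<^sup>2))
    = 2 powr (2 * rk * lam) * heat t x y"
    unfolding heat_kernel_trace by simp
  moreover note orbit_integral[OF x y t, of "-1" "-1"]
  ultimately show ?thesis by (simp add: mult.assoc)
qed

text \<open>With r = 0 the second Bessel factor of \<open>orbit_integral\<close> is B(0) = 1; its
  vector is taken to be \<open>x\<close>. The exponential of tr(x)/t cancels the one in the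
  kernel.\<close>

lemma heat_kernel_total:
  assumes x: "x \<in> \<Xi>" and t: "t > 0"
  shows "has_bochner_integral \<mu> (\<lambda>y. heat t x y) 1"
proof -
  define C where "C = (2 * t) powr (- (rk * lam)) * exp (- (tr x / t))"
  have t': "1 / t > 0" using t by simp
  have "has_bochner_integral \<mu>
      (\<lambda>y. C * (exp (- (1 / t) * tr y) * (bessel_B lam (1 / t\<^sup>2 * (x \<bullet> y)) * bessel_B lam (0 * (x \<bullet> y)))))
      (C * ((2 / (1 / t)) powr (rk * lam) * (exp ((1 / t\<^sup>2 * tr x + 0 * tr x) / (1 / t)) * bessel_B lam (1 / t\<^sup>2 * 0 * (x \<bullet> x) / (1 / t)\<^sup>2))))"
    by (intro has_bochner_integral_mult_right orbit_integral x t')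
  moreover have "C * (exp (- (1 / t) * tr y) * (bessel_B lam (1 / t\<^sup>2 * (x \<bullet> y)) * bessel_B lam (0 * (x \<bullet> y))))
     = heat t x y" for y
  proof -
    have "exp (- (1 / t) * (tr x + tr y)) = exp (- (tr x / t)) * exp (- (1 / t) * tr y)"
      by (simp add: exp_add[symmetric] add_divide_distrib algebra_simps)
    then show ?thesis by (simp add: heat_kernel_trace C_def bessel_B_0[OF lam_pos])
  qed
  moreover have "C * ((2 / (1 / t)) powr (rk * lam) * (exp ((1 / t\<^sup>2 * tr x + 0 * tr x) / (1 / t)) * bessel_B lam (1 / t\<^sup>2 * 0 * (x \<bullet> x) / (1 / t)\<^sup>2))) = 1"
  proof -
    have "(1 / t\<^sup>2 * tr x + 0 * tr x) / (1 / t) = tr x / t" using t by (simp add: power2_eq_square)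
    then show ?thesis
      using t by (simp add: C_def bessel_B_0[OF lam_pos] powr_minus exp_minus field_simps power2_eq_square)
  qed
  ultimately show ?thesis by simp
qed

lemma heat_kernel_convolution:
  assumes x: "x \<in> \<Xi>" and y: "y \<in> \<Xi>" and s: "s > 0" and t: "t > 0"
  shows "has_bochner_integral \<mu> (\<lambda>z. heat s x z * heat t y z)
    (heat (s + t) x y)"
proof -
  define q where "q = rk * lam"
  define C where "C = (2 * s) powr (- q) * (2 * t) powr (- q) * exp (- (tr x / s) - tr y / t)"
  define \<tau> where "\<tau> = 1 / s + 1 / t"
  have \<tau>: "\<tau> > 0" using s t by (simp add: \<tau>_def add_pos_pos)
  have \<tau>_eq: "\<tau> = (s + t) / (s * t)" using s t by (simp add: \<tau>_def field_simps)
  have "has_bochner_integral \<mu>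
      (\<lambda>z. C * (exp (- \<tau> * tr z) * (bessel_B lam (1 / s\<^sup>2 * (x \<bullet> z)) * bessel_B lam (1 / t\<^sup>2 * (y \<bullet> z)))))
      (C * ((2 / \<tau>) powr (rk * lam) * (exp ((1 / s\<^sup>2 * tr x + 1 / t\<^sup>2 * tr y) / \<tau>) * bessel_B lam (1 / s\<^sup>2 * (1 / t\<^sup>2) * (x \<bullet> y) / \<tau>\<^sup>2))))"
    by (intro has_bochner_integral_mult_right orbit_integral x y \<tau>)
  moreover have "C * (exp (- \<tau> * tr z) * (bessel_B lam (1 / s\<^sup>2 * (x \<bullet> z)) * bessel_B lam (1 / t\<^sup>2 * (y \<bullet> z))))
     = heat s x z * heat t y z" for z
  proof -
    have "exp (- (tr x / s) - tr y / t) * exp (- \<tau> * tr z) =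
      exp (- (1 / s) * (tr x + tr z)) * exp (- (1 / t) * (tr y + tr z))"
      by (simp add: exp_add[symmetric] \<tau>_def algebra_simps add_divide_distrib)
    then show ?thesis by (simp add: heat_kernel_trace C_def q_def mult_ac)
  qed
  moreover have "C * ((2 / \<tau>) powr (rk * lam) * (exp ((1 / s\<^sup>2 * tr x + 1 / t\<^sup>2 * tr y) / \<tau>) * bessel_B lam (1 / s\<^sup>2 * (1 / t\<^sup>2) * (x \<bullet> y) / \<tau>\<^sup>2)))
     = heat (s + t) x y"
  proof -
    have B: "1 / s\<^sup>2 * (1 / t\<^sup>2) * (x \<bullet> y) / \<tau>\<^sup>2 = (x \<bullet> y) / (s + t)\<^sup>2"
      unfolding \<tau>_eq using s t by (simp add: power_divide power_mult_distrib)
    \<comment> \<open>The part in \<open>x\<close> is 1/s - 1/(s^2 \<tau>) = 1/(s + t); the part in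
      \<open>y\<close> is the same with s and t exchanged.\<close>
    have "- (tr x / s) - tr y / t + (1 / s\<^sup>2 * tr x + 1 / t\<^sup>2 * tr y) / \<tau> = - (1 / (s + t)) * (tr x + tr y)"
    proof -
      have a: "- (a / s) + (1 / s\<^sup>2 * a) / \<tau> = - (1 / (s + t)) * a" if "s > 0" "t > 0" "\<tau> = (s + t) / (s * t)" for a s t :: real
      proof -
        have "s + t \<noteq> 0" using that by simp
        have "(1 / s\<^sup>2 * a) / \<tau> = t * a / (s * (s + t))"
          unfolding that(3) using that(1,2) by (simp add: power2_eq_square)
        moreover have "a / s - t * a / (s * (s + t)) = a / (s + t)"
          using that \<open>s + t \<noteq> 0\<close> by (simp add: divide_simps) (simp add: algebra_simps)
        ultimately show ?thesis by simp
      qed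
      have "\<tau> = (t + s) / (t * s)" by (simp add: \<tau>_eq add.commute mult.commute)
      from a[OF s t \<tau>_eq, of "tr x"] a[OF t s this, of "tr y"]
      show ?thesis by (simp add: add_divide_distrib add.commute distrib_left)
    qed
    then have E: "exp (- (tr x / s) - tr y / t) * exp ((1 / s\<^sup>2 * tr x + 1 / t\<^sup>2 * tr y) / \<tau>) = exp (- (1 / (s + t)) * (tr x + tr y))"
      by (simp only: exp_add[symmetric])
    have P: "(2 * s) powr (- q) * (2 * t) powr (- q) * (2 / \<tau>) powr q = (2 * (s + t)) powr (- q)"
    proof -
      have gen: "a powr (- q) * u powr q = (a / u) powr (- q)" for a u :: real
        by (simp add: powr_divide powr_minus_divide)
      have "(2 * s) powr (- q) * (2 * t) powr (- q) = (2 * s * (2 * t)) powr (- q)"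
        using s t by (intro powr_mult[symmetric])
      also have "\<dots> * (2 / \<tau>) powr q = (2 * s * (2 * t) / (2 / \<tau>)) powr (- q)"
        by (rule gen)
      also have "2 * s * (2 * t) / (2 / \<tau>) = 2 * (s + t)"
        unfolding \<tau>_eq using s t by simp
      finally show ?thesis .
    qed
    have "C * ((2 / \<tau>) powr q * (exp ((1 / s\<^sup>2 * tr x + 1 / t\<^sup>2 * tr y) / \<tau>) * b)) =
      ((2 * s) powr (- q) * (2 * t) powr (- q) * (2 / \<tau>) powr q) *
      (exp (- (tr x / s) - tr y / t) * exp ((1 / s\<^sup>2 * tr x + 1 / t\<^sup>2 * tr y) / \<tau>)) * b" for b
      by (simp only: C_def mult_ac)
    then show ?thesis unfolding B q_def[symmetric] by (simp only: P E heat_kernel_trace q_def[symmetric])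
  qed
  ultimately show ?thesis by simp
qed

end

theorem theorem5p2:
  fixes jprod :: "'a::euclidean_space \<Rightarrow> 'a \<Rightarrow> 'a"
    and e c\<^sub>1 :: 'a
    and d :: nat
    and lam :: real
    and \<kappa> :: "('a \<Rightarrow>\<^sub>L 'a) measure"
  assumes "simple_euclidean_jordan_algebra jprod e"
    and trace_form: "\<And>x y. x \<bullet> y = jordan_trace jprod e (jprod x y)"
    and "jordan_rank jprod e > 1 \<Longrightarrow> \<exists>W \<in> off_diagonal_peirce_spaces jprod e. d = dim W"
    and "jordan_rank jprod e > 1 \<Longrightarrow> lam = real d / 2"
    and "jordan_rank jprod e = 1 \<Longrightarrow> lam > 0"
    and "primitive_idempotent jprod c\<^sub>1"
    and "normalized_haar (structure_group_K jprod e) \<kappa>"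
  shows "let r = real (jordan_rank jprod e); tr = jordan_trace jprod e;
             \<Xi> = min_orbit jprod c\<^sub>1; \<mu> = orbit_measure jprod e lam c\<^sub>1 \<kappa>;
             B = bessel_B lam; \<Gamma> = heat_kernel jprod e lam
         in \<forall>s>0. \<forall>t>0. \<forall>x\<in>\<Xi>. \<forall>y\<in>\<Xi>.
              (integrable \<mu> (\<lambda>\<xi>. exp (- t * tr \<xi>) * B (- (x \<bullet> \<xi>)) * B (- (y \<bullet> \<xi>))) \<and>
               \<Gamma> t x y = 2 powr (- (2 * r * lam)) *
                 (\<integral>\<xi>. exp (- t * tr \<xi>) * B (- (x \<bullet> \<xi>)) * B (- (y \<bullet> \<xi>)) \<partial>\<mu>)) \<and>
              (integrable \<mu> (\<lambda>y. \<Gamma> t x y) \<and> (\<integral>y. \<Gamma> t x y \<partial>\<mu>) = 1) \<and>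
              (integrable \<mu> (\<lambda>z. \<Gamma> s x z * \<Gamma> t y z) \<and>
               (\<integral>z. \<Gamma> s x z * \<Gamma> t y z \<partial>\<mu>) = \<Gamma> (s + t) x y) \<and>
              (\<exists>D. has_bessel_e jprod e lam c\<^sub>1 (\<lambda>x. \<Gamma> t x y) x D \<and>
                   ((\<lambda>t. \<Gamma> t x y) has_real_derivative D) (at t))"
proof -
  interpret simple_euclidean_jordan_algebra jprod e by fact
  have offdiag: "\<exists>C c c'. frame C \<and> c \<in> C \<and> c' \<in> C \<and> c \<noteq> c' \<and> real (dim (peirce c c')) = 2 * lam"
    if rk1: "jordan_rank jprod e > 1"
  proof -
    obtain W where W: "W \<in> off_diagonal_peirce_spaces jprod e" "d = dim W"
      using assms(3)[OF rk1] by blast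
    then obtain C c c' where C: "frame C" "c \<in> C" "c' \<in> C" "c \<noteq> c'" "W = peirce c c'"
      unfolding off_diagonal_peirce_spaces_def peirce_def by blast
    then have "real (dim (peirce c c')) = 2 * lam" using W assms(4)[OF rk1] by simp
    then show ?thesis using C by blast
  qed
  \<comment> \<open>For rank above 1 this rests on simplicity, which makes every joint Peirce space
    nonzero.\<close>
  have lam: "lam > 0"
  proof (cases "jordan_rank jprod e > 1")
    case True
    then obtain C c c' where "frame C" "c \<in> C" "c' \<in> C" "c \<noteq> c'" "real (dim (peirce c c')) = 2 * lam"
      using offdiag by blast
    then show ?thesis using dim_peirce_pos[of C c c'] by linarith
  next
    case False
    obtain C where "frame C" using spectral by blast
    then have "jordan_rank jprod e = 1" using False jordan_rank_eq[of C] frame_card_pos[of C] by linarith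
    then show ?thesis using assms(5) by blast
  qed
  \<comment> \<open>The hypothesis concerns one Peirce space of one frame.
    \<open>dim_eq_peirce\<close> gives the same equation for both frames, and R(R - 1) is
    nonzero.\<close>
  have dims: "real (dim (peirce c c')) = 2 * lam"
    if C: "frame C" "c \<in> C" "c' \<in> C" "c \<noteq> c'" for C c c'
  proof -
    have "card {c, c'} \<le> card C" using C frameD(1)[OF C(1)] by (intro card_mono) auto
    then have rk: "jordan_rank jprod e > 1" using C jordan_rank_eq[OF C(1)] by simp
    then obtain D b b' where D: "frame D" "b \<in> D" "b' \<in> D" "b \<noteq> b'" "real (dim (peirce b b')) = 2 * lam"
      using offdiag by blast
    define R where "R = real (card C)"
    have cD: "real (card D) = R" using jordan_rank_eq[OF C(1)] jordan_rank_eq[OF D(1)] by (simp add: R_def)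
    have "R * (R - 1) * real (dim (peirce c c')) = R * (R - 1) * real (dim (peirce b b'))"
      using dim_eq_peirce[OF C] dim_eq_peirce[OF D(1-4)] unfolding cD R_def[symmetric] by linarith
    moreover have "R > 1" using rk jordan_rank_eq[OF C(1)] by (simp add: R_def)
    ultimately show ?thesis using D(5) by simp
  qed
  interpret bessel_orbit jprod e lam c\<^sub>1 \<kappa>
    by unfold_locales (use trace_form lam dims assms(6,7) in auto)
  have scale: "2 powr (- (2 * rk * lam)) * (2 powr (2 * rk * lam) * g) = g" for g :: real
    by (simp add: powr_minus)
  show ?thesis
    unfolding Let_def
  proof (intro allI impI ballI)
    fix s t :: real and x y
    assume *: "s > 0" "t > 0" "x \<in> \<Xi>" "y \<in> \<Xi>"
    note 1 = heat_kernel_spectral[OF *(3,4,2)] heat_kernel_total[OF *(3,2)] heat_kernel_convolution[OF *(3,4,1,2)]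
    show "(integrable \<mu> (\<lambda>\<xi>. exp (- t * tr \<xi>) * bessel_B lam (- (x \<bullet> \<xi>)) * bessel_B lam (- (y \<bullet> \<xi>))) \<and>
        heat_kernel jprod e lam t x y = 2 powr (- (2 * rk * lam)) *
          (\<integral>\<xi>. exp (- t * tr \<xi>) * bessel_B lam (- (x \<bullet> \<xi>)) * bessel_B lam (- (y \<bullet> \<xi>)) \<partial>\<mu>)) \<and>
       (integrable \<mu> (\<lambda>y. heat_kernel jprod e lam t x y) \<and> (\<integral>y. heat_kernel jprod e lam t x y \<partial>\<mu>) = 1) \<and>
       (integrable \<mu> (\<lambda>z. heat_kernel jprod e lam s x z * heat_kernel jprod e lam t y z) \<and>
        (\<integral>z. heat_kernel jprod e lam s x z * heat_kernel jprod e lam t y z \<partial>\<mu>) = heat_kernel jprod e lam (s + t) x y) \<and>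
       (\<exists>D. has_bessel_e jprod e lam c\<^sub>1 (\<lambda>x. heat_kernel jprod e lam t x y) x D \<and>
          ((\<lambda>t. heat_kernel jprod e lam t x y) has_real_derivative D) (at t))"
      using 1 heat_equation[OF prim *(3,4,2)] unfolding has_bochner_integral_iff by (simp only: scale)
  qed
qed

end
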